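(* Suppose that $G$ is the fundamental group of a finite graph of groups where the vertex groups have the falsification by fellow traveler property and the edge groups are finite. Then $G$ has the falsification by fellow traveler property.
   Context: $X\subseteq G$ is a generating set of $G$ if every element of $G$ is a product of elements of $X$ (generation as a monoid; $X$ need not be closed under inverses). $|g|_X$ is the minimal length of a word over $X$ representing $g$; $d_X(g,h)=|g^{-1}h|_X$. $\Gamma(G,X)$ is the Cayley graph, with an edge labelled $x$ from $g$ to $gx$. A path $p$ of length $n=\ell(p)$ follows edges through vertices $p(0),\dots,p(n)$, and $p(m)=p(n)$ for $m\ge n$; it is geodesic if no path with the same endpoints is shorter. Paths $p,q$ asynchronously $K$-fellow travel if there are non-decreasing $\phi,\psi:\mathbb N\to\mathbb N$ with $d_X(p(t),q(\phi(t)))\le K$ and $d_X(p(\psi(t)),q(t))\le K$ for all $t\in\mathbb N$. For a finite generating set $X$, $(G,X)$ has the falsification by fellow traveler property if there is $K\ge0$ such that for every non-geodesic path $p$ in $\Gamma(G,X)$ there is a path $q$ with the same initial and terminal vertices, $\ell(q)<\ell(p)$, such that $p$ and $q$ asynchronously $K$-fellow travel. A group has the falsification by fellow traveler property if there is a finite generating set $X$ of it such that $(G,X)$ has the property. *)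

theory Defs
  imports
    "HOL-Algebra.Group"
    "Graph_Theory.Bidirected_Digraph"
    "Graph_Theory.Digraph_Component"
    "Graph_Theory.Arc_Walk"
begin

section \<open>Monoid generating sets and Cayley graphs\<close>

definition word_value :: "('g, 'm) monoid_scheme \<Rightarrow> 'g list \<Rightarrow> 'g" where
  "word_value G w = foldr (\<lambda>x y. x \<otimes>\<^bsub>G\<^esub> y) w \<one>\<^bsub>G\<^esub>"

text \<open>Generation is as a monoid: inverses of elements of \<open>X\<close> may not be used.\<close>

definition generating_set :: "('g, 'm) monoid_scheme \<Rightarrow> 'g set \<Rightarrow> bool" where
  "generating_set G X \<longleftrightarrow> X \<subseteq> carrier G \<and> carrier G \<subseteq> word_value G ` lists X"

definition word_length :: "('g, 'm) monoid_scheme \<Rightarrow> 'g set \<Rightarrow> 'g \<Rightarrow> nat" where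
  "word_length G X g = (LEAST n. \<exists>w \<in> lists X. word_value G w = g \<and> length w = n)"

text \<open>Not symmetric in general, since \<open>X\<close> need not be closed under inverses.\<close>

definition word_dist :: "('g, 'm) monoid_scheme \<Rightarrow> 'g set \<Rightarrow> 'g \<Rightarrow> 'g \<Rightarrow> nat" where
  "word_dist G X g h = word_length G X (inv\<^bsub>G\<^esub> g \<otimes>\<^bsub>G\<^esub> h)"

text \<open>The arc \<open>(g, x)\<close> is the edge with label \<open>x\<close> that starts at \<open>g\<close>.\<close>

definition cayley_graph :: "('g, 'm) monoid_scheme \<Rightarrow> 'g set \<Rightarrow> ('g, 'g \<times> 'g) pre_digraph" where
  "cayley_graph G X =
     \<lparr>verts = carrier G, arcs = carrier G \<times> X, tail = fst, head = (\<lambda>(g, x). g \<otimes>\<^bsub>G\<^esub> x)\<rparr>"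

definition geodesic :: "('v, 'e) pre_digraph \<Rightarrow> 'v \<Rightarrow> 'e list \<Rightarrow> 'v \<Rightarrow> bool" where
  "geodesic \<Gamma> u p v \<longleftrightarrow> pre_digraph.awalk \<Gamma> u p v \<and>
     \<not> (\<exists>q. pre_digraph.awalk \<Gamma> u q v \<and> length q < length p)"

text \<open>The vertex \<open>p(t)\<close> of a path \<open>p\<close> that starts at \<open>u\<close>; the path stays at its last vertex
  after time \<open>length p\<close>.\<close>

definition path_vertex :: "('v, 'e) pre_digraph \<Rightarrow> 'v \<Rightarrow> 'e list \<Rightarrow> nat \<Rightarrow> 'v" where
  "path_vertex \<Gamma> u p t = pre_digraph.awalk_verts \<Gamma> u p ! min t (length p)"


section \<open>Falsification by fellow traveler\<close>

definition async_fellow_travel ::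
    "('g, 'm) monoid_scheme \<Rightarrow> 'g set \<Rightarrow> nat \<Rightarrow> (nat \<Rightarrow> 'g) \<Rightarrow> (nat \<Rightarrow> 'g) \<Rightarrow> bool" where
  "async_fellow_travel G X K p q \<longleftrightarrow>
     (\<exists>\<phi> \<psi> :: nat \<Rightarrow> nat. mono \<phi> \<and> mono \<psi> \<and>
        (\<forall>t. word_dist G X (p t) (q (\<phi> t)) \<le> K \<and> word_dist G X (p (\<psi> t)) (q t) \<le> K))"

definition fftp_wrt :: "('g, 'm) monoid_scheme \<Rightarrow> 'g set \<Rightarrow> bool" where
  "fftp_wrt G X \<longleftrightarrow>
     (\<exists>K. \<forall>u p v. pre_digraph.awalk (cayley_graph G X) u p v \<and> \<not> geodesic (cayley_graph G X) u p v
        \<longrightarrow> (\<exists>q. pre_digraph.awalk (cayley_graph G X) u q v \<and> length q < length p \<and>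
              async_fellow_travel G X K
                (path_vertex (cayley_graph G X) u p) (path_vertex (cayley_graph G X) u q)))"

definition has_fftp :: "('g, 'm) monoid_scheme \<Rightarrow> bool" where
  "has_fftp G \<longleftrightarrow> (\<exists>X. finite X \<and> generating_set G X \<and> fftp_wrt G X)"


section \<open>Graphs of groups\<close>

text \<open>Every geometric edge of the underlying graph is a pair of arcs \<open>e\<close>, \<open>arc_rev e\<close>
  (as in Serre's \<open>Trees\<close>), and \<open>edge_emb e\<close> is the monomorphism from the edge group of \<open>e\<close> into
  the vertex group at the head of \<open>e\<close>.\<close>

record ('v, 'e, 'a, 'b) gog =
  base :: "('v, 'e) pre_digraph"
  arc_rev :: "'e \<Rightarrow> 'e"
  vertex_group :: "'v \<Rightarrow> 'a monoid"
  edge_group :: "'e \<Rightarrow> 'b monoid"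
  edge_emb :: "'e \<Rightarrow> 'b \<Rightarrow> 'a"

locale graph_of_groups =
  fixes \<G> :: "('v, 'e, 'a, 'b) gog"
  assumes bidirected: "bidirected_digraph (base \<G>) (arc_rev \<G>)"
    and conn: "Digraph_Component.connected (base \<G>)"
    and group_vertex: "v \<in> verts (base \<G>) \<Longrightarrow> group (vertex_group \<G> v)"
    and group_edge: "e \<in> arcs (base \<G>) \<Longrightarrow> group (edge_group \<G> e)"
    and edge_group_rev: "e \<in> arcs (base \<G>) \<Longrightarrow> edge_group \<G> (arc_rev \<G> e) = edge_group \<G> e"
    and emb_hom: "e \<in> arcs (base \<G>) \<Longrightarrow>
          edge_emb \<G> e \<in> hom (edge_group \<G> e) (vertex_group \<G> (head (base \<G>) e))"
    and emb_inj: "e \<in> arcs (base \<G>) \<Longrightarrow> inj_on (edge_emb \<G> e) (carrier (edge_group \<G> e))"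

text \<open>The fundamental group at a vertex \<open>v\<close> consists of the loops \<open>g\<^sub>0, e\<^sub>1, g\<^sub>1, \<dots>, e\<^sub>n, g\<^sub>n\<close> at
  \<open>v\<close> (with \<open>e\<^sub>1, \<dots>, e\<^sub>n\<close> a path in the underlying graph and each \<open>g\<^sub>i\<close> in the group of the vertex
  at which it is read), modulo the relations
  \<open>e \<cdot> edge_emb e h \<cdot> arc_rev e = edge_emb (arc_rev e) h\<close>.
  Such a loop is represented as \<open>(g\<^sub>0, [(e\<^sub>1, g\<^sub>1), \<dots>, (e\<^sub>n, g\<^sub>n)])\<close>.\<close>

type_synonym ('e, 'a) gpath = "'a \<times> ('e \<times> 'a) list"

definition gpaths :: "('v, 'e, 'a, 'b) gog \<Rightarrow> 'v \<Rightarrow> 'v \<Rightarrow> ('e, 'a) gpath set" where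
  "gpaths \<G> u v = {(a, s). pre_digraph.awalk (base \<G>) u (map fst s) v \<and>
     a \<in> carrier (vertex_group \<G> u) \<and>
     (\<forall>(e, b) \<in> set s. b \<in> carrier (vertex_group \<G> (head (base \<G>) e)))}"

text \<open>The first parameter of type \<open>'v\<close> is the initial vertex of the first path.\<close>

fun gpath_append ::
    "('v, 'e, 'a, 'b) gog \<Rightarrow> 'v \<Rightarrow> ('e, 'a) gpath \<Rightarrow> ('e, 'a) gpath \<Rightarrow> ('e, 'a) gpath" where
  "gpath_append \<G> u (a, []) (b, t) = (a \<otimes>\<^bsub>vertex_group \<G> u\<^esub> b, t)"
| "gpath_append \<G> u (a, (e, c) # s) q =
     (case gpath_append \<G> (head (base \<G>) e) (c, s) q of (c', s') \<Rightarrow> (a, (e, c') # s'))"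

inductive gpath_reduce ::
    "('v, 'e, 'a, 'b) gog \<Rightarrow> ('e, 'a) gpath \<Rightarrow> ('e, 'a) gpath \<Rightarrow> bool" for \<G> where
  here: "\<lbrakk>e \<in> arcs (base \<G>); h \<in> carrier (edge_group \<G> e)\<rbrakk> \<Longrightarrow>
     gpath_reduce \<G>
       (a, (e, edge_emb \<G> e h) # (arc_rev \<G> e, b) # s)
       (a \<otimes>\<^bsub>vertex_group \<G> (tail (base \<G>) e)\<^esub> edge_emb \<G> (arc_rev \<G> e) h
          \<otimes>\<^bsub>vertex_group \<G> (tail (base \<G>) e)\<^esub> b, s)"
| later: "gpath_reduce \<G> (c, s) (c', s') \<Longrightarrow>
     gpath_reduce \<G> (a, (e, c) # s) (a, (e, c') # s')"

text \<open>The generated equivalence is taken inside the set of paths from \<open>u\<close> to \<open>v\<close>, so that a chain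
  of reductions and expansions never leaves that set.\<close>

definition gpath_homotopy ::
    "('v, 'e, 'a, 'b) gog \<Rightarrow> 'v \<Rightarrow> 'v \<Rightarrow> (('e, 'a) gpath \<times> ('e, 'a) gpath) set" where
  "gpath_homotopy \<G> u v = {(p, q). p \<in> gpaths \<G> u v \<and> q \<in> gpaths \<G> u v \<and>
     equivclp (\<lambda>p' q'. p' \<in> gpaths \<G> u v \<and> q' \<in> gpaths \<G> u v \<and> gpath_reduce \<G> p' q') p q}"

definition fundamental_group ::
    "('v, 'e, 'a, 'b) gog \<Rightarrow> 'v \<Rightarrow> ('e, 'a) gpath set monoid" where
  "fundamental_group \<G> v =
     \<lparr>carrier = gpaths \<G> v v // gpath_homotopy \<G> v v,
      monoid.mult = (\<lambda>A B. \<Union>p \<in> A. \<Union>q \<in> B. gpath_homotopy \<G> v v `` {gpath_append \<G> v p q}),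
      monoid.one = gpath_homotopy \<G> v v `` {(\<one>\<^bsub>vertex_group \<G> v\<^esub>, [])}\<rparr>"

end

theory Submission
  imports Defs
begin

text \<open>Every vertex group \<open>v\<close> has a finite generating set \<open>Y v\<close> with the falsification by fellow
traveler property that contains the images of all edge groups at \<open>v\<close>: the property is inherited by
the balls of radius \<open>m \<ge> 1\<close> around the identity (\<open>word_fftp_ball\<close>), and these exhaust the group.
A spanning tree yields a map from paths to \<open>G\<close>: the vertex groups have homomorphisms \<open>\<iota> v\<close> to \<open>G\<close>,
and every arc \<open>e\<close> has an image \<open>t e\<close>, which is trivial along the tree
(\<open>fundamental_group_presentation\<close>). The generating set \<open>X\<close> of \<open>G\<close> consists of the images of the sets
\<open>Y v\<close> and of the nontrivial elements \<open>t e\<close>.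

A word over \<open>X\<close> can be read along a path in the graph of groups: its letters spell the labels at the
vertices and the arcs outside the tree, while arcs with trivial image are crossed without a letter.
Let \<open>w\<close> be a word that is not geodesic, read along a loop \<open>p\<close> at \<open>v0\<close>.

\<^item> If some label of \<open>p\<close> is spelled by a word that is not geodesic in its vertex group, then the
  property of that vertex group shortens \<open>w\<close> (\<open>shorten_reading\<close>).

\<^item> Suppose that all labels are spelled geodesically and \<open>p\<close> contains a backtrack
  \<open>e \<cdot> emb e h \<cdot> arc_rev e\<close>. As edge group elements are letters, \<open>emb e h\<close> is spelled by at most one
  letter. If \<open>t e = \<one>\<close>, this letter is the same element of \<open>G\<close> as a letter at the tail of \<open>e\<close>, so
  \<open>w\<close> itself is also read along the reduced path, which has fewer arcs. Since the word does not
  change, arbitrarily many reductions do not affect the fellow traveling constant. If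
  \<open>t e \<noteq> \<one>\<close>, then the whole backtrack can be replaced by at most one letter (\<open>reads_reduce\<close>).

\<^item> Otherwise \<open>p\<close> is irreducible. A geodesic word for the value of \<open>w\<close> is read along some loop, and
  reducing that loop does not increase its cost. Reduction is confluent up to sliding edge group
  elements across arcs (\<open>homotopic_irreducible\<close>), so the reduced loop has the arcs of \<open>p\<close>, and each of
  its labels is obtained from the one in \<open>p\<close> by multiplying with an edge group element on either side.
  Multiplying a geodesic word by a letter on either side and shortening the result at most four times
  gives a geodesic word that stays close (\<open>geodesic_push\<close>). These words together form a word for the
  value of \<open>w\<close> that is shorter than \<open>w\<close> and fellow travels with it (\<open>slide_reading\<close>).\<close>

section \<open>Words over a generating set\<close>

lemma word_value_Nil [simp]: "word_value G [] = \<one>\<^bsub>G\<^esub>"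
  by (simp add: word_value_def)

lemma word_value_Cons [simp]: "word_value G (x # w) = x \<otimes>\<^bsub>G\<^esub> word_value G w"
  by (simp add: word_value_def)

lemma (in monoid) word_value_closed: "set w \<subseteq> carrier G \<Longrightarrow> word_value G w \<in> carrier G"
  by (induction w) auto

lemma (in monoid) word_value_append:
  "\<lbrakk>set v \<subseteq> carrier G; set w \<subseteq> carrier G\<rbrakk>
    \<Longrightarrow> word_value G (v @ w) = word_value G v \<otimes> word_value G w"
  by (induction v) (auto simp: word_value_closed m_assoc)

lemma (in group) inv_cancel_left [simp]:
  assumes "x \<in> carrier G" "y \<in> carrier G"
  shows "inv x \<otimes> (x \<otimes> y) = y" "x \<otimes> (inv x \<otimes> y) = y"
  using assms by (simp_all flip: m_assoc)

lemma word_value_map_hom: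
  assumes "group H" "group G" "f \<in> hom H G" "set w \<subseteq> carrier H"
  shows "word_value G (map f w) = f (word_value H w)"
proof -
  interpret group_hom H G f using assms by (simp add: group_hom_def group_hom_axioms_def)
  show ?thesis using assms(4) by (induction w) (auto simp: H.word_value_closed G.word_value_closed)
qed

text \<open>The path labelled \<open>q\<close> starts at \<open>h\<close> and the path labelled \<open>p\<close> at the identity. The offset \<open>h\<close> is what
allows fellow traveling words to be concatenated when the intermediate end points differ.\<close>

definition fellow ::
    "('g, 'm) monoid_scheme \<Rightarrow> 'g set \<Rightarrow> nat \<Rightarrow> 'g \<Rightarrow> 'g list \<Rightarrow> 'g list \<Rightarrow> bool" where
  "fellow G X K h p q = async_fellow_travel G X K
     (\<lambda>t. word_value G (take t p)) (\<lambda>t. h \<otimes>\<^bsub>G\<^esub> word_value G (take t q))"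

lemma async_fellow_travelI:
  assumes "mono \<phi>" "mono \<psi>"
    and "\<And>t. word_dist G X (p t) (q (\<phi> t)) \<le> K"
    and "\<And>t. word_dist G X (p (\<psi> t)) (q t) \<le> K"
  shows "async_fellow_travel G X K p q"
  using assms unfolding async_fellow_travel_def by blast

lemma async_fellow_travelE:
  assumes "async_fellow_travel G X K p q"
  obtains \<phi> \<psi> where "mono \<phi>" "mono \<psi>"
    and "\<And>t. word_dist G X (p t) (q (\<phi> t)) \<le> K"
    and "\<And>t. word_dist G X (p (\<psi> t)) (q t) \<le> K"
  using assms unfolding async_fellow_travel_def by blast

lemma fellow_mono: "\<lbrakk>fellow G X K h p q; K \<le> L\<rbrakk> \<Longrightarrow> fellow G X L h p q"
  unfolding fellow_def async_fellow_travel_def using order_trans by blast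

locale marked_group = group G for G (structure) + fixes X
  assumes generating: "generating_set G X"
begin

lemma generator_in_carrier: "x \<in> X \<Longrightarrow> x \<in> carrier G"
  using generating by (auto simp: generating_set_def)

lemma set_word_subset: "w \<in> lists X \<Longrightarrow> set w \<subseteq> carrier G"
  using generator_in_carrier by auto

lemma value_closed [simp]: "w \<in> lists X \<Longrightarrow> word_value G w \<in> carrier G"
  by (simp add: word_value_closed set_word_subset)

lemma take_in_lists [simp]: "w \<in> lists X \<Longrightarrow> take t w \<in> lists X"
  using set_take_subset[of t w] by auto

lemma value_append: "\<lbrakk>v \<in> lists X; w \<in> lists X\<rbrakk>
    \<Longrightarrow> word_value G (v @ w) = word_value G v \<otimes> word_value G w"
  by (simp add: word_value_append set_word_subset)

lemma length_ge_word_length: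
  "w \<in> lists X \<Longrightarrow> word_length G X (word_value G w) \<le> length w"
  unfolding word_length_def by (rule Least_le) auto

lemma geodesic_word_exists:
  assumes "g \<in> carrier G"
  obtains w where "w \<in> lists X" "word_value G w = g" "length w = word_length G X g"
proof -
  obtain w where "w \<in> lists X" "word_value G w = g"
    using assms generating unfolding generating_set_def by blast
  then have "\<exists>n. \<exists>w \<in> lists X. word_value G w = g \<and> length w = n" by blast
  then have "\<exists>w \<in> lists X. word_value G w = g \<and> length w = word_length G X g"
    unfolding word_length_def by (rule LeastI_ex)
  then show thesis using that by blast
qed

lemma word_length_one [simp]: "word_length G X \<one> = 0"
  using length_ge_word_length[of "[]"] by simp

lemma word_length_eq_0_iff: "g \<in> carrier G \<Longrightarrow> word_length G X g = 0 \<longleftrightarrow> g = \<one>"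
  by (metis geodesic_word_exists length_0_conv word_value_Nil word_length_one)

lemma word_length_generator: "x \<in> X \<Longrightarrow> word_length G X x \<le> 1"
  using length_ge_word_length[of "[x]"] by (simp add: generator_in_carrier)

lemma word_length_mult:
  assumes "g \<in> carrier G" "h \<in> carrier G"
  shows "word_length G X (g \<otimes> h) \<le> word_length G X g + word_length G X h"
proof -
  obtain v where v: "v \<in> lists X" "word_value G v = g" "length v = word_length G X g"
    using assms by (blast elim: geodesic_word_exists)
  obtain w where w: "w \<in> lists X" "word_value G w = h" "length w = word_length G X h"
    using assms by (blast elim: geodesic_word_exists)
  show ?thesis using length_ge_word_length[of "v @ w"] v w by (simp add: value_append)
qed

lemma dist_self [simp]: "g \<in> carrier G \<Longrightarrow> word_dist G X g g = 0"
  by (simp add: word_dist_def)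

lemma dist_left_invariant:
  assumes "g \<in> carrier G" "a \<in> carrier G" "b \<in> carrier G"
  shows "word_dist G X (g \<otimes> a) (g \<otimes> b) = word_dist G X a b"
  using assms by (simp add: word_dist_def inv_mult_group m_assoc)

lemma dist_triangle:
  assumes "a \<in> carrier G" "b \<in> carrier G" "c \<in> carrier G"
  shows "word_dist G X a c \<le> word_dist G X a b + word_dist G X b c"
proof -
  have "inv a \<otimes> c = (inv a \<otimes> b) \<otimes> (inv b \<otimes> c)"
    using assms by (simp add: m_assoc)
  then show ?thesis unfolding word_dist_def using assms word_length_mult by simp
qed

lemma fellow_refl: "w \<in> lists X \<Longrightarrow> fellow G X K \<one> w w"
  unfolding fellow_def
  by (rule async_fellow_travelI[where \<phi> = id and \<psi> = id]) (auto simp: mono_def)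

lemma fellow_trans:
  assumes pq: "fellow G X K h p q" and qr: "fellow G X L k q r"
    and w: "p \<in> lists X" "q \<in> lists X" "r \<in> lists X" and hk: "h \<in> carrier G" "k \<in> carrier G"
  shows "fellow G X (K + L) (h \<otimes> k) p r"
proof -
  obtain \<phi> \<psi> where 1: "mono \<phi>" "mono \<psi>"
      "\<And>t. word_dist G X (word_value G (take t p)) (h \<otimes> word_value G (take (\<phi> t) q)) \<le> K"
      "\<And>t. word_dist G X (word_value G (take (\<psi> t) p)) (h \<otimes> word_value G (take t q)) \<le> K"
    by (rule async_fellow_travelE[OF pq[unfolded fellow_def]], rule that)
  obtain \<phi>' \<psi>' where 2: "mono \<phi>'" "mono \<psi>'"
      "\<And>t. word_dist G X (word_value G (take t q)) (k \<otimes> word_value G (take (\<phi>' t) r)) \<le> L"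
      "\<And>t. word_dist G X (word_value G (take (\<psi>' t) q)) (k \<otimes> word_value G (take t r)) \<le> L"
    by (rule async_fellow_travelE[OF qr[unfolded fellow_def]], rule that)
  have step: "word_dist G X (word_value G (take i p)) (h \<otimes> k \<otimes> word_value G (take l r)) \<le> K + L"
    if "word_dist G X (word_value G (take i p)) (h \<otimes> word_value G (take j q)) \<le> K"
      and "word_dist G X (word_value G (take j q)) (k \<otimes> word_value G (take l r)) \<le> L" for i j l
  proof -
    have "word_dist G X (h \<otimes> word_value G (take j q)) (h \<otimes> (k \<otimes> word_value G (take l r))) \<le> L"
      using that(2) w hk by (simp add: dist_left_invariant)
    then show ?thesis
      using dist_triangle[of "word_value G (take i p)" "h \<otimes> word_value G (take j q)"
          "h \<otimes> (k \<otimes> word_value G (take l r))"] that(1) w hk by (simp add: m_assoc)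
  qed
  show ?thesis unfolding fellow_def
  proof (rule async_fellow_travelI[where \<phi> = "\<lambda>t. \<phi>' (\<phi> t)" and \<psi> = "\<lambda>t. \<psi> (\<psi>' t)"])
    show "mono (\<lambda>t. \<phi>' (\<phi> t))" "mono (\<lambda>t. \<psi> (\<psi>' t))" using 1 2 by (simp_all add: mono_def)
  qed (rule step[OF 1(3) 2(3)] step[OF 1(4) 2(4)])+
qed

lemma fellow_trans_one:
  assumes "fellow G X K \<one> p q" "fellow G X L \<one> q r" "p \<in> lists X" "q \<in> lists X" "r \<in> lists X"
  shows "fellow G X (K + L) \<one> p r"
  using fellow_trans[OF assms(1,2)] assms by simp

text \<open>The hypothesis on \<open>k\<close> says that it is the offset between the end points of the first two paths, where
the second two continue. The reparametrizations are glued at the lengths of \<open>p\<close> and \<open>q\<close>; those of the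
first part are truncated there, which changes nothing because paths are constant after their end.\<close>

lemma fellow_append:
  assumes f1: "fellow G X K h p q" and f2: "fellow G X K k p' q'"
    and eq: "h \<otimes> word_value G q = word_value G p \<otimes> k"
    and w: "p \<in> lists X" "q \<in> lists X" "p' \<in> lists X" "q' \<in> lists X"
    and hk: "h \<in> carrier G" "k \<in> carrier G"
  shows "fellow G X K h (p @ p') (q @ q')"
proof -
  obtain \<phi> \<psi> where 1: "mono \<phi>" "mono \<psi>"
      "\<And>t. word_dist G X (word_value G (take t p)) (h \<otimes> word_value G (take (\<phi> t) q)) \<le> K"
      "\<And>t. word_dist G X (word_value G (take (\<psi> t) p)) (h \<otimes> word_value G (take t q)) \<le> K"
    by (rule async_fellow_travelE[OF f1[unfolded fellow_def]], rule that)
  obtain \<phi>' \<psi>' where 2: "mono \<phi>'" "mono \<psi>'"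
      "\<And>t. word_dist G X (word_value G (take t p')) (k \<otimes> word_value G (take (\<phi>' t) q')) \<le> K"
      "\<And>t. word_dist G X (word_value G (take (\<psi>' t) p')) (k \<otimes> word_value G (take t q')) \<le> K"
    by (rule async_fellow_travelE[OF f2[unfolded fellow_def]], rule that)
  have left: "word_dist G X (word_value G (take i (p @ p'))) (h \<otimes> word_value G (take j (q @ q'))) \<le> K"
    if "i \<le> length p" "j \<le> length q"
      "word_dist G X (word_value G (take i p)) (h \<otimes> word_value G (take j q)) \<le> K" for i j
    using that by simp
  have right: "word_dist G X (word_value G (take (length p + i) (p @ p')))
      (h \<otimes> word_value G (take (length q + j) (q @ q'))) \<le> K"
    if "word_dist G X (word_value G (take i p')) (k \<otimes> word_value G (take j q')) \<le> K" for i j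
  proof -
    have "h \<otimes> (word_value G q \<otimes> word_value G (take j q'))
        = word_value G p \<otimes> (k \<otimes> word_value G (take j q'))"
      using eq w hk by (simp flip: m_assoc)
    then show ?thesis using that w hk by (simp add: value_append dist_left_invariant)
  qed
  show ?thesis unfolding fellow_def
  proof (rule async_fellow_travelI[where
        \<phi> = "\<lambda>t. if t < length p then min (\<phi> t) (length q) else length q + \<phi>' (t - length p)" and
        \<psi> = "\<lambda>t. if t < length q then min (\<psi> t) (length p) else length p + \<psi>' (t - length q)"])
    show "mono (\<lambda>t. if t < length p then min (\<phi> t) (length q) else length q + \<phi>' (t - length p))"
    proof (rule monoI)
      fix x y :: nat assume "x \<le> y"
      moreover from this have "\<phi> x \<le> \<phi> y" "\<phi>' (x - length p) \<le> \<phi>' (y - length p)"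
        using 1(1) 2(1) by (simp_all add: mono_def diff_le_mono)
      ultimately show "(if x < length p then min (\<phi> x) (length q) else length q + \<phi>' (x - length p))
          \<le> (if y < length p then min (\<phi> y) (length q) else length q + \<phi>' (y - length p))"
        by auto
    qed
    show "mono (\<lambda>t. if t < length q then min (\<psi> t) (length p) else length p + \<psi>' (t - length q))"
    proof (rule monoI)
      fix x y :: nat assume "x \<le> y"
      moreover from this have "\<psi> x \<le> \<psi> y" "\<psi>' (x - length q) \<le> \<psi>' (y - length q)"
        using 1(2) 2(2) by (simp_all add: mono_def diff_le_mono)
      ultimately show "(if x < length q then min (\<psi> x) (length p) else length p + \<psi>' (x - length q))
          \<le> (if y < length q then min (\<psi> y) (length p) else length p + \<psi>' (y - length q))"
        by auto
    qed
    have m: "take (min i (length r)) r = take i r" for i and r :: "'a list"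
      by (simp add: min_def)
    show "word_dist G X (word_value G (take t (p @ p')))
        (h \<otimes> word_value G (take (if t < length p then min (\<phi> t) (length q)
          else length q + \<phi>' (t - length p)) (q @ q'))) \<le> K" for t
    proof (cases "t < length p")
      case True
      then show ?thesis using left[of t "min (\<phi> t) (length q)", unfolded m] 1(3)[of t]
        by (simp only: if_True)
    next
      case False
      then show ?thesis using right[OF 2(3)[of "t - length p"]] by simp
    qed
    show "word_dist G X (word_value G (take (if t < length q then min (\<psi> t) (length p)
          else length p + \<psi>' (t - length q)) (p @ p'))) (h \<otimes> word_value G (take t (q @ q'))) \<le> K" for t
    proof (cases "t < length q")
      case True
      then show ?thesis using left[of "min (\<psi> t) (length p)" t, unfolded m] 1(4)[of t]
        by (simp only: if_True)
    next
      case False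
      then show ?thesis using right[OF 2(4)[of "t - length q"]] by simp
    qed
  qed
qed

lemma fellow_in_context:
  assumes "fellow G X K \<one> p q" "word_value G p = word_value G q"
    and "p \<in> lists X" "q \<in> lists X" "u \<in> lists X" "v \<in> lists X"
  shows "fellow G X K \<one> (u @ p @ v) (u @ q @ v)"
  using assms by (intro fellow_append[where k = \<one>] fellow_refl) (auto simp: value_append)

text \<open>Every vertex of \<open>p\<close> is matched with the common end point, and the origin with every vertex of \<open>q\<close>.
Both pairings only use distances along one of the paths in its direction of travel; the distance is
not symmetric, so bounds against that direction would be harder to come by.\<close>

lemma fellow_same_value:
  assumes w: "p \<in> lists X" "q \<in> lists X" and eq: "word_value G p = word_value G q"
    and K: "length p \<le> K" "length q \<le> K"
  shows "fellow G X K \<one> p q"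
  unfolding fellow_def
proof (rule async_fellow_travelI[where \<phi> = "\<lambda>_. length q" and \<psi> = "\<lambda>_. 0"])
  fix t
  have "word_value G p = word_value G (take t p) \<otimes> word_value G (drop t p)"
    using w by (metis append_take_drop_id append_in_lists_conv value_append)
  moreover have d: "drop t p \<in> lists X" using w(1) by (metis append_take_drop_id append_in_lists_conv)
  ultimately have "inv (word_value G (take t p)) \<otimes> word_value G q = word_value G (drop t p)"
    using eq[symmetric] w by (simp add: m_assoc)
  then show "word_dist G X (word_value G (take t p)) (\<one> \<otimes> word_value G (take (length q) q)) \<le> K"
    using length_ge_word_length[OF d] K w by (simp add: word_dist_def)
  show "word_dist G X (word_value G (take 0 p)) (\<one> \<otimes> word_value G (take t q)) \<le> K"
    using length_ge_word_length[of "take t q"] K w by (simp add: word_dist_def)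
qed (auto simp: mono_def)

end

text \<open>A homomorphism that maps generators to generators does not increase distances.\<close>

lemma fellow_map_hom:
  assumes H: "marked_group H Y" and G: "marked_group G X"
    and f: "f \<in> hom H G" "f ` Y \<subseteq> X"
    and fel: "fellow H Y K h p q" and pq: "p \<in> lists Y" "q \<in> lists Y" and h: "h \<in> carrier H"
  shows "fellow G X K (f h) (map f p) (map f q)"
proof -
  interpret H: marked_group H Y by (rule H)
  interpret G: marked_group G X by (rule G)
  interpret f: group_hom H G f
    using f by (simp add: group_hom_def group_hom_axioms_def H.is_group G.is_group)
  have val: "word_value G (map f w) = f (word_value H w)" if "w \<in> lists Y" for w
    using that f by (intro word_value_map_hom H.is_group G.is_group H.set_word_subset)
  have len: "word_length G X (f g) \<le> word_length H Y g" if g: "g \<in> carrier H" for g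
  proof -
    obtain w where w: "w \<in> lists Y" "word_value H w = g" "length w = word_length H Y g"
      by (rule H.geodesic_word_exists[OF g])
    have "map f w \<in> lists X" using w(1) f(2) by (simp add: in_lists_conv_set) blast
    from G.length_ge_word_length[OF this] show ?thesis using w by (simp add: val)
  qed
  have dist: "word_dist G X (word_value G (take i (map f p))) (f h \<otimes>\<^bsub>G\<^esub> word_value G (take j (map f q)))
      \<le> word_dist H Y (word_value H (take i p)) (h \<otimes>\<^bsub>H\<^esub> word_value H (take j q))" for i j
    using len[of "inv\<^bsub>H\<^esub> (word_value H (take i p)) \<otimes>\<^bsub>H\<^esub> (h \<otimes>\<^bsub>H\<^esub> word_value H (take j q))"] pq h
    by (simp add: word_dist_def take_map val)
  obtain \<phi> \<psi> where "mono \<phi>" "mono \<psi>"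
      "\<And>t. word_dist H Y (word_value H (take t p)) (h \<otimes>\<^bsub>H\<^esub> word_value H (take (\<phi> t) q)) \<le> K"
      "\<And>t. word_dist H Y (word_value H (take (\<psi> t) p)) (h \<otimes>\<^bsub>H\<^esub> word_value H (take t q)) \<le> K"
    by (rule async_fellow_travelE[OF fel[unfolded fellow_def]], rule that)
  then show ?thesis unfolding fellow_def
    by (intro async_fellow_travelI[where \<phi> = \<phi> and \<psi> = \<psi>] order_trans[OF dist])
qed

section \<open>The falsification by fellow traveler property for words\<close>

text \<open>By left invariance only paths that start at the identity matter, and these correspond to words.\<close>

definition word_fftp :: "('g, 'm) monoid_scheme \<Rightarrow> 'g set \<Rightarrow> nat \<Rightarrow> bool" where
  "word_fftp G X K \<longleftrightarrow> (\<forall>w \<in> lists X. word_length G X (word_value G w) < length w \<longrightarrow>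
     (\<exists>q \<in> lists X. word_value G q = word_value G w \<and> length q < length w \<and> fellow G X K \<one>\<^bsub>G\<^esub> w q))"

lemma word_fftp_mono: "\<lbrakk>word_fftp G X K; K \<le> L\<rbrakk> \<Longrightarrow> word_fftp G X L"
  unfolding word_fftp_def by (meson fellow_mono)

context marked_group begin

abbreviation (input) "\<Gamma> \<equiv> cayley_graph G X"

fun path_of_word :: "'a \<Rightarrow> 'a list \<Rightarrow> ('a \<times> 'a) list" where
  "path_of_word u [] = []"
| "path_of_word u (x # w) = (u, x) # path_of_word (u \<otimes> x) w"

lemma length_path_of_word [simp]: "length (path_of_word u w) = length w"
  by (induction w arbitrary: u) auto

lemma awalk_cayley_iff:
  "pre_digraph.awalk \<Gamma> u p v \<longleftrightarrow>
     u \<in> carrier G \<and> (\<exists>w \<in> lists X. p = path_of_word u w \<and> v = u \<otimes> word_value G w)"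
proof (induction p arbitrary: u)
  case Nil
  have "[] = path_of_word u w \<longleftrightarrow> w = []" for w by (cases w) auto
  then have "(\<exists>w \<in> lists X. [] = path_of_word u w \<and> v = u \<otimes> word_value G w) \<longleftrightarrow> v = u \<otimes> \<one>"
    by (simp add: Bex_def conj_commute cong: conj_cong)
  moreover have "pre_digraph.awalk \<Gamma> u [] v \<longleftrightarrow> u \<in> carrier G \<and> u = v"
    by (simp add: pre_digraph.awalk_def pre_digraph.cas.simps cayley_graph_def)
  ultimately show ?case by auto
next
  case (Cons e p)
  obtain a x where e: "e = (a, x)" by fastforce
  have "pre_digraph.awalk \<Gamma> u (e # p) v \<longleftrightarrow>
      u \<in> carrier G \<and> x \<in> X \<and> a = u \<and> pre_digraph.awalk \<Gamma> (u \<otimes> x) p v"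
    using generator_in_carrier
    by (auto simp: e pre_digraph.awalk_def pre_digraph.cas.simps cayley_graph_def)
  also have "\<dots> \<longleftrightarrow> u \<in> carrier G \<and> x \<in> X \<and> a = u \<and>
      (\<exists>w \<in> lists X. p = path_of_word (u \<otimes> x) w \<and> v = u \<otimes> x \<otimes> word_value G w)"
    using Cons.IH generator_in_carrier by auto
  also have "\<dots> \<longleftrightarrow> u \<in> carrier G \<and>
      (\<exists>w \<in> lists X. e # p = path_of_word u w \<and> v = u \<otimes> word_value G w)" (is "?L \<longleftrightarrow> ?R")
  proof
    assume ?L
    then obtain w where "u \<in> carrier G" "x \<in> X" "a = u" "w \<in> lists X"
        "p = path_of_word (u \<otimes> x) w" "v = u \<otimes> x \<otimes> word_value G w" by blast
    then show ?R using generator_in_carrier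
      by (auto simp: e m_assoc intro!: bexI[of _ "x # w"])
  next
    assume ?R
    then obtain w where *: "u \<in> carrier G" "w \<in> lists X" "e # p = path_of_word u w"
      "v = u \<otimes> word_value G w" by blast
    then obtain y w' where "w = y # w'" by (cases w) auto
    then show ?L using * generator_in_carrier by (auto simp: e m_assoc)
  qed
  finally show ?case .
qed

lemma path_vertex_path_of_word:
  assumes "w \<in> lists X" "u \<in> carrier G"
  shows "path_vertex \<Gamma> u (path_of_word u w) t = u \<otimes> word_value G (take t w)"
proof -
  have "pre_digraph.awalk_verts \<Gamma> u (path_of_word u w) ! t = u \<otimes> word_value G (take t w)"
    if "t \<le> length w" for t
    using that assms
  proof (induction w arbitrary: u t)
    case Nil
    then show ?case by (simp add: pre_digraph.awalk_verts.simps)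
  next
    case (Cons x w)
    then have "x \<in> carrier G" using generator_in_carrier by auto
    with Cons show ?case
      by (cases t) (auto simp: pre_digraph.awalk_verts.simps cayley_graph_def m_assoc)
  qed
  then show ?thesis by (simp add: path_vertex_def min_def)
qed

lemma async_fellow_travel_translate:
  assumes "u \<in> carrier G" "range p \<subseteq> carrier G" "range q \<subseteq> carrier G"
  shows "async_fellow_travel G X K (\<lambda>t. u \<otimes> p t) (\<lambda>t. u \<otimes> q t) \<longleftrightarrow> async_fellow_travel G X K p q"
proof -
  have "word_dist G X (u \<otimes> p i) (u \<otimes> q j) = word_dist G X (p i) (q j)" for i j
    using assms by (intro dist_left_invariant) auto
  then show ?thesis by (simp add: async_fellow_travel_def)
qed

lemma fellow_travel_paths_iff:
  assumes "p \<in> lists X" "q \<in> lists X" "u \<in> carrier G"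
  shows "async_fellow_travel G X K (path_vertex \<Gamma> u (path_of_word u p)) (path_vertex \<Gamma> u (path_of_word u q))
    \<longleftrightarrow> fellow G X K \<one> p q"
proof -
  have "path_vertex \<Gamma> u (path_of_word u w) = (\<lambda>t. u \<otimes> word_value G (take t w))" if "w \<in> lists X" for w
    using that assms by (intro ext path_vertex_path_of_word)
  then show ?thesis
    using assms async_fellow_travel_translate[of u "\<lambda>t. word_value G (take t p)" "\<lambda>t. word_value G (take t q)"]
    by (simp add: fellow_def image_subset_iff)
qed

lemma geodesic_path_of_word_iff:
  assumes "w \<in> lists X" "u \<in> carrier G"
  shows "geodesic \<Gamma> u (path_of_word u w) (u \<otimes> word_value G w) \<longleftrightarrow>
    word_length G X (word_value G w) = length w"
proof -
  have "word_length G X (word_value G w) = length w \<longleftrightarrow>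
      \<not> (\<exists>q \<in> lists X. word_value G q = word_value G w \<and> length q < length w)"
    using length_ge_word_length[OF assms(1)] length_ge_word_length
    by (metis assms(1) geodesic_word_exists le_neq_implies_less linorder_not_less value_closed)
  moreover have "(\<exists>q. pre_digraph.awalk \<Gamma> u q (u \<otimes> word_value G w) \<and> length q < length w) \<longleftrightarrow>
      (\<exists>q \<in> lists X. word_value G q = word_value G w \<and> length q < length w)"
  proof
    assume "\<exists>q \<in> lists X. word_value G q = word_value G w \<and> length q < length w"
    then obtain q where q: "q \<in> lists X" "word_value G q = word_value G w" "length q < length w" by blast
    then have "pre_digraph.awalk \<Gamma> u (path_of_word u q) (u \<otimes> word_value G w)"
      using assms by (auto simp: awalk_cayley_iff)
    then show "\<exists>q. pre_digraph.awalk \<Gamma> u q (u \<otimes> word_value G w) \<and> length q < length w"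
      using q by (intro exI[of _ "path_of_word u q"]) simp
  qed (use assms in \<open>auto simp: awalk_cayley_iff\<close>)
  moreover have "pre_digraph.awalk \<Gamma> u (path_of_word u w) (u \<otimes> word_value G w)"
    using assms by (auto simp: awalk_cayley_iff)
  ultimately show ?thesis by (simp add: geodesic_def)
qed

lemma fftp_wrt_iff_word_fftp: "fftp_wrt G X \<longleftrightarrow> (\<exists>K. word_fftp G X K)"
proof -
  have "(\<forall>u p v. pre_digraph.awalk \<Gamma> u p v \<and> \<not> geodesic \<Gamma> u p v
        \<longrightarrow> (\<exists>q. pre_digraph.awalk \<Gamma> u q v \<and> length q < length p \<and>
              async_fellow_travel G X K (path_vertex \<Gamma> u p) (path_vertex \<Gamma> u q)))
      \<longleftrightarrow> word_fftp G X K" (is "?L \<longleftrightarrow> ?R") for K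
  proof
    assume L: ?L
    show ?R unfolding word_fftp_def
    proof (intro ballI impI)
      fix w assume w: "w \<in> lists X" "word_length G X (word_value G w) < length w"
      have "pre_digraph.awalk \<Gamma> \<one> (path_of_word \<one> w) (\<one> \<otimes> word_value G w)"
        using w by (auto simp: awalk_cayley_iff)
      moreover have "\<not> geodesic \<Gamma> \<one> (path_of_word \<one> w) (\<one> \<otimes> word_value G w)"
        using w by (subst geodesic_path_of_word_iff) auto
      ultimately obtain p where p: "pre_digraph.awalk \<Gamma> \<one> p (\<one> \<otimes> word_value G w)"
          "length p < length (path_of_word \<one> w)"
          "async_fellow_travel G X K (path_vertex \<Gamma> \<one> (path_of_word \<one> w)) (path_vertex \<Gamma> \<one> p)"
        using L by blast
      then obtain q where q: "q \<in> lists X" "p = path_of_word \<one> q" "word_value G w = word_value G q"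
        using w by (auto simp: awalk_cayley_iff)
      then show "\<exists>q\<in>lists X. word_value G q = word_value G w \<and> length q < length w \<and> fellow G X K \<one> w q"
        using w p by (intro bexI[of _ q]) (simp_all add: fellow_travel_paths_iff)
    qed
  next
    assume R: ?R
    show ?L
    proof (intro allI impI, elim conjE)
      fix u p v assume p: "pre_digraph.awalk \<Gamma> u p v" "\<not> geodesic \<Gamma> u p v"
      then obtain w where w: "u \<in> carrier G" "w \<in> lists X" "p = path_of_word u w"
          "v = u \<otimes> word_value G w" by (auto simp: awalk_cayley_iff)
      then have "word_length G X (word_value G w) < length w"
        using p(2) length_ge_word_length[of w] by (simp add: geodesic_path_of_word_iff)
      then obtain q where "q \<in> lists X" "word_value G q = word_value G w" "length q < length w"
          "fellow G X K \<one> w q" using R w(2) unfolding word_fftp_def by blast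
      moreover from this have "pre_digraph.awalk \<Gamma> u (path_of_word u q) v"
        using w by (auto simp: awalk_cayley_iff)
      ultimately show "\<exists>q. pre_digraph.awalk \<Gamma> u q v \<and> length q < length p \<and>
          async_fellow_travel G X K (path_vertex \<Gamma> u p) (path_vertex \<Gamma> u q)"
        using w by (intro exI[of _ "path_of_word u q"]) (simp add: fellow_travel_paths_iff)
    qed
  qed
  then show ?thesis by (simp add: fftp_wrt_def)
qed

text \<open>If \<open>w\<close> exceeds an attainable length \<open>m\<close> by at most \<open>n\<close>, then shortening it \<open>n\<close> times suffices, so the
constant depends on the excess and not on the length of \<open>w\<close>.\<close>

lemma word_fftp_iterate:
  assumes "word_fftp G X K" "w \<in> lists X"
    and "word_length G X (word_value G w) \<le> m" "length w \<le> m + n"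
  obtains q where "q \<in> lists X" "word_value G q = word_value G w" "length q \<le> m"
    "fellow G X (n * K) \<one> w q"
proof -
  have "\<exists>q \<in> lists X. word_value G q = word_value G w \<and> length q \<le> m \<and> fellow G X (n * K) \<one> w q"
    using assms(2-4)
  proof (induction n arbitrary: w)
    case 0
    then show ?case using fellow_refl by auto
  next
    case (Suc n)
    show ?case
    proof (cases "length w \<le> m")
      case True
      then show ?thesis using Suc.prems fellow_refl by auto
    next
      case False
      then have "word_length G X (word_value G w) < length w" using Suc.prems by simp
      then obtain v where v: "v \<in> lists X" "word_value G v = word_value G w" "length v < length w"
          "fellow G X K \<one> w v" using assms(1) Suc.prems(1) unfolding word_fftp_def by blast
      obtain q where q: "q \<in> lists X" "word_value G q = word_value G v" "length q \<le> m"
          "fellow G X (n * K) \<one> v q" using Suc.IH[of v] v Suc.prems by auto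
      have "fellow G X (Suc n * K) \<one> w q"
        using fellow_trans_one[OF v(4) q(4)] Suc.prems(1) v(1) q(1) by simp
      then show ?thesis using q v by auto
    qed
  qed
  then show thesis using that by blast
qed

end

section \<open>Balls as generating sets\<close>

definition word_ball :: "('g, 'm) monoid_scheme \<Rightarrow> 'g set \<Rightarrow> nat \<Rightarrow> 'g set" where
  "word_ball G X m = {g \<in> carrier G. word_length G X g \<le> m}"

context marked_group begin

lemma finite_word_ball:
  assumes "finite X"
  shows "finite (word_ball G X m)"
proof (rule finite_subset)
  show "word_ball G X m \<subseteq> word_value G ` {w. set w \<subseteq> X \<and> length w \<le> m}"
  proof
    fix g assume "g \<in> word_ball G X m"
    then have g: "g \<in> carrier G" "word_length G X g \<le> m" by (auto simp: word_ball_def)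
    obtain w where "w \<in> lists X" "word_value G w = g" "length w = word_length G X g"
      by (rule geodesic_word_exists[OF g(1)])
    then show "g \<in> word_value G ` {w. set w \<subseteq> X \<and> length w \<le> m}" using g(2) by auto
  qed
  show "finite (word_value G ` {w. set w \<subseteq> X \<and> length w \<le> m})"
    using assms by (simp add: finite_lists_length_le)
qed

lemma generators_subset_word_ball: "m \<ge> 1 \<Longrightarrow> X \<subseteq> word_ball G X m"
  using word_length_generator generator_in_carrier by (fastforce simp: word_ball_def)

lemma generating_word_ball:
  assumes "m \<ge> 1"
  shows "generating_set G (word_ball G X m)"
  unfolding generating_set_def
proof
  show "word_ball G X m \<subseteq> carrier G" by (auto simp: word_ball_def)
  have "lists X \<subseteq> lists (word_ball G X m)"
    by (rule lists_mono[OF generators_subset_word_ball[OF assms]])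
  then show "carrier G \<subseteq> word_value G ` lists (word_ball G X m)"
    using generating unfolding generating_set_def by blast
qed

lemma expand_ball_word:
  assumes "m \<ge> 1" "w \<in> lists (word_ball G X m)"
  obtains v where "v \<in> lists X" "word_value G v = word_value G w" "length v \<le> m * length w"
    "fellow G (word_ball G X m) m \<one> w v"
proof -
  interpret B: marked_group G "word_ball G X m"
    by (rule marked_group.intro[OF is_group])
      (rule marked_group_axioms.intro[OF generating_word_ball[OF assms(1)]])
  have sub: "lists X \<subseteq> lists (word_ball G X m)"
    by (rule lists_mono[OF generators_subset_word_ball[OF assms(1)]])
  have "\<exists>v \<in> lists X. word_value G v = word_value G w \<and> length v \<le> m * length w \<and>
      fellow G (word_ball G X m) m \<one> w v"
    using assms(2)
  proof (induction w)
    case Nil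
    then show ?case using B.fellow_refl[of "[]"] by auto
  next
    case (Cons z w)
    then have z: "z \<in> carrier G" "word_length G X z \<le> m" by (auto simp: word_ball_def)
    obtain y where y: "y \<in> lists X" "word_value G y = z" "length y = word_length G X z"
      by (rule geodesic_word_exists[OF z(1)])
    obtain v where v: "v \<in> lists X" "word_value G v = word_value G w" "length v \<le> m * length w"
        "fellow G (word_ball G X m) m \<one> w v"
      using Cons by auto
    have wB: "[z] \<in> lists (word_ball G X m)" "w \<in> lists (word_ball G X m)"
        "y \<in> lists (word_ball G X m)" "v \<in> lists (word_ball G X m)"
      using Cons.hyps subsetD[OF sub y(1)] subsetD[OF sub v(1)] by simp_all
    have "fellow G (word_ball G X m) m \<one> [z] y"
      using y z assms(1) wB by (intro B.fellow_same_value) auto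
    then have "fellow G (word_ball G X m) m \<one> ([z] @ w) (y @ v)"
      using v wB y z by (intro B.fellow_append[where k = \<one>]) simp_all
    moreover have "length (y @ v) \<le> m * length (z # w)" using y z v by simp
    moreover have "word_value G (y @ v) = word_value G (z # w)"
      using y v by (simp add: value_append)
    ultimately show ?case using y(1) v(1) by (intro bexI[of _ "y @ v"]) simp_all
  qed
  then show thesis using that by blast
qed

lemma chunk_word:
  assumes "m \<ge> 1" "v \<in> lists X" "length v \<le> m * n"
  obtains q where "q \<in> lists (word_ball G X m)" "word_value G q = word_value G v" "length q \<le> n"
    "fellow G (word_ball G X m) m \<one> v q"
proof -
  interpret B: marked_group G "word_ball G X m"
    by (rule marked_group.intro[OF is_group])
      (rule marked_group_axioms.intro[OF generating_word_ball[OF assms(1)]])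
  have sub: "lists X \<subseteq> lists (word_ball G X m)"
    by (rule lists_mono[OF generators_subset_word_ball[OF assms(1)]])
  have "\<exists>q \<in> lists (word_ball G X m). word_value G q = word_value G v \<and> length q \<le> n \<and>
      fellow G (word_ball G X m) m \<one> v q"
    using assms(2,3)
  proof (induction n arbitrary: v)
    case 0
    then show ?case using B.fellow_refl[of "[]"] by auto
  next
    case (Suc n)
    let ?z = "word_value G (take m v)"
    have td: "take m v \<in> lists X" "drop m v \<in> lists X" "take m v @ drop m v = v"
      using Suc.prems by (auto dest: in_set_takeD in_set_dropD)
    obtain q where q: "q \<in> lists (word_ball G X m)" "word_value G q = word_value G (drop m v)"
        "length q \<le> n" "fellow G (word_ball G X m) m \<one> (drop m v) q"
    proof -
      have "length (drop m v) \<le> m * n" using Suc.prems(2) by simp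
      then show thesis using Suc.IH[OF td(2)] that by blast
    qed
    have "word_length G X ?z \<le> m" using length_ge_word_length[OF td(1)] by simp
    then have z: "?z \<in> word_ball G X m" using td by (simp add: word_ball_def)
    then have zc: "?z \<in> carrier G" by (simp add: word_ball_def)
    have wB: "[?z] \<in> lists (word_ball G X m)" "take m v \<in> lists (word_ball G X m)"
        "drop m v \<in> lists (word_ball G X m)"
      using z subsetD[OF sub td(1)] subsetD[OF sub td(2)] by simp_all
    have "fellow G (word_ball G X m) m \<one> (take m v) [?z]"
      using wB zc assms(1) by (intro B.fellow_same_value) simp_all
    then have "fellow G (word_ball G X m) m \<one> (take m v @ drop m v) ([?z] @ q)"
      using q wB zc by (intro B.fellow_append[where k = \<one>]) simp_all
    moreover have "word_value G (?z # q) = word_value G v"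
      using q(2) value_append[OF td(1,2)] td(3) by simp
    ultimately show ?case using q z td(3) by (intro bexI[of _ "?z # q"]) simp_all
  qed
  then show thesis using that by blast
qed

text \<open>A word of length \<open>n + 1\<close> over the ball that is not geodesic expands to a word over \<open>X\<close> of length at most
\<open>m * n + m\<close> whose value has length at most \<open>m * n\<close>. After at most \<open>m\<close> shortenings its length is at most
\<open>m * n\<close>, and then it can be cut into \<open>n\<close> pieces of length at most \<open>m\<close>.\<close>

lemma word_fftp_ball:
  assumes fftp: "word_fftp G X K" and m: "m \<ge> 1"
  shows "word_fftp G (word_ball G X m) (m + m * K + m)"
  unfolding word_fftp_def
proof (intro ballI impI)
  let ?B = "word_ball G X m"
  interpret B: marked_group G ?B
    by (rule marked_group.intro[OF is_group])
      (rule marked_group_axioms.intro[OF generating_word_ball[OF m]])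
  have sub: "X \<subseteq> ?B" "lists X \<subseteq> lists ?B"
    using generators_subset_word_ball[OF m] lists_mono by auto
  fix w assume w: "w \<in> lists ?B" "word_length G ?B (word_value G w) < length w"
  obtain v where v: "v \<in> lists X" "word_value G v = word_value G w" "length v \<le> m * length w"
      "fellow G ?B m \<one> w v"
    by (rule expand_ball_word[OF m w(1)])
  obtain n where n: "length w = Suc n" using w(2) by (cases "length w") auto
  \<comment> \<open>Expanding a geodesic word over the ball shows that the length \<open>m * n\<close> is attainable over \<open>X\<close>.\<close>
  obtain s where s: "s \<in> lists ?B" "word_value G s = word_value G w" "length s \<le> n"
    using B.geodesic_word_exists[OF B.value_closed[OF w(1)]] w(2) n
    by (metis less_Suc_eq_le)
  obtain s' where s': "s' \<in> lists X" "word_value G s' = word_value G s" "length s' \<le> m * length s"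
    using expand_ball_word[OF m s(1)] by blast
  have "word_length G X (word_value G v) \<le> m * n"
  proof -
    have "word_length G X (word_value G v) \<le> length s'"
      using length_ge_word_length[OF s'(1)] s' s v by simp
    also have "\<dots> \<le> m * length s" by (rule s')
    also have "\<dots> \<le> m * n" using s(3) by simp
    finally show ?thesis .
  qed
  moreover have "length v \<le> m * n + m" using v(3) n by simp
  ultimately obtain u where u: "u \<in> lists X" "word_value G u = word_value G v"
      "length u \<le> m * n" "fellow G X (m * K) \<one> v u"
    using word_fftp_iterate[OF fftp v(1)] by blast
  obtain q where q: "q \<in> lists ?B" "word_value G q = word_value G u" "length q \<le> n"
      "fellow G ?B m \<one> u q"
    by (rule chunk_word[OF m u(1,3)])
  have "id \<in> hom G G" "id ` X \<subseteq> ?B" using sub(1) by (simp_all add: hom_def)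
  from fellow_map_hom[OF marked_group_axioms B.marked_group_axioms this u(4) v(1) u(1)]
  have vu: "fellow G ?B (m * K) \<one> v u" by simp
  have "v \<in> lists ?B" "u \<in> lists ?B" using u(1) v(1) sub(2) by blast+
  then have "fellow G ?B (m + m * K + m) \<one> w q"
    using B.fellow_trans_one[OF B.fellow_trans_one[OF v(4) vu] q(4)] w(1) q(1) by blast
  then show "\<exists>q\<in>lists ?B. word_value G q = word_value G w \<and> length q < length w \<and>
      fellow G ?B (m + m * K + m) \<one> w q"
    using q u v n by auto
qed

text \<open>Spelling \<open>inv h\<close> and \<open>k\<close> by at most one letter each extends \<open>w\<close> to a word for \<open>g\<close> that exceeds the
length of \<open>g\<close> by at most four: two for the new letters, and two because the lengths of \<open>g\<close> and of the
value of \<open>w\<close> differ by at most two. Geodesics with the same end points need not fellow travel, which is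
why the geodesic for \<open>g\<close> is obtained by shortening this particular word.\<close>

lemma geodesic_push:
  assumes fftp: "word_fftp G X K"
    and w: "w \<in> lists X" "length w = word_length G X (word_value G w)"
    and g: "g \<in> carrier G" "h \<otimes> g = word_value G w \<otimes> k"
    and h: "h \<in> carrier G" "word_length G X h \<le> 1" "word_length G X (inv h) \<le> 1"
    and k: "k \<in> carrier G" "word_length G X k \<le> 1" "word_length G X (inv k) \<le> 1"
  obtains q where "q \<in> lists X" "word_value G q = g" "length q = word_length G X g"
    "fellow G X (4 * K + 1) h w q"
proof -
  have ih: "inv h \<in> carrier G" using h(1) by simp
  obtain s where s: "s \<in> lists X" "word_value G s = inv h" "length s = word_length G X (inv h)"
    by (rule geodesic_word_exists[OF ih])
  obtain t where t: "t \<in> lists X" "word_value G t = k" "length t = word_length G X k"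
    by (rule geodesic_word_exists[OF k(1)])
  let ?v = "s @ w @ t"
  have v: "?v \<in> lists X" using s t w by simp
  have gv: "word_value G ?v = g"
  proof -
    have "word_value G ?v = inv h \<otimes> (word_value G w \<otimes> k)"
      using s t w by (simp add: value_append)
    also have "\<dots> = g" using g h by (simp flip: g(2))
    finally show ?thesis .
  qed
  have "length w \<le> word_length G X g + 2"
  proof -
    have "word_value G w = h \<otimes> g \<otimes> inv k" using g w(1) k(1) by (simp add: m_assoc)
    then have "word_length G X (word_value G w)
        \<le> word_length G X h + word_length G X g + word_length G X (inv k)"
      using word_length_mult[of "h \<otimes> g" "inv k"] word_length_mult[of h g] h k g(1) by simp
    then show ?thesis using w(2) h k by simp
  qed
  then have "length ?v \<le> word_length G X g + 4" using s(3) t(3) h k by simp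
  then obtain q where q: "q \<in> lists X" "word_value G q = g" "length q \<le> word_length G X g"
      "fellow G X (4 * K) \<one> ?v q"
    using word_fftp_iterate[OF fftp v, of "word_length G X g" 4] gv by auto
  have near_prefix: "word_length G X (word_value G (take i r)) \<le> 1" if "r \<in> lists X" "length r \<le> 1" for i r
    using that length_ge_word_length[of "take i r"] by simp
  have hs: "fellow G X 1 h [] s" unfolding fellow_def
  proof (rule async_fellow_travelI[where \<phi> = "\<lambda>_. 0" and \<psi> = "\<lambda>_. 0"])
    fix i
    have "take i s = [] \<or> take i s = s" using s(3) h(3) by (cases s; cases i) auto
    then have "word_value G (take i s) = \<one> \<or> word_value G (take i s) = inv h"
      using s(2) by (metis word_value_Nil)
    then show "word_dist G X (word_value G (take 0 [])) (h \<otimes> word_value G (take i s)) \<le> 1"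
      using h by (elim disjE) (simp_all add: word_dist_def)
    show "word_dist G X (word_value G (take i [])) (h \<otimes> word_value G (take 0 s)) \<le> 1"
      using h by (auto simp: word_dist_def)
  qed (simp_all add: mono_def)
  have kt: "fellow G X 1 \<one> [] t" unfolding fellow_def
  proof (rule async_fellow_travelI[where \<phi> = "\<lambda>_. 0" and \<psi> = "\<lambda>_. 0"])
    fix i
    show "word_dist G X (word_value G (take 0 [])) (\<one> \<otimes> word_value G (take i t)) \<le> 1"
      using near_prefix[of t i] t k by (simp add: word_dist_def)
    show "word_dist G X (word_value G (take i [])) (\<one> \<otimes> word_value G (take 0 t)) \<le> 1"
      by (simp add: word_dist_def)
  qed (simp_all add: mono_def)
  have "fellow G X 1 \<one> (w @ []) (w @ t)"
    using fellow_append[OF fellow_refl[OF w(1)] kt] w(1) t(1) by simp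
  then have "fellow G X 1 h ([] @ (w @ [])) (s @ (w @ t))"
    using fellow_append[OF hs, of \<one> "w @ []" "w @ t"] s t w(1) h(1) by simp
  then have "fellow G X 1 h w ?v" by simp
  from fellow_trans[OF this q(4) w(1) v q(1) h(1)] have "fellow G X (4 * K + 1) h w q"
    using h(1) by (simp add: add.commute)
  moreover have "length q = word_length G X g" using q length_ge_word_length[OF q(1)] by simp
  ultimately show thesis using that q(1,2) by blast
qed

end

text \<open>The property depends on the generating set, but any finite set can be added by passing to a ball.\<close>

lemma fftp_generators_containing:
  assumes "group G" "has_fftp G" "finite F" "F \<subseteq> carrier G"
  obtains X K where "finite X" "marked_group G X" "F \<subseteq> X" "word_fftp G X K"
proof -
  obtain Y where Y: "finite Y" "generating_set G Y" "fftp_wrt G Y"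
    using assms(2) by (auto simp: has_fftp_def)
  interpret marked_group G Y
    by (rule marked_group.intro[OF assms(1)]) (rule marked_group_axioms.intro[OF Y(2)])
  obtain K where K: "word_fftp G Y K" using Y(3) by (auto simp: fftp_wrt_iff_word_fftp)
  define m where "m = Suc (Max (insert 0 (word_length G Y ` F)))"
  have "m \<ge> 1" by (simp add: m_def)
  moreover have "word_length G Y g \<le> m" if "g \<in> F" for g
    unfolding m_def using assms(3) that by (intro le_SucI Max_ge) auto
  then have "F \<subseteq> word_ball G Y m" using assms(4) by (auto simp: word_ball_def)
  moreover have "marked_group G (word_ball G Y m)"
    by (rule marked_group.intro[OF assms(1)])
      (rule marked_group_axioms.intro[OF generating_word_ball[OF \<open>m \<ge> 1\<close>]])
  ultimately show thesis
    using that[OF finite_word_ball[OF Y(1)]] word_fftp_ball[OF K \<open>m \<ge> 1\<close>] by blast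
qed

section \<open>Vertex groups and edge groups\<close>

sublocale graph_of_groups \<subseteq> base: bidirected_digraph "base \<G>" "arc_rev \<G>"
  by (rule bidirected)

context graph_of_groups begin

abbreviation "V \<equiv> verts (base \<G>)"
abbreviation "E \<equiv> arcs (base \<G>)"
abbreviation "hd_of \<equiv> head (base \<G>)"
abbreviation "tl_of \<equiv> tail (base \<G>)"
abbreviation "rv \<equiv> arc_rev \<G>"
abbreviation "emb \<equiv> edge_emb \<G>"
abbreviation "VG \<equiv> vertex_group \<G>"
abbreviation "EG \<equiv> edge_group \<G>"

lemma vertex_monoid:
  assumes "v \<in> V"
  shows vertex_m_closed [simp]: "\<lbrakk>a \<in> carrier (VG v); b \<in> carrier (VG v)\<rbrakk> \<Longrightarrow> a \<otimes>\<^bsub>VG v\<^esub> b \<in> carrier (VG v)"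
    and vertex_one_closed [simp]: "\<one>\<^bsub>VG v\<^esub> \<in> carrier (VG v)"
    and vertex_l_one [simp]: "a \<in> carrier (VG v) \<Longrightarrow> \<one>\<^bsub>VG v\<^esub> \<otimes>\<^bsub>VG v\<^esub> a = a"
    and vertex_r_one [simp]: "a \<in> carrier (VG v) \<Longrightarrow> a \<otimes>\<^bsub>VG v\<^esub> \<one>\<^bsub>VG v\<^esub> = a"
    and vertex_m_assoc: "\<lbrakk>a \<in> carrier (VG v); b \<in> carrier (VG v); c \<in> carrier (VG v)\<rbrakk>
      \<Longrightarrow> a \<otimes>\<^bsub>VG v\<^esub> b \<otimes>\<^bsub>VG v\<^esub> c = a \<otimes>\<^bsub>VG v\<^esub> (b \<otimes>\<^bsub>VG v\<^esub> c)"
proof -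
  interpret group "VG v" by (rule group_vertex[OF assms])
  show "\<lbrakk>a \<in> carrier (VG v); b \<in> carrier (VG v)\<rbrakk> \<Longrightarrow> a \<otimes>\<^bsub>VG v\<^esub> b \<in> carrier (VG v)"
    "\<one>\<^bsub>VG v\<^esub> \<in> carrier (VG v)"
    "a \<in> carrier (VG v) \<Longrightarrow> \<one>\<^bsub>VG v\<^esub> \<otimes>\<^bsub>VG v\<^esub> a = a"
    "a \<in> carrier (VG v) \<Longrightarrow> a \<otimes>\<^bsub>VG v\<^esub> \<one>\<^bsub>VG v\<^esub> = a"
    "\<lbrakk>a \<in> carrier (VG v); b \<in> carrier (VG v); c \<in> carrier (VG v)\<rbrakk>
      \<Longrightarrow> a \<otimes>\<^bsub>VG v\<^esub> b \<otimes>\<^bsub>VG v\<^esub> c = a \<otimes>\<^bsub>VG v\<^esub> (b \<otimes>\<^bsub>VG v\<^esub> c)"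
    by (simp_all add: m_assoc)
qed

lemma emb_group_hom: "e \<in> E \<Longrightarrow> group_hom (EG e) (VG (hd_of e)) (emb e)"
  using group_edge group_vertex emb_hom
  by (simp add: group_hom_def group_hom_axioms_def)

lemma emb_closed [simp]: "\<lbrakk>e \<in> E; h \<in> carrier (EG e)\<rbrakk> \<Longrightarrow> emb e h \<in> carrier (VG (hd_of e))"
  by (rule group_hom.hom_closed[OF emb_group_hom])

lemma emb_rev_closed [simp]:
  "\<lbrakk>e \<in> E; h \<in> carrier (EG e)\<rbrakk> \<Longrightarrow> emb (rv e) h \<in> carrier (VG (tl_of e))"
  using emb_closed[of "rv e" h] by (simp add: edge_group_rev)

lemma emb_mult:
  "\<lbrakk>e \<in> E; h \<in> carrier (EG e); k \<in> carrier (EG e)\<rbrakk>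
    \<Longrightarrow> emb e (h \<otimes>\<^bsub>EG e\<^esub> k) = emb e h \<otimes>\<^bsub>VG (hd_of e)\<^esub> emb e k"
  by (rule group_hom.hom_mult[OF emb_group_hom])

lemma emb_rev_mult:
  "\<lbrakk>e \<in> E; h \<in> carrier (EG e); k \<in> carrier (EG e)\<rbrakk>
    \<Longrightarrow> emb (rv e) (h \<otimes>\<^bsub>EG e\<^esub> k) = emb (rv e) h \<otimes>\<^bsub>VG (tl_of e)\<^esub> emb (rv e) k"
  using emb_mult[of "rv e" h k] by (simp add: edge_group_rev)

lemma emb_one [simp]: "e \<in> E \<Longrightarrow> emb e \<one>\<^bsub>EG e\<^esub> = \<one>\<^bsub>VG (hd_of e)\<^esub>"
  by (rule group_hom.hom_one[OF emb_group_hom])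

lemma emb_rev_one [simp]: "e \<in> E \<Longrightarrow> emb (rv e) \<one>\<^bsub>EG e\<^esub> = \<one>\<^bsub>VG (tl_of e)\<^esub>"
  using emb_one[of "rv e"] by (simp add: edge_group_rev)

lemma edge_one_closed [simp]: "e \<in> E \<Longrightarrow> \<one>\<^bsub>EG e\<^esub> \<in> carrier (EG e)"
  by (rule monoid.one_closed[OF group.is_monoid[OF group_edge]])

lemma edge_m_closed [simp]:
  "\<lbrakk>e \<in> E; h \<in> carrier (EG e); k \<in> carrier (EG e)\<rbrakk> \<Longrightarrow> h \<otimes>\<^bsub>EG e\<^esub> k \<in> carrier (EG e)"
  by (rule monoid.m_closed[OF group.is_monoid[OF group_edge]])

lemma edge_inv_closed [simp]:
  "\<lbrakk>e \<in> E; h \<in> carrier (EG e)\<rbrakk> \<Longrightarrow> inv\<^bsub>EG e\<^esub> h \<in> carrier (EG e)"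
  by (rule group.inv_closed[OF group_edge])

lemma edge_l_inv [simp]:
  "\<lbrakk>e \<in> E; h \<in> carrier (EG e)\<rbrakk> \<Longrightarrow> inv\<^bsub>EG e\<^esub> h \<otimes>\<^bsub>EG e\<^esub> h = \<one>\<^bsub>EG e\<^esub>"
  by (rule group.l_inv[OF group_edge])

lemma edge_r_inv [simp]:
  "\<lbrakk>e \<in> E; h \<in> carrier (EG e)\<rbrakk> \<Longrightarrow> h \<otimes>\<^bsub>EG e\<^esub> inv\<^bsub>EG e\<^esub> h = \<one>\<^bsub>EG e\<^esub>"
  by (rule group.r_inv[OF group_edge])

lemma emb_mult_left:
  assumes "e \<in> E" "h \<in> carrier (EG e)" "k \<in> carrier (EG e)"
  shows "b \<in> carrier (VG (hd_of e)) \<Longrightarrow>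
      emb e h \<otimes>\<^bsub>VG (hd_of e)\<^esub> (emb e k \<otimes>\<^bsub>VG (hd_of e)\<^esub> b) = emb e (h \<otimes>\<^bsub>EG e\<^esub> k) \<otimes>\<^bsub>VG (hd_of e)\<^esub> b"
    and "a \<in> carrier (VG (tl_of e)) \<Longrightarrow>
      a \<otimes>\<^bsub>VG (tl_of e)\<^esub> emb (rv e) h \<otimes>\<^bsub>VG (tl_of e)\<^esub> emb (rv e) k = a \<otimes>\<^bsub>VG (tl_of e)\<^esub> emb (rv e) (h \<otimes>\<^bsub>EG e\<^esub> k)"
  using assms by (simp_all add: emb_mult emb_rev_mult vertex_m_assoc)

section \<open>Paths in a graph of groups\<close>

lemma gpaths_Nil [simp]:
  "(a, []) \<in> gpaths \<G> u v \<longleftrightarrow> u = v \<and> u \<in> V \<and> a \<in> carrier (VG u)"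
  by (auto simp: gpaths_def base.awalk_Nil_iff)

lemma gpaths_Cons [simp]:
  "(a, (e, b) # s) \<in> gpaths \<G> u v \<longleftrightarrow>
     e \<in> E \<and> u = tl_of e \<and> a \<in> carrier (VG (tl_of e)) \<and> (b, s) \<in> gpaths \<G> (hd_of e) v"
  by (auto simp: gpaths_def base.awalk_Cons_iff)

lemma gpaths_head: "(a, s) \<in> gpaths \<G> u v \<Longrightarrow> u \<in> V \<and> a \<in> carrier (VG u)"
  by (cases s) auto

lemma gpaths_change_head:
  "\<lbrakk>(a, s) \<in> gpaths \<G> u v; b \<in> carrier (VG u)\<rbrakk> \<Longrightarrow> (b, s) \<in> gpaths \<G> u v"
  by (cases s) auto

lemma reduce_gpaths:
  "\<lbrakk>gpath_reduce \<G> p q; p \<in> gpaths \<G> u v\<rbrakk> \<Longrightarrow> q \<in> gpaths \<G> u v"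
proof (induction arbitrary: u rule: gpath_reduce.induct)
  case (here e h a b s)
  then have "(b, s) \<in> gpaths \<G> (tl_of e) v" by simp
  with here show ?case using gpaths_head[of b s "tl_of e" v]
    by (auto intro: gpaths_change_head)
qed auto

lemma reduce_length: "gpath_reduce \<G> p q \<Longrightarrow> length (snd q) < length (snd p)"
  by (induction rule: gpath_reduce.induct) auto

text \<open>Multiplying the first label from the left commutes with reduction.\<close>

lemma reduce_translate:
  assumes "gpath_reduce \<G> (b, s) (c, t)" "(b, s) \<in> gpaths \<G> u v" "x \<in> carrier (VG u)"
  shows "gpath_reduce \<G> (x \<otimes>\<^bsub>VG u\<^esub> b, s) (x \<otimes>\<^bsub>VG u\<^esub> c, t)"
  using assms(1)
proof cases
  case (here e h b')
  then have u: "u = tl_of e" "u \<in> V" "b \<in> carrier (VG u)" "b' \<in> carrier (VG u)"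
    using assms(2) gpaths_head[of b' t u v] by auto
  have "gpath_reduce \<G> (x \<otimes>\<^bsub>VG u\<^esub> b, (e, emb e h) # (rv e, b') # t)
      (x \<otimes>\<^bsub>VG u\<^esub> b \<otimes>\<^bsub>VG (tl_of e)\<^esub> emb (rv e) h \<otimes>\<^bsub>VG (tl_of e)\<^esub> b', t)"
    using here by (intro gpath_reduce.here)
  then show ?thesis using here u assms(3) by (simp add: vertex_m_assoc)
next
  case (later c' s' d t' e)
  then show ?thesis by (auto intro: gpath_reduce.later)
qed

section \<open>Sliding edge group elements\<close>

text \<open>Two paths are related if one arises from the other by moving edge group elements across arcs, that is
by replacing \<open>a \<cdot> e \<cdot> emb e h \<cdot> b\<close> with \<open>a \<cdot> emb (rv e) h \<cdot> e \<cdot> b\<close>. This is the part of homotopy that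
keeps the arcs.\<close>

inductive slide_eq :: "('e, 'a) gpath \<Rightarrow> ('e, 'a) gpath \<Rightarrow> bool" where
  Nil: "slide_eq (a, []) (a, [])"
| Cons: "\<lbrakk>h \<in> carrier (EG e); slide_eq (b, s) (emb e h \<otimes>\<^bsub>VG (hd_of e)\<^esub> b', s')\<rbrakk>
    \<Longrightarrow> slide_eq (a, (e, b) # s) (a \<otimes>\<^bsub>VG (tl_of e)\<^esub> emb (rv e) h, (e, b') # s')"

inductive_cases slide_eq_ConsE: "slide_eq (a, (e, b) # s) p"

lemma slide_eq_translate:
  assumes "slide_eq (a, s) (a', s')" "(a, s) \<in> gpaths \<G> u v" "x \<in> carrier (VG u)"
  shows "slide_eq (x \<otimes>\<^bsub>VG u\<^esub> a, s) (x \<otimes>\<^bsub>VG u\<^esub> a', s')"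
  using assms(1)
proof cases
  case Nil
  then show ?thesis by (simp add: slide_eq.Nil)
next
  case (Cons h e b t b' t')
  then have "slide_eq (x \<otimes>\<^bsub>VG u\<^esub> a, (e, b) # t)
      (x \<otimes>\<^bsub>VG u\<^esub> a \<otimes>\<^bsub>VG (tl_of e)\<^esub> emb (rv e) h, (e, b') # t')"
    by (intro slide_eq.Cons)
  then show ?thesis using Cons assms(2,3) by (auto simp: vertex_m_assoc)
qed

lemma slide_eq_refl: "(a, s) \<in> gpaths \<G> u v \<Longrightarrow> slide_eq (a, s) (a, s)"
proof (induction s arbitrary: a u)
  case Nil
  show ?case by (rule slide_eq.Nil)
next
  case (Cons eb s)
  obtain e b where eb: "eb = (e, b)" by fastforce
  have b: "b \<in> carrier (VG (hd_of e))" using Cons.prems gpaths_head[of b s] by (auto simp: eb)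
  have "slide_eq (a, (e, b) # s) (a \<otimes>\<^bsub>VG (tl_of e)\<^esub> emb (rv e) \<one>\<^bsub>EG e\<^esub>, (e, b) # s)"
    using Cons b by (intro slide_eq.Cons) (auto simp: eb)
  then show ?case using Cons.prems by (simp add: eb)
qed

lemma slide_eq_sym:
  "\<lbrakk>slide_eq p q; p \<in> gpaths \<G> u v; q \<in> gpaths \<G> u v\<rbrakk> \<Longrightarrow> slide_eq q p"
proof (induction arbitrary: u rule: slide_eq.induct)
  case (Nil a)
  show ?case by (rule slide_eq.Nil)
next
  case (Cons h e b s b' s' a)
  have e: "e \<in> E" "a \<in> carrier (VG (tl_of e))" "(b', s') \<in> gpaths \<G> (hd_of e) v"
    "(b, s) \<in> gpaths \<G> (hd_of e) v"
    using Cons.prems by auto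
  then have b: "b' \<in> carrier (VG (hd_of e))" "b \<in> carrier (VG (hd_of e))" using gpaths_head by blast+
  let ?h = "inv\<^bsub>EG e\<^esub> h"
  have valid: "(emb e h \<otimes>\<^bsub>VG (hd_of e)\<^esub> b', s') \<in> gpaths \<G> (hd_of e) v"
    using e b Cons.hyps by (intro gpaths_change_head[OF e(3)]) simp
  have "slide_eq (emb e h \<otimes>\<^bsub>VG (hd_of e)\<^esub> b', s') (b, s)"
    using Cons.IH[OF e(4) valid] .
  from slide_eq_translate[OF this valid, of "emb e ?h"]
  have "slide_eq (b', s') (emb e ?h \<otimes>\<^bsub>VG (hd_of e)\<^esub> b, s)"
    using e b Cons.hyps by (simp add: emb_mult_left)
  then have "slide_eq (a \<otimes>\<^bsub>VG (tl_of e)\<^esub> emb (rv e) h, (e, b') # s')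
      (a \<otimes>\<^bsub>VG (tl_of e)\<^esub> emb (rv e) h \<otimes>\<^bsub>VG (tl_of e)\<^esub> emb (rv e) ?h, (e, b) # s)"
    using Cons.hyps e by (intro slide_eq.Cons) auto
  then show ?case using e Cons.hyps by (simp add: emb_mult_left)
qed

lemma slide_eq_trans:
  "\<lbrakk>slide_eq p q; slide_eq q r; p \<in> gpaths \<G> u v; q \<in> gpaths \<G> u v; r \<in> gpaths \<G> u v\<rbrakk> \<Longrightarrow> slide_eq p r"
proof (induction arbitrary: u r rule: slide_eq.induct)
  case (Nil a)
  then show ?case by simp
next
  case (Cons h e b s b' s' a)
  have e: "e \<in> E" "a \<in> carrier (VG (tl_of e))" "(b', s') \<in> gpaths \<G> (hd_of e) v"
    "(b, s) \<in> gpaths \<G> (hd_of e) v"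
    using Cons.prems by auto
  then have b: "b' \<in> carrier (VG (hd_of e))" "b \<in> carrier (VG (hd_of e))" using gpaths_head by blast+
  obtain k b'' s'' where k: "k \<in> carrier (EG e)"
      "slide_eq (b', s') (emb e k \<otimes>\<^bsub>VG (hd_of e)\<^esub> b'', s'')"
      "r = (a \<otimes>\<^bsub>VG (tl_of e)\<^esub> emb (rv e) h \<otimes>\<^bsub>VG (tl_of e)\<^esub> emb (rv e) k, (e, b'') # s'')"
    using Cons.prems(1) by (auto elim: slide_eq_ConsE)
  have r: "(b'', s'') \<in> gpaths \<G> (hd_of e) v" using k Cons.prems by auto
  then have b'': "b'' \<in> carrier (VG (hd_of e))" using gpaths_head by blast
  have valid: "(emb e h \<otimes>\<^bsub>VG (hd_of e)\<^esub> b', s') \<in> gpaths \<G> (hd_of e) v"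
    "(emb e (h \<otimes>\<^bsub>EG e\<^esub> k) \<otimes>\<^bsub>VG (hd_of e)\<^esub> b'', s'') \<in> gpaths \<G> (hd_of e) v"
    using e b b'' k Cons.hyps by (auto intro!: gpaths_change_head[OF e(3)] gpaths_change_head[OF r])
  have "slide_eq (emb e h \<otimes>\<^bsub>VG (hd_of e)\<^esub> b', s') (emb e (h \<otimes>\<^bsub>EG e\<^esub> k) \<otimes>\<^bsub>VG (hd_of e)\<^esub> b'', s'')"
    using slide_eq_translate[OF k(2) e(3), of "emb e h"] e b b'' k Cons.hyps
    by (simp add: emb_mult_left)
  from Cons.IH[OF this e(4) valid]
  have "slide_eq (a, (e, b) # s) (a \<otimes>\<^bsub>VG (tl_of e)\<^esub> emb (rv e) (h \<otimes>\<^bsub>EG e\<^esub> k), (e, b'') # s'')"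
    using Cons.hyps e k by (intro slide_eq.Cons) auto
  then show ?case using e k Cons.hyps by (simp add: emb_mult_left)
qed

section \<open>Confluence\<close>

text \<open>Sliding can only multiply the label inside a backtrack by edge group elements from both sides, so the
label stays in the edge group and the backtrack can still be cancelled.\<close>

lemma reduce_slide:
  "\<lbrakk>gpath_reduce \<G> p q; slide_eq p p'; p \<in> gpaths \<G> u v; p' \<in> gpaths \<G> u v\<rbrakk>
    \<Longrightarrow> \<exists>q'. gpath_reduce \<G> p' q' \<and> slide_eq q q'"
proof (induction arbitrary: u p' rule: gpath_reduce.induct)
  case (here e h a b s)
  obtain k b1 t where k: "k \<in> carrier (EG e)"
      "p' = (a \<otimes>\<^bsub>VG (tl_of e)\<^esub> emb (rv e) k, (e, b1) # t)"
      "slide_eq (emb e h, (rv e, b) # s) (emb e k \<otimes>\<^bsub>VG (hd_of e)\<^esub> b1, t)"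
    using here.prems(1) by (auto elim: slide_eq_ConsE)
  obtain l b2 s' where l: "l \<in> carrier (EG e)"
      "emb e k \<otimes>\<^bsub>VG (hd_of e)\<^esub> b1 = emb e h \<otimes>\<^bsub>VG (hd_of e)\<^esub> emb e l" "t = (rv e, b2) # s'"
      "slide_eq (b, s) (emb (rv e) l \<otimes>\<^bsub>VG (tl_of e)\<^esub> b2, s')"
    using k(3) here.hyps by (auto elim!: slide_eq_ConsE simp: edge_group_rev)
  have valid: "a \<in> carrier (VG (tl_of e))" "(b, s) \<in> gpaths \<G> (tl_of e) v" "u = tl_of e"
      "(b2, s') \<in> gpaths \<G> (tl_of e) v" "b1 \<in> carrier (VG (hd_of e))"
    using here.prems here.hyps k l by auto
  then have b: "b \<in> carrier (VG (tl_of e))" "b2 \<in> carrier (VG (tl_of e))" using gpaths_head by blast+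
  \<comment> \<open>Sliding has turned the label \<open>h\<close> inside the backtrack into \<open>k\<close> inverse times \<open>h l\<close>.\<close>
  let ?m = "inv\<^bsub>EG e\<^esub> k \<otimes>\<^bsub>EG e\<^esub> (h \<otimes>\<^bsub>EG e\<^esub> l)"
  have "b1 = emb e (inv\<^bsub>EG e\<^esub> k) \<otimes>\<^bsub>VG (hd_of e)\<^esub> (emb e k \<otimes>\<^bsub>VG (hd_of e)\<^esub> b1)"
    using here.hyps k valid by (simp add: emb_mult_left)
  also have "\<dots> = emb e ?m" using here.hyps k l by (simp add: emb_mult)
  finally have b1: "b1 = emb e ?m" .
  have km: "k \<otimes>\<^bsub>EG e\<^esub> ?m = h \<otimes>\<^bsub>EG e\<^esub> l"
  proof -
    interpret group "EG e" by (rule group_edge[OF here.hyps(1)])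
    show ?thesis using here.hyps k l by (simp flip: m_assoc)
  qed
  have "gpath_reduce \<G> p' (a \<otimes>\<^bsub>VG (tl_of e)\<^esub> emb (rv e) k \<otimes>\<^bsub>VG (tl_of e)\<^esub> emb (rv e) ?m
      \<otimes>\<^bsub>VG (tl_of e)\<^esub> b2, s')"
    unfolding k(2) l(3) b1 using here.hyps k l by (intro gpath_reduce.here) simp_all
  moreover have "a \<otimes>\<^bsub>VG (tl_of e)\<^esub> emb (rv e) k \<otimes>\<^bsub>VG (tl_of e)\<^esub> emb (rv e) ?m \<otimes>\<^bsub>VG (tl_of e)\<^esub> b2
      = a \<otimes>\<^bsub>VG (tl_of e)\<^esub> emb (rv e) h \<otimes>\<^bsub>VG (tl_of e)\<^esub> (emb (rv e) l \<otimes>\<^bsub>VG (tl_of e)\<^esub> b2)"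
    using here.hyps k l valid b by (simp add: emb_mult_left km) (simp add: emb_rev_mult vertex_m_assoc)
  moreover have "slide_eq (a \<otimes>\<^bsub>VG (tl_of e)\<^esub> emb (rv e) h \<otimes>\<^bsub>VG (tl_of e)\<^esub> b, s)
      (a \<otimes>\<^bsub>VG (tl_of e)\<^esub> emb (rv e) h \<otimes>\<^bsub>VG (tl_of e)\<^esub> (emb (rv e) l \<otimes>\<^bsub>VG (tl_of e)\<^esub> b2), s')"
    using slide_eq_translate[OF l(4) valid(2)] here.hyps valid by simp
  ultimately show ?case by auto
next
  case (later c s c' s' a e)
  have e: "e \<in> E" "a \<in> carrier (VG (tl_of e))" "(c, s) \<in> gpaths \<G> (hd_of e) v"
    using later.prems by auto
  obtain k b1 t where k: "k \<in> carrier (EG e)"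
      "p' = (a \<otimes>\<^bsub>VG (tl_of e)\<^esub> emb (rv e) k, (e, b1) # t)"
      "slide_eq (c, s) (emb e k \<otimes>\<^bsub>VG (hd_of e)\<^esub> b1, t)"
    using later.prems(1) by (auto elim: slide_eq_ConsE)
  have p': "(b1, t) \<in> gpaths \<G> (hd_of e) v" using later.prems k by auto
  then have b1: "b1 \<in> carrier (VG (hd_of e))" using gpaths_head by blast
  have kb1: "(emb e k \<otimes>\<^bsub>VG (hd_of e)\<^esub> b1, t) \<in> gpaths \<G> (hd_of e) v"
    using e k b1 by (auto intro: gpaths_change_head[OF p'])
  obtain d r where d: "gpath_reduce \<G> (emb e k \<otimes>\<^bsub>VG (hd_of e)\<^esub> b1, t) (d, r)" "slide_eq (c', s') (d, r)"
    using later.IH[OF k(3) e(3) kb1] by auto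
  have dr: "(d, r) \<in> gpaths \<G> (hd_of e) v" using reduce_gpaths[OF d(1) kb1] .
  then have dc: "d \<in> carrier (VG (hd_of e))" using gpaths_head by blast
  let ?k = "inv\<^bsub>EG e\<^esub> k"
  have "gpath_reduce \<G> (b1, t) (emb e ?k \<otimes>\<^bsub>VG (hd_of e)\<^esub> d, r)"
    using reduce_translate[OF d(1) kb1, of "emb e ?k"] e k b1 by (simp add: emb_mult_left)
  then have "gpath_reduce \<G> p' (a \<otimes>\<^bsub>VG (tl_of e)\<^esub> emb (rv e) k, (e, emb e ?k \<otimes>\<^bsub>VG (hd_of e)\<^esub> d) # r)"
    unfolding k(2) by (rule gpath_reduce.later)
  moreover have "slide_eq (a, (e, c') # s')
      (a \<otimes>\<^bsub>VG (tl_of e)\<^esub> emb (rv e) k, (e, emb e ?k \<otimes>\<^bsub>VG (hd_of e)\<^esub> d) # r)"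
    using d(2) e k dc by (intro slide_eq.Cons) (simp_all add: emb_mult_left)
  ultimately show ?case by blast
qed

inductive_cases reduce_ConsE: "gpath_reduce \<G> (a, (e, b) # s) q"

text \<open>A second reduction of a path that starts with a backtrack is the same one, by injectivity of the edge
map, or it takes place in the rest of the path, or the two backtracks overlap in
\<open>e \<cdot> emb e h \<cdot> rv e \<cdot> emb (rv e) k \<cdot> e\<close>. In the last case the results differ by sliding \<open>h k\<close> across \<open>e\<close>.\<close>

lemma reduce_diamond_here:
  assumes e: "e \<in> E" "h \<in> carrier (EG e)"
    and p: "(a, (e, emb e h) # (rv e, b) # s) \<in> gpaths \<G> u v"
    and red: "gpath_reduce \<G> (a, (e, emb e h) # (rv e, b) # s) r"
  defines "q \<equiv> (a \<otimes>\<^bsub>VG (tl_of e)\<^esub> emb (rv e) h \<otimes>\<^bsub>VG (tl_of e)\<^esub> b, s)"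
  shows "slide_eq q r \<or> (\<exists>x y. gpath_reduce \<G> q x \<and> gpath_reduce \<G> r y \<and> slide_eq x y)"
proof -
  have valid: "a \<in> carrier (VG (tl_of e))" "(b, s) \<in> gpaths \<G> (tl_of e) v"
    using p e by auto
  then have b: "b \<in> carrier (VG (tl_of e))" using gpaths_head by blast
  let ?x = "a \<otimes>\<^bsub>VG (tl_of e)\<^esub> emb (rv e) h"
  have x: "?x \<in> carrier (VG (tl_of e))" using valid e by simp
  have q: "q \<in> gpaths \<G> (tl_of e) v" unfolding q_def using valid e b x by (intro gpaths_change_head[OF valid(2)]) simp
  from red consider
      (same) k where "k \<in> carrier (EG e)" "emb e k = emb e h" "r = (a \<otimes>\<^bsub>VG (tl_of e)\<^esub> emb (rv e) k \<otimes>\<^bsub>VG (tl_of e)\<^esub> b, s)"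
    | (overlap) c d where "r = (a, (e, c) # d)" "gpath_reduce \<G> (emb e h, (rv e, b) # s) (c, d)"
    by (auto elim!: reduce_ConsE[of a e "emb e h" "(rv e, b) # s"])
  then show ?thesis
  proof cases
    case same
    then have "k = h" using emb_inj[OF e(1)] e(2) by (auto dest: inj_onD)
    then show ?thesis using same slide_eq_refl q by (auto simp: q_def)
  next
    case overlap
    from overlap(2) consider
        (here2) k c' d' where "k \<in> carrier (EG e)" "b = emb (rv e) k" "s = (e, c') # d'"
          "c = emb e h \<otimes>\<^bsub>VG (hd_of e)\<^esub> emb e k \<otimes>\<^bsub>VG (hd_of e)\<^esub> c'" "d = d'"
      | (later2) b' s' where "c = emb e h" "d = (rv e, b') # s'" "gpath_reduce \<G> (b, s) (b', s')"
      using e by (auto elim!: reduce_ConsE simp: edge_group_rev)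
    then show ?thesis
    proof cases
      case here2
      have c': "(c', d') \<in> gpaths \<G> (hd_of e) v" using valid(2) here2 by simp
      then have c'c: "c' \<in> carrier (VG (hd_of e))" using gpaths_head by blast
      let ?m = "h \<otimes>\<^bsub>EG e\<^esub> k"
      have m: "(emb e ?m \<otimes>\<^bsub>VG (hd_of e)\<^esub> c', d') \<in> gpaths \<G> (hd_of e) v"
        using e here2 c'c by (intro gpaths_change_head[OF c']) simp
      have r: "r = (a, (e, emb e ?m \<otimes>\<^bsub>VG (hd_of e)\<^esub> c') # d')"
        using overlap here2 e c'c by (simp add: emb_mult)
      have "slide_eq r (a \<otimes>\<^bsub>VG (tl_of e)\<^esub> emb (rv e) ?m, (e, c') # d')"
        unfolding r using e here2 slide_eq_refl[OF m] by (intro slide_eq.Cons) simp_all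
      then have rq: "slide_eq r q" using here2 e valid by (simp add: q_def emb_mult_left)
      have rv: "r \<in> gpaths \<G> (tl_of e) v" unfolding r using e valid m by simp
      show ?thesis using slide_eq_sym[OF rq rv q] by blast
    next
      case later2
      let ?y = "(?x \<otimes>\<^bsub>VG (tl_of e)\<^esub> b', s')"
      have 1: "gpath_reduce \<G> q ?y" unfolding q_def by (rule reduce_translate[OF later2(3) valid(2) x])
      have "gpath_reduce \<G> r ?y" unfolding overlap(1) later2 using e by (intro gpath_reduce.here)
      moreover have "slide_eq ?y ?y" using slide_eq_refl reduce_gpaths[OF 1 q] by blast
      ultimately show ?thesis using 1 by blast
    qed
  qed
qed

lemma reduce_diamond:
  "\<lbrakk>gpath_reduce \<G> p q; gpath_reduce \<G> p r; p \<in> gpaths \<G> u v\<rbrakk>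
    \<Longrightarrow> slide_eq q r \<or> (\<exists>x y. gpath_reduce \<G> q x \<and> gpath_reduce \<G> r y \<and> slide_eq x y)"
proof (induction arbitrary: u r rule: gpath_reduce.induct)
  case (here e h a b s)
  show ?case by (rule reduce_diamond_here[OF here.hyps here.prems(2,1)])
next
  case (later c s c' s' a e)
  have e: "e \<in> E" "a \<in> carrier (VG (tl_of e))" "(c, s) \<in> gpaths \<G> (hd_of e) v"
    using later.prems by auto
  from later.prems(1) consider
      (here2) k b d where "k \<in> carrier (EG e)" "c = emb e k" "s = (rv e, b) # d"
        "r = (a \<otimes>\<^bsub>VG (tl_of e)\<^esub> emb (rv e) k \<otimes>\<^bsub>VG (tl_of e)\<^esub> b, d)"
    | (later2) c2 s2 where "r = (a, (e, c2) # s2)" "gpath_reduce \<G> (c, s) (c2, s2)"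
    by (auto elim!: reduce_ConsE[of a e c s])
  then show ?case
  proof cases
    case here2
    have p: "(a, (e, c) # s) \<in> gpaths \<G> (tl_of e) v" using e by simp
    have q: "gpath_reduce \<G> (a, (e, c) # s) (a, (e, c') # s')"
      using later.hyps by (rule gpath_reduce.later)
    note valid = reduce_gpaths[OF q p] reduce_gpaths[OF later.prems(1) p]
    from reduce_diamond_here[of e k a b d "tl_of e" v "(a, (e, c') # s')"] q p here2 e
    have "slide_eq r (a, (e, c') # s') \<or>
        (\<exists>x y. gpath_reduce \<G> r x \<and> gpath_reduce \<G> (a, (e, c') # s') y \<and> slide_eq x y)"
      by simp
    then show ?thesis
    proof
      assume "slide_eq r (a, (e, c') # s')"
      then show ?thesis using slide_eq_sym valid by blast
    next
      assume "\<exists>x y. gpath_reduce \<G> r x \<and> gpath_reduce \<G> (a, (e, c') # s') y \<and> slide_eq x y"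
      then obtain x y where "gpath_reduce \<G> r x" "gpath_reduce \<G> (a, (e, c') # s') y" "slide_eq x y"
        by blast
      then show ?thesis using slide_eq_sym reduce_gpaths valid by metis
    qed
  next
    case later2
    have v: "(c', s') \<in> gpaths \<G> (hd_of e) v" "(c2, s2) \<in> gpaths \<G> (hd_of e) v"
      using reduce_gpaths[OF later.hyps e(3)] reduce_gpaths[OF later2(2) e(3)] .
    have lift: "slide_eq (a, (e, x) # t) (a, (e, x') # t')"
      if "slide_eq (x, t) (x', t')" "(x', t') \<in> gpaths \<G> (hd_of e) v" for x t x' t'
    proof -
      have "x' \<in> carrier (VG (hd_of e))" using that(2) gpaths_head by blast
      then have "slide_eq (a, (e, x) # t) (a \<otimes>\<^bsub>VG (tl_of e)\<^esub> emb (rv e) \<one>\<^bsub>EG e\<^esub>, (e, x') # t')"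
        using that(1) e by (intro slide_eq.Cons) simp_all
      then show ?thesis using e by simp
    qed
    from later.IH[OF later2(2) e(3)] show ?thesis
    proof
      assume "slide_eq (c', s') (c2, s2)"
      then show ?thesis using lift v(2) later2(1) by blast
    next
      assume "\<exists>x y. gpath_reduce \<G> (c', s') x \<and> gpath_reduce \<G> (c2, s2) y \<and> slide_eq x y"
      then obtain x t x' t' where xt: "gpath_reduce \<G> (c', s') (x, t)" "gpath_reduce \<G> (c2, s2) (x', t')"
          "slide_eq (x, t) (x', t')" by (metis surj_pair)
      have "gpath_reduce \<G> (a, (e, c') # s') (a, (e, x) # t)" "gpath_reduce \<G> r (a, (e, x') # t')"
        unfolding later2(1) by (rule gpath_reduce.later[OF xt(1)] gpath_reduce.later[OF xt(2)])+
      then show ?thesis using lift[OF xt(3) reduce_gpaths[OF xt(2) v(2)]] by blast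
    qed
  qed
qed


definition irreducible :: "('e, 'a) gpath \<Rightarrow> bool" where
  "irreducible p \<longleftrightarrow> (\<nexists>q. gpath_reduce \<G> p q)"

lemma reduces_gpaths: "\<lbrakk>(gpath_reduce \<G>)\<^sup>*\<^sup>* p q; p \<in> gpaths \<G> u v\<rbrakk> \<Longrightarrow> q \<in> gpaths \<G> u v"
  by (induction rule: rtranclp_induct) (auto intro: reduce_gpaths)

lemma reduces_slide:
  assumes "(gpath_reduce \<G>)\<^sup>*\<^sup>* p q" "slide_eq p p'" "p \<in> gpaths \<G> u v" "p' \<in> gpaths \<G> u v"
  shows "\<exists>q'. (gpath_reduce \<G>)\<^sup>*\<^sup>* p' q' \<and> slide_eq q q'"
  using assms(1)
proof (induction rule: rtranclp_induct)
  case base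
  then show ?case using assms(2) by blast
next
  case (step q r)
  then obtain q' where q': "(gpath_reduce \<G>)\<^sup>*\<^sup>* p' q'" "slide_eq q q'" by blast
  obtain r' where "gpath_reduce \<G> q' r'" "slide_eq r r'"
    using reduce_slide[OF step.hyps(2) q'(2)] reduces_gpaths[OF step.hyps(1) assms(3)]
      reduces_gpaths[OF q'(1) assms(4)] by blast
  then show ?case using q'(1) by (meson rtranclp.rtrancl_into_rtrancl)
qed

text \<open>Local confluence implies confluence, by induction on the number of arcs as in Newman's lemma, but modulo
sliding.\<close>

lemma irreducible_reduces_strip:
  "\<lbrakk>gpath_reduce \<G> p q; (gpath_reduce \<G>)\<^sup>*\<^sup>* p r; irreducible r; p \<in> gpaths \<G> u v\<rbrakk>
    \<Longrightarrow> \<exists>r'. (gpath_reduce \<G>)\<^sup>*\<^sup>* q r' \<and> slide_eq r r'"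
proof (induction "length (snd p)" arbitrary: p q r rule: less_induct)
  case less
  note q = reduce_gpaths[OF less.prems(1,4)]
  from less.prems(2) obtain x where x: "gpath_reduce \<G> p x" "(gpath_reduce \<G>)\<^sup>*\<^sup>* x r"
  proof -
    have "p \<noteq> r" using less.prems(1,3) unfolding irreducible_def by blast
    then show thesis using less.prems(2) that by (metis converse_rtranclpE)
  qed
  note xv = reduce_gpaths[OF x(1) less.prems(4)]
  from reduce_diamond[OF x(1) less.prems(1,4)] show ?case
  proof
    assume "slide_eq x q"
    then show ?thesis using reduces_slide[OF x(2) _ xv q] by blast
  next
    assume "\<exists>y z. gpath_reduce \<G> x y \<and> gpath_reduce \<G> q z \<and> slide_eq y z"
    then obtain y z where yz: "gpath_reduce \<G> x y" "gpath_reduce \<G> q z" "slide_eq y z" by blast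
    note yv = reduce_gpaths[OF yz(1) xv] and zv = reduce_gpaths[OF yz(2) q]
    obtain r1 where r1: "(gpath_reduce \<G>)\<^sup>*\<^sup>* y r1" "slide_eq r r1"
      using less.hyps[OF reduce_length[OF x(1)] yz(1) x(2) less.prems(3) xv] by blast
    obtain r2 where r2: "(gpath_reduce \<G>)\<^sup>*\<^sup>* z r2" "slide_eq r1 r2"
      using reduces_slide[OF r1(1) yz(3) yv zv] by blast
    have "slide_eq r r2"
      using slide_eq_trans[OF r1(2) r2(2)] reduces_gpaths[OF less.prems(2,4)]
        reduces_gpaths[OF r1(1) yv] reduces_gpaths[OF r2(1) zv] by blast
    then show ?thesis using yz(2) r2(1) by (meson converse_rtranclp_into_rtranclp)
  qed
qed

text \<open>This is the normal form theorem for graphs of groups. It is proved by following the chain of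
reductions and expansions from \<open>p\<close> to \<open>q\<close>: having a reduction to \<open>p\<close> up to sliding is preserved by
expansions trivially and by reductions by confluence.\<close>

theorem homotopic_irreducible:
  assumes "(p, q) \<in> gpath_homotopy \<G> u v" "irreducible p"
  shows "\<exists>p'. (gpath_reduce \<G>)\<^sup>*\<^sup>* q p' \<and> slide_eq p p'"
proof -
  let ?R = "\<lambda>p' q'. p' \<in> gpaths \<G> u v \<and> q' \<in> gpaths \<G> u v \<and> gpath_reduce \<G> p' q'"
  have p: "p \<in> gpaths \<G> u v" and eq: "equivclp ?R p q"
    using assms(1) by (auto simp: gpath_homotopy_def)
  have irr: "irreducible p'" if "slide_eq p p'" "p' \<in> gpaths \<G> u v" for p'
    using that assms(2) p reduce_slide[OF _ slide_eq_sym] unfolding irreducible_def by blast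
  from eq show ?thesis
  proof (induction rule: equivclp_induct)
    case base
    then show ?case using slide_eq_refl p by (metis rtranclp.rtrancl_refl surj_pair)
  next
    case (step q r)
    then obtain p' where p': "(gpath_reduce \<G>)\<^sup>*\<^sup>* q p'" "slide_eq p p'" by blast
    from step.hyps(2) show ?case
    proof
      assume R: "?R q r"
      then have v: "p' \<in> gpaths \<G> u v" using reduces_gpaths p'(1) by blast
      obtain p'' where p'': "(gpath_reduce \<G>)\<^sup>*\<^sup>* r p''" "slide_eq p' p''"
        using irreducible_reduces_strip[OF _ p'(1) irr[OF p'(2) v]] R by blast
      then have "slide_eq p p''"
        using slide_eq_trans[OF p'(2) p''(2) p v] reduces_gpaths R by blast
      then show ?thesis using p''(1) by blast
    next
      assume "?R r q"
      then show ?thesis using p' by (meson converse_rtranclp_into_rtranclp)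
    qed
  qed
qed


section \<open>The fundamental groupoid\<close>

abbreviation "ap \<equiv> gpath_append \<G>"

lemma gpath_induct [case_names Nil Cons]:
  assumes "\<And>u a. P u (a, [])" "\<And>u a e c s. P (hd_of e) (c, s) \<Longrightarrow> P u (a, (e, c) # s)"
  shows "P u p"
proof -
  have "P u (a, s)" for a s
    by (induction s arbitrary: u a) (auto intro: assms)
  then show ?thesis by (cases p) simp
qed

lemma append_gpaths:
  "\<lbrakk>p \<in> gpaths \<G> u v; q \<in> gpaths \<G> v w\<rbrakk> \<Longrightarrow> ap u p q \<in> gpaths \<G> u w"
proof (induction u p rule: gpath_induct)
  case (Nil u a)
  then show ?case using gpaths_head[of "fst q" "snd q"]
    by (cases q) (auto intro: gpaths_change_head)
next
  case (Cons u a e c s)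
  then show ?case by (cases "ap (hd_of e) (c, s) q") simp
qed

lemma append_translate:
  assumes "(b, s) \<in> gpaths \<G> u v" "q \<in> gpaths \<G> v w" "x \<in> carrier (VG u)" "ap u (b, s) q = (c, t)"
  shows "ap u (x \<otimes>\<^bsub>VG u\<^esub> b, s) q = (x \<otimes>\<^bsub>VG u\<^esub> c, t)"
proof (cases s)
  case Nil
  obtain d r where "q = (d, r)" by fastforce
  then show ?thesis using assms Nil gpaths_head[of d r] by (auto simp: vertex_m_assoc)
next
  case (Cons eb s')
  then show ?thesis using assms by (cases eb) (auto split: prod.splits)
qed

lemma append_assoc:
  "\<lbrakk>p \<in> gpaths \<G> u v; q \<in> gpaths \<G> v w; r \<in> gpaths \<G> w z\<rbrakk>
    \<Longrightarrow> ap u (ap u p q) r = ap u p (ap v q r)"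
proof (induction u p rule: gpath_induct)
  case (Nil u a)
  obtain b t where bt: "q = (b, t)" by fastforce
  obtain c s where cs: "ap u (b, t) r = (c, s)" by fastforce
  then show ?case using append_translate[OF _ Nil(3) _ cs, of a] Nil bt by auto
next
  case (Cons u a e c s)
  obtain c' s' where "ap (hd_of e) (c, s) q = (c', s')" by fastforce
  then show ?case using Cons by simp
qed

lemma append_one_left: "q \<in> gpaths \<G> u v \<Longrightarrow> ap u (\<one>\<^bsub>VG u\<^esub>, []) q = q"
  using gpaths_head by (cases q) fastforce

lemma append_one_right: "p \<in> gpaths \<G> u v \<Longrightarrow> ap u p (\<one>\<^bsub>VG v\<^esub>, []) = p"
  by (induction u p rule: gpath_induct) auto

lemma reduce_append_left:
  assumes "gpath_reduce \<G> q q'" "q \<in> gpaths \<G> v w"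
  shows "p \<in> gpaths \<G> u v \<Longrightarrow> gpath_reduce \<G> (ap u p q) (ap u p q')"
proof (induction u p rule: gpath_induct)
  case (Nil u a)
  then show ?case using assms by (cases q; cases q') (auto intro: reduce_translate)
next
  case (Cons u a e c s)
  then have "gpath_reduce \<G> (ap (hd_of e) (c, s) q) (ap (hd_of e) (c, s) q')" by simp
  then show ?case
    by (cases "ap (hd_of e) (c, s) q"; cases "ap (hd_of e) (c, s) q'") (simp add: gpath_reduce.later)
qed

lemma reduce_append_right:
  "\<lbrakk>gpath_reduce \<G> p p'; p \<in> gpaths \<G> u v; q \<in> gpaths \<G> v w\<rbrakk>
    \<Longrightarrow> gpath_reduce \<G> (ap u p q) (ap u p' q)"
proof (induction arbitrary: u rule: gpath_reduce.induct)
  case (here e h a b s)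
  let ?x = "a \<otimes>\<^bsub>VG (tl_of e)\<^esub> emb (rv e) h"
  have u: "u = tl_of e" and b: "(b, s) \<in> gpaths \<G> (tl_of e) v" and x: "?x \<in> carrier (VG (tl_of e))"
    using here by auto
  obtain c t where ct: "ap (tl_of e) (b, s) q = (c, t)" by fastforce
  have "ap u (a, (e, emb e h) # (rv e, b) # s) q = (a, (e, emb e h) # (rv e, c) # t)"
    using ct here.hyps by simp
  moreover have "ap u (?x \<otimes>\<^bsub>VG (tl_of e)\<^esub> b, s) q = (?x \<otimes>\<^bsub>VG (tl_of e)\<^esub> c, t)"
    using append_translate[OF b here.prems(2) x ct] u by simp
  ultimately show ?case using gpath_reduce.here[OF here.hyps] by simp
next
  case (later c s c' s' a e)
  then have "gpath_reduce \<G> (ap (hd_of e) (c, s) q) (ap (hd_of e) (c', s') q)" by simp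
  then show ?case
    by (cases "ap (hd_of e) (c, s) q"; cases "ap (hd_of e) (c', s') q") (simp add: gpath_reduce.later)
qed

lemma homotopy_gpaths: "(p, q) \<in> gpath_homotopy \<G> u v \<Longrightarrow> p \<in> gpaths \<G> u v \<and> q \<in> gpaths \<G> u v"
  by (simp add: gpath_homotopy_def)

lemma homotopy_refl: "p \<in> gpaths \<G> u v \<Longrightarrow> (p, p) \<in> gpath_homotopy \<G> u v"
  using reflpD[OF reflp_equivclp] by (auto simp: gpath_homotopy_def)

lemma homotopy_sym: "(p, q) \<in> gpath_homotopy \<G> u v \<Longrightarrow> (q, p) \<in> gpath_homotopy \<G> u v"
  by (auto simp: gpath_homotopy_def intro: equivclp_sym)

lemma homotopy_trans:
  "\<lbrakk>(p, q) \<in> gpath_homotopy \<G> u v; (q, r) \<in> gpath_homotopy \<G> u v\<rbrakk> \<Longrightarrow> (p, r) \<in> gpath_homotopy \<G> u v"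
  using transpD[OF transp_equivclp] unfolding gpath_homotopy_def by fast

lemma equiv_homotopy: "equiv (gpaths \<G> u v) (gpath_homotopy \<G> u v)"
  by (rule equivI)
    (auto simp: refl_on_def intro: symI transI homotopy_refl homotopy_sym homotopy_trans dest: homotopy_gpaths)

lemma reduce_homotopy:
  "\<lbrakk>gpath_reduce \<G> p q; p \<in> gpaths \<G> u v\<rbrakk> \<Longrightarrow> (p, q) \<in> gpath_homotopy \<G> u v"
  using reduce_gpaths[of p q u v] unfolding gpath_homotopy_def equivclp_def by (auto intro!: r_into_rtranclp symclpI1)

lemma homotopy_map:
  assumes "(p, q) \<in> gpath_homotopy \<G> u v"
    and map: "\<And>p. p \<in> gpaths \<G> u v \<Longrightarrow> f p \<in> gpaths \<G> u' v'"
    and red: "\<And>p q. \<lbrakk>p \<in> gpaths \<G> u v; gpath_reduce \<G> p q\<rbrakk> \<Longrightarrow> gpath_reduce \<G> (f p) (f q)"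
  shows "(f p, f q) \<in> gpath_homotopy \<G> u' v'"
proof -
  let ?R = "\<lambda>p' q'. p' \<in> gpaths \<G> u v \<and> q' \<in> gpaths \<G> u v \<and> gpath_reduce \<G> p' q'"
  have p: "p \<in> gpaths \<G> u v" and "equivclp ?R p q"
    using assms(1) by (auto simp: gpath_homotopy_def)
  from this(2) show ?thesis
  proof (induction rule: equivclp_induct)
    case base
    show ?case using homotopy_refl map p by blast
  next
    case (step q r)
    have *: "(f x, f y) \<in> gpath_homotopy \<G> u' v'" if "?R x y" for x y
      using that by (intro reduce_homotopy[of "f x" "f y"] red map) simp_all
    from step.hyps(2) have "(f q, f r) \<in> gpath_homotopy \<G> u' v'"
    proof
      assume "?R q r" then show ?thesis by (rule *)
    next
      assume "?R r q" then show ?thesis by (rule homotopy_sym[OF *])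
    qed
    with step.IH show ?case by (rule homotopy_trans)
  qed
qed

lemma homotopy_append:
  assumes "(p, p') \<in> gpath_homotopy \<G> u v" "(q, q') \<in> gpath_homotopy \<G> v w"
  shows "(ap u p q, ap u p' q') \<in> gpath_homotopy \<G> u w"
proof -
  note v = homotopy_gpaths[OF assms(1)] homotopy_gpaths[OF assms(2)]
  have "(ap u p q, ap u p' q) \<in> gpath_homotopy \<G> u w"
    using assms(1) by (rule homotopy_map) (use v in \<open>blast intro: append_gpaths reduce_append_right\<close>)+
  moreover have "(ap u p' q, ap u p' q') \<in> gpath_homotopy \<G> u w"
    using assms(2) by (rule homotopy_map) (use v in \<open>blast intro: append_gpaths reduce_append_left\<close>)+
  ultimately show ?thesis by (rule homotopy_trans)
qed

lemma fundamental_group_mult: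
  assumes "p \<in> gpaths \<G> v v" "q \<in> gpaths \<G> v v"
  shows "gpath_homotopy \<G> v v `` {p} \<otimes>\<^bsub>fundamental_group \<G> v\<^esub> gpath_homotopy \<G> v v `` {q}
    = gpath_homotopy \<G> v v `` {ap v p q}"
proof -
  have "(\<lambda>p q. gpath_homotopy \<G> v v `` {ap v p q}) respects2 gpath_homotopy \<G> v v"
    by (intro congruent2I' equiv_class_eq[OF equiv_homotopy] homotopy_append)
  then show ?thesis
    using UN_equiv_class2[OF equiv_homotopy equiv_homotopy _ assms] by (simp add: fundamental_group_def)
qed

section \<open>Paths with trivial labels\<close>

definition trivial_gpath :: "'v \<Rightarrow> 'e list \<Rightarrow> ('e, 'a) gpath" where
  "trivial_gpath u \<pi> = (\<one>\<^bsub>VG u\<^esub>, map (\<lambda>e. (e, \<one>\<^bsub>VG (hd_of e)\<^esub>)) \<pi>)"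

lemma trivial_gpaths: "base.awalk u \<pi> v \<Longrightarrow> trivial_gpath u \<pi> \<in> gpaths \<G> u v"
proof (induction \<pi> arbitrary: u)
  case (Cons e \<pi>)
  then show ?case by (auto simp: trivial_gpath_def base.awalk_Cons_iff)
qed (auto simp: trivial_gpath_def base.awalk_Nil_iff)

lemma append_trivial:
  "\<lbrakk>base.awalk u \<pi> v; base.awalk v \<rho> w\<rbrakk>
    \<Longrightarrow> ap u (trivial_gpath u \<pi>) (trivial_gpath v \<rho>) = trivial_gpath u (\<pi> @ \<rho>)"
proof (induction \<pi> arbitrary: u)
  case (Cons e \<pi>)
  then show ?case by (auto simp: trivial_gpath_def base.awalk_Cons_iff)
qed (auto simp: trivial_gpath_def base.awalk_Nil_iff)

definition rev_arcs :: "'e list \<Rightarrow> 'e list" where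
  "rev_arcs \<pi> = rev (map rv \<pi>)"

lemma rev_arcs_rev_arcs [simp]: "rev_arcs (rev_arcs \<pi>) = \<pi>"
  by (simp add: rev_arcs_def rev_map comp_def)

lemma awalk_rev_arcs: "base.awalk u \<pi> v \<Longrightarrow> base.awalk v (rev_arcs \<pi>) u"
proof (induction \<pi> arbitrary: u)
  case (Cons e \<pi>)
  then have "base.awalk v (rev_arcs \<pi>) (hd_of e)" "base.awalk (hd_of e) [rv e] u"
    by (auto simp: base.awalk_simps)
  then show ?case unfolding rev_arcs_def by (simp add: base.awalk_appendI del: base.awalk_append_iff)
qed (auto simp: rev_arcs_def base.awalk_Nil_iff)

lemma trivial_rev_homotopy:
  "base.awalk u \<pi> v \<Longrightarrow> (trivial_gpath u (\<pi> @ rev_arcs \<pi>), trivial_gpath u []) \<in> gpath_homotopy \<G> u u"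
proof (induction \<pi> arbitrary: u)
  case Nil
  then show ?case by (auto simp: trivial_gpath_def rev_arcs_def base.awalk_Nil_iff intro: homotopy_refl)
next
  case (Cons e \<pi>)
  then have e: "e \<in> E" "u = tl_of e" and \<pi>: "base.awalk (hd_of e) \<pi> v"
    by (auto simp: base.awalk_Cons_iff)
  let ?a = "trivial_gpath u [e]" and ?b = "trivial_gpath (hd_of e) (\<pi> @ rev_arcs \<pi>)"
    and ?c = "trivial_gpath (hd_of e) [rv e]" and ?o = "trivial_gpath (hd_of e) []"
  have walks: "base.awalk u [e] (hd_of e)" "base.awalk (hd_of e) [rv e] u"
      "base.awalk (hd_of e) [] (hd_of e)" "base.awalk (hd_of e) (\<pi> @ rev_arcs \<pi>) (hd_of e)"
    using e base.awalk_appendI[OF \<pi> awalk_rev_arcs[OF \<pi>]]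
    by (auto simp: base.awalk_simps simp del: base.awalk_append_iff)
  have "(ap u (ap u ?a ?b) ?c, ap u (ap u ?a ?o) ?c) \<in> gpath_homotopy \<G> u u"
    by (intro homotopy_append[where v = "hd_of e"] Cons.IH \<pi> homotopy_refl trivial_gpaths walks)
  moreover have "ap u (ap u ?a ?b) ?c = trivial_gpath u ((e # \<pi>) @ rev_arcs (e # \<pi>))"
    using append_trivial[OF walks(1,4)] append_trivial[OF base.awalk_appendI[OF walks(1,4)] walks(2)]
    by (simp add: rev_arcs_def)
  moreover have "ap u (ap u ?a ?o) ?c = trivial_gpath u [e, rv e]"
    using append_trivial[OF walks(1,3)] append_trivial[OF walks(1,2)] by simp
  moreover have "gpath_reduce \<G> (trivial_gpath u [e, rv e]) (trivial_gpath u [])"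
    using gpath_reduce.here[OF e(1) edge_one_closed[OF e(1)], of "\<one>\<^bsub>VG u\<^esub>" "\<one>\<^bsub>VG u\<^esub>" "[]"] e
    by (simp add: trivial_gpath_def)
  then have "(trivial_gpath u [e, rv e], trivial_gpath u []) \<in> gpath_homotopy \<G> u u"
    using base.awalk_appendI[OF walks(1,2)] by (intro reduce_homotopy trivial_gpaths) simp_all
  ultimately show ?case using homotopy_trans by metis
qed

section \<open>A spanning tree\<close>

lemma connected_awalk:
  assumes "u \<in> V" "v \<in> V"
  obtains \<pi> where "base.awalk u \<pi> v"
proof -
  have "u \<rightarrow>\<^sup>*\<^bsub>base \<G>\<^esub> v"
    using base.symmetric_connected_imp_strongly_connected[OF base.sym_arcs conn] assms
    by (auto simp: strongly_connected_def)
  then show thesis using that by (auto simp: base.reachable_awalk)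
qed

text \<open>The paths \<open>\<pi> v\<close> are the branches of a breadth first spanning tree, in which the parent arc of \<open>v\<close>
starts at a vertex that is closer to \<open>v0\<close>.\<close>

lemma spanning_tree_paths:
  assumes v0: "v0 \<in> V"
  obtains \<pi> where "\<pi> v0 = []" "\<And>v. v \<in> V \<Longrightarrow> base.awalk v0 (\<pi> v) v"
    "\<And>v. \<lbrakk>v \<in> V; v \<noteq> v0\<rbrakk> \<Longrightarrow> \<exists>e \<in> E. hd_of e = v \<and> \<pi> v = \<pi> (tl_of e) @ [e]"
proof -
  define d where "d v = (LEAST n. \<exists>p. base.awalk v0 p v \<and> length p = n)" for v
  have d_le: "d v \<le> length p" if "base.awalk v0 p v" for p v
    unfolding d_def using that by (auto intro: Least_le)
  have d_ex: "\<exists>p. base.awalk v0 p v \<and> length p = d v" if "v \<in> V" for v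
    unfolding d_def by (rule LeastI_ex) (use connected_awalk[OF v0 that] in blast)
  have d0: "d v0 = 0" using d_le[of "[]" v0] v0 by (simp add: base.awalk_Nil_iff)
  have "\<exists>e. e \<in> E \<and> hd_of e = v \<and> d v = Suc (d (tl_of e))" if v: "v \<in> V" "v \<noteq> v0" for v
  proof -
    obtain p where p: "base.awalk v0 p v" "length p = d v" using d_ex v(1) by blast
    then have "p \<noteq> []" using v(2) by (auto simp: base.awalk_Nil_iff)
    then obtain p' e where pe: "p = p' @ [e]" by (cases p rule: rev_cases) auto
    then have e: "e \<in> E" "hd_of e = v" "base.awalk v0 p' (tl_of e)"
      using p(1) by (auto simp: base.awalk_simps)
    obtain r where r: "base.awalk v0 r (tl_of e)" "length r = d (tl_of e)"
      using d_ex[of "tl_of e"] e(1) by auto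
    have "base.awalk v0 (r @ [e]) v"
      using e by (intro base.awalk_appendI[OF r(1)]) (auto simp: base.awalk_simps)
    from d_le[OF this] have "d v \<le> Suc (d (tl_of e))" using r(2) by simp
    moreover have "Suc (d (tl_of e)) \<le> d v" using d_le[OF e(3)] p(2) pe by simp
    ultimately show ?thesis using e by auto
  qed
  then obtain par where par: "par v \<in> E" "hd_of (par v) = v" "d v = Suc (d (tl_of (par v)))"
    if "v \<in> V" "v \<noteq> v0" for v
    by metis
  \<comment> \<open>Recursion on the distance from \<open>v0\<close>, which is the number of steps back to \<open>v0\<close> along parent arcs.\<close>
  define walk where "walk = rec_nat (\<lambda>_. []) (\<lambda>_ f v. f (tl_of (par v)) @ [par v])"
  have walk: "walk 0 v = []" "walk (Suc n) v = walk n (tl_of (par v)) @ [par v]" for n v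
    by (simp_all add: walk_def)
  show thesis
  proof
    show "walk (d v0) v0 = []" by (simp add: d0 walk)
    show step: "\<exists>e\<in>E. hd_of e = v \<and> walk (d v) v = walk (d (tl_of e)) (tl_of e) @ [e]"
      if "v \<in> V" "v \<noteq> v0" for v
      using par[OF that] by (intro bexI[of _ "par v"]) (simp_all add: walk)
    show "base.awalk v0 (walk (d v) v) v" if "v \<in> V" for v
      using that
    proof (induction "d v" arbitrary: v rule: less_induct)
      case less
      show ?case
      proof (cases "v = v0")
        case True
        then show ?thesis using v0 by (simp add: d0 walk base.awalk_Nil_iff)
      next
        case False
        note p = par[OF less.prems False]
        have "base.awalk v0 (walk (d (tl_of (par v))) (tl_of (par v))) (tl_of (par v))"
          using less.hyps[of "tl_of (par v)"] p by simp
        moreover have "base.awalk (tl_of (par v)) [par v] v"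
          using p less.prems by (auto simp: base.awalk_simps)
        ultimately show ?thesis using base.awalk_appendI p(3) walk(2) by metis
      qed
    qed
  qed
qed


section \<open>Generators of the fundamental group\<close>

fun gpath_value ::
    "('g, 'm) monoid_scheme \<Rightarrow> ('v \<Rightarrow> 'a \<Rightarrow> 'g) \<Rightarrow> ('e \<Rightarrow> 'g) \<Rightarrow> 'v \<Rightarrow> ('e, 'a) gpath \<Rightarrow> 'g" where
  "gpath_value G \<iota> t u (a, []) = \<iota> u a"
| "gpath_value G \<iota> t u (a, (e, b) # s) = \<iota> u a \<otimes>\<^bsub>G\<^esub> (t e \<otimes>\<^bsub>G\<^esub> gpath_value G \<iota> t (hd_of e) (b, s))"

end

text \<open>What the proof uses of the isomorphism between \<open>G\<close> and the fundamental group: the path groupoid is mapped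
to \<open>G\<close> by \<open>\<iota>\<close> and \<open>t\<close>, bijectively on homotopy classes of loops at \<open>v0\<close>, and any two vertices are
connected by arcs with trivial image.\<close>

locale pi1_presentation = graph_of_groups \<G> + G: group G
  for \<G> :: "('v, 'e, 'a, 'b) gog" and G :: "'g monoid" (structure) +
  fixes v0 :: 'v and \<iota> :: "'v \<Rightarrow> 'a \<Rightarrow> 'g" and t :: "'e \<Rightarrow> 'g"
  assumes v0: "v0 \<in> V"
    and \<iota>_hom: "v \<in> V \<Longrightarrow> \<iota> v \<in> hom (VG v) G"
    and t_closed [simp]: "e \<in> E \<Longrightarrow> t e \<in> carrier G"
    and edge_relation: "\<lbrakk>e \<in> E; h \<in> carrier (EG e)\<rbrakk> \<Longrightarrow>
      t e \<otimes> (\<iota> (hd_of e) (emb e h) \<otimes> t (rv e)) = \<iota> (tl_of e) (emb (rv e) h)"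
    and value_faithful: "\<lbrakk>p \<in> gpaths \<G> v0 v0; q \<in> gpaths \<G> v0 v0;
      gpath_value G \<iota> t v0 p = gpath_value G \<iota> t v0 q\<rbrakk> \<Longrightarrow> (p, q) \<in> gpath_homotopy \<G> v0 v0"
    and value_surj: "g \<in> carrier G \<Longrightarrow> \<exists>p \<in> gpaths \<G> v0 v0. gpath_value G \<iota> t v0 p = g"
    and tree: "\<lbrakk>u \<in> V; v \<in> V\<rbrakk> \<Longrightarrow> (u, v) \<in> {(tl_of e, hd_of e) |e. e \<in> E \<and> t e = \<one>}\<^sup>*"

text \<open>Closing up a path from \<open>u\<close> to \<open>v\<close> by the tree paths from \<open>v0\<close> to \<open>u\<close> and from \<open>v\<close> back to \<open>v0\<close> maps
paths to loops at \<open>v0\<close>, compatibly with composition. The parent arc \<open>e\<close> of a vertex is mapped to the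
identity because the branch of the tree to its head is the branch to its tail followed by \<open>e\<close>.\<close>

theorem (in graph_of_groups) fundamental_group_presentation:
  fixes G :: "'g monoid"
  assumes v0: "v0 \<in> V" and "group G" and iso: "G \<cong> fundamental_group \<G> v0"
  shows "\<exists>\<iota> t. pi1_presentation \<G> G v0 \<iota> t"
proof -
  interpret G: group G by (rule assms)
  let ?F = "fundamental_group \<G> v0" and ?H = "gpath_homotopy \<G> v0 v0"
  obtain f where f: "f \<in> hom G ?F" "bij_betw f (carrier G) (carrier ?F)"
    using iso by (auto simp: is_iso_def iso_def)
  have car: "carrier ?F = gpaths \<G> v0 v0 // ?H" by (simp add: fundamental_group_def)
  have cls: "?H `` {p} \<in> carrier ?F" if "p \<in> gpaths \<G> v0 v0" for p
    using that by (simp add: car quotientI)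
  define F where "F p = inv_into (carrier G) f (?H `` {p})" for p
  have F: "F p \<in> carrier G" "f (F p) = ?H `` {p}" if "p \<in> gpaths \<G> v0 v0" for p
  proof -
    have "?H `` {p} \<in> f ` carrier G" using cls[OF that] f(2) by (simp add: bij_betw_def)
    then show "F p \<in> carrier G" "f (F p) = ?H `` {p}"
      unfolding F_def by (rule inv_into_into, rule f_inv_into_f)
  qed
  have inj: "inj_on f (carrier G)" using f(2) by (simp add: bij_betw_def)
  have F_eq: "F p = F q \<longleftrightarrow> (p, q) \<in> ?H" if "p \<in> gpaths \<G> v0 v0" "q \<in> gpaths \<G> v0 v0" for p q
    using that eq_equiv_class_iff[OF equiv_homotopy] F by (metis F_def)
  have F_mult: "F (ap v0 p q) = F p \<otimes>\<^bsub>G\<^esub> F q" if "p \<in> gpaths \<G> v0 v0" "q \<in> gpaths \<G> v0 v0" for p q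
  proof -
    have "f (F p \<otimes>\<^bsub>G\<^esub> F q) = f (F (ap v0 p q))"
      using that F append_gpaths f(1) by (simp add: hom_mult fundamental_group_mult)
    from inj_onD[OF inj this] show ?thesis
      using F(1) that append_gpaths[OF that] by simp
  qed
  have F_surj: "\<exists>p \<in> gpaths \<G> v0 v0. F p = g" if g: "g \<in> carrier G" for g
  proof -
    have "f g \<in> gpaths \<G> v0 v0 // ?H" using f(2) g by (auto simp: bij_betw_def simp flip: car)
    then obtain p where p: "p \<in> gpaths \<G> v0 v0" "f g = ?H `` {p}" by (rule quotientE)
    then have "f (F p) = f g" using F(2) by simp
    from inj_onD[OF inj this] show ?thesis using p(1) F(1) g by blast
  qed
  obtain \<pi> where \<pi>: "\<pi> v0 = []" "\<And>v. v \<in> V \<Longrightarrow> base.awalk v0 (\<pi> v) v"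
    "\<And>v. \<lbrakk>v \<in> V; v \<noteq> v0\<rbrakk> \<Longrightarrow> \<exists>e \<in> E. hd_of e = v \<and> \<pi> v = \<pi> (tl_of e) @ [e]"
    by (rule spanning_tree_paths[OF v0]) blast
  define P where "P v = trivial_gpath v0 (\<pi> v)" for v
  define Q where "Q v = trivial_gpath v (rev_arcs (\<pi> v))" for v
  define O' where "O' v = (\<one>\<^bsub>VG v\<^esub>, [] :: ('e \<times> 'a) list)" for v
  have O: "O' v \<in> gpaths \<G> v v" "O' v = trivial_gpath v []" if "v \<in> V" for v
    using that by (simp_all add: O'_def trivial_gpath_def)
  have P: "P v \<in> gpaths \<G> v0 v" and Q: "Q v \<in> gpaths \<G> v v0" if "v \<in> V" for v
    using \<pi>(2)[OF that] awalk_rev_arcs unfolding P_def Q_def by (auto intro: trivial_gpaths)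
  have PQ: "(ap v0 (P v) (Q v), O' v0) \<in> ?H" if "v \<in> V" for v
    using trivial_rev_homotopy[OF \<pi>(2)[OF that]] append_trivial[OF \<pi>(2)[OF that] awalk_rev_arcs[OF \<pi>(2)[OF that]]]
    by (simp add: P_def Q_def O v0)
  have QP: "(ap v (Q v) (P v), O' v) \<in> gpath_homotopy \<G> v v" if "v \<in> V" for v
    using trivial_rev_homotopy[OF awalk_rev_arcs[OF \<pi>(2)[OF that]]]
      append_trivial[OF awalk_rev_arcs[OF \<pi>(2)[OF that]] \<pi>(2)[OF that]]
    by (simp add: P_def Q_def O that)
  have PQ0: "P v0 = O' v0" "Q v0 = O' v0" using \<pi>(1) v0 by (simp_all add: P_def Q_def O rev_arcs_def)
  \<comment> \<open>The image of a path from \<open>u\<close> to \<open>v\<close>, closed up by tree paths.\<close>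
  define W where "W u v p = F (ap v0 (P u) (ap u p (Q v)))" for u v p
  have ends: "u \<in> V" "v \<in> V" if "p \<in> gpaths \<G> u v" for p u v
  proof -
    obtain a s where "p = (a, s)" by fastforce
    then have "base.awalk u (map fst s) v" using that by (auto simp: gpaths_def)
    then show "u \<in> V" "v \<in> V" by (auto intro: base.awalk_hd_in_verts base.awalk_last_in_verts)
  qed
  have conj: "ap v0 (P u) (ap u p (Q v)) \<in> gpaths \<G> v0 v0" if "p \<in> gpaths \<G> u v" for p u v
    using that ends[OF that] P Q append_gpaths by blast
  have W_closed: "W u v p \<in> carrier G" if "p \<in> gpaths \<G> u v" for p u v
    unfolding W_def by (rule F(1)[OF conj[OF that]])
  have W_cong: "W u v p = W u v q" if "(p, q) \<in> gpath_homotopy \<G> u v" for p q u v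
  proof -
    have pq: "p \<in> gpaths \<G> u v" "q \<in> gpaths \<G> u v" using homotopy_gpaths[OF that] by auto
    have "(ap v0 (P u) (ap u p (Q v)), ap v0 (P u) (ap u q (Q v))) \<in> ?H"
      using ends[OF pq(1)] by (intro homotopy_append[OF homotopy_refl homotopy_append[OF that homotopy_refl]] P Q)
    then show ?thesis unfolding W_def using F_eq[OF conj conj, OF pq] by blast
  qed
  have W_append: "W u w (ap u p q) = W u v p \<otimes>\<^bsub>G\<^esub> W v w q"
    if p: "p \<in> gpaths \<G> u v" and q: "q \<in> gpaths \<G> v w" for u v w p q
  proof -
    note V = ends[OF p] ends[OF q]
    note mem = p q P[OF V(1)] Q[OF V(2)] P[OF V(2)] Q[OF V(4)]
    note 1 = append_gpaths[OF q mem(6)] and 3 = conj[OF q] and 4 = append_gpaths[OF p mem(4)]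
    have "ap v0 (ap v0 (P u) (ap u p (Q v))) (ap v0 (P v) (ap v q (Q w)))
        = ap v0 (P u) (ap u p (ap v (Q v) (ap v0 (P v) (ap v q (Q w)))))"
      using append_assoc[OF mem(3) 4 3] append_assoc[OF mem(1,4) 3] by simp
    also have "\<dots> = ap v0 (P u) (ap u p (ap v (ap v (Q v) (P v)) (ap v q (Q w))))"
      using append_assoc[OF mem(4,5) 1] by simp
    finally have "(ap v0 (ap v0 (P u) (ap u p (Q v))) (ap v0 (P v) (ap v q (Q w))),
        ap v0 (P u) (ap u p (ap v (O' v) (ap v q (Q w))))) \<in> ?H"
      using homotopy_append[OF homotopy_refl[OF mem(3)] homotopy_append[OF homotopy_refl[OF p]
            homotopy_append[OF QP[OF V(2)] homotopy_refl[OF 1]]]]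
      by simp
    moreover have "ap v (O' v) (ap v q (Q w)) = ap v q (Q w)"
      using append_one_left[OF 1] by (simp add: O'_def)
    moreover have "ap u p (ap v q (Q w)) = ap u (ap u p q) (Q w)"
      using append_assoc[OF p q mem(6)] by simp
    ultimately have "F (ap v0 (ap v0 (P u) (ap u p (Q v))) (ap v0 (P v) (ap v q (Q w)))) = W u w (ap u p q)"
      unfolding W_def using F_eq conj[OF append_gpaths[OF p q]] append_gpaths[OF conj[OF p] conj[OF q]]
      by simp
    then show ?thesis using F_mult[OF conj[OF p] conj[OF q]] by (simp add: W_def)
  qed
  have F_one: "F (O' v0) = \<one>\<^bsub>G\<^esub>"
  proof -
    have "F (O' v0) \<otimes>\<^bsub>G\<^esub> F (O' v0) = F (O' v0)"
      using F_mult[OF O(1)[OF v0] O(1)[OF v0]] append_one_left[OF O(1)[OF v0]] by (simp add: O'_def)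
    then show ?thesis using F(1)[OF O(1)[OF v0]] by (metis G.r_cancel_one)
  qed
  have W_one: "W v v (O' v) = \<one>\<^bsub>G\<^esub>" if v: "v \<in> V" for v
  proof -
    have "ap v (O' v) (Q v) = Q v" using append_one_left[OF Q[OF v]] by (simp add: O'_def)
    then have "W v v (O' v) = F (ap v0 (P v) (Q v))" by (simp add: W_def)
    also have "\<dots> = F (O' v0)"
      using F_eq[OF append_gpaths[OF P Q, OF v v] O(1)[OF v0]] PQ[OF v] by simp
    finally show ?thesis using F_one by simp
  qed
  have W_v0: "W v0 v0 p = F p" if "p \<in> gpaths \<G> v0 v0" for p
    using append_one_right[OF that] append_one_left[OF that] by (simp add: W_def PQ0 O'_def)
  define \<iota> where "\<iota> v a = W v v (a, [])" for v a
  define t where "t e = W (tl_of e) (hd_of e) (trivial_gpath (tl_of e) [e])" for e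
  have arc: "trivial_gpath (tl_of e) [e] \<in> gpaths \<G> (tl_of e) (hd_of e)" if "e \<in> E" for e
    using that by (intro trivial_gpaths) (auto simp: base.awalk_simps)
  have val: "p \<in> gpaths \<G> u v \<Longrightarrow> gpath_value G \<iota> t u p = W u v p" for u v p
  proof (induction u p rule: gpath_induct)
    case (Nil u a)
    then show ?case by (simp add: \<iota>_def)
  next
    case (Cons u a e b s)
    then have e: "e \<in> E" "u = tl_of e" "a \<in> carrier (VG (tl_of e))"
      and bs: "(b, s) \<in> gpaths \<G> (hd_of e) v" by auto
    have b: "b \<in> carrier (VG (hd_of e))" using gpaths_head[OF bs] by simp
    let ?x = "trivial_gpath (tl_of e) [e]"
    have *: "ap (tl_of e) (a, []) (ap (tl_of e) ?x (b, s)) = (a, (e, b) # s)"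
      using e b by (simp add: trivial_gpath_def)
    have a: "(a, []) \<in> gpaths \<G> (tl_of e) (tl_of e)" using e by simp
    have x: "ap (tl_of e) ?x (b, s) \<in> gpaths \<G> (tl_of e) v" by (rule append_gpaths[OF arc[OF e(1)] bs])
    have "W (tl_of e) v (a, (e, b) # s) = \<iota> (tl_of e) a \<otimes>\<^bsub>G\<^esub> (t e \<otimes>\<^bsub>G\<^esub> W (hd_of e) v (b, s))"
      using W_append[OF a x] W_append[OF arc[OF e(1)] bs] unfolding * by (simp add: \<iota>_def t_def)
    then show ?case using Cons.IH[OF bs] e(2) by simp
  qed
  have hom: "\<iota> v \<in> hom (VG v) G" if v: "v \<in> V" for v
  proof (rule homI)
    fix a b assume ab: "a \<in> carrier (VG v)" "b \<in> carrier (VG v)"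
    show "\<iota> v a \<in> carrier G" unfolding \<iota>_def using ab v by (intro W_closed) simp
    show "\<iota> v (a \<otimes>\<^bsub>VG v\<^esub> b) = \<iota> v a \<otimes>\<^bsub>G\<^esub> \<iota> v b"
      using W_append[of "(a, [])" v v "(b, [])" v] ab v by (simp add: \<iota>_def)
  qed
  have \<iota>_one: "\<iota> v \<one>\<^bsub>VG v\<^esub> = \<one>\<^bsub>G\<^esub>" if "v \<in> V" for v
    using W_one[OF that] by (simp add: \<iota>_def O'_def)
  have t_closed: "t e \<in> carrier G" if "e \<in> E" for e
    unfolding t_def using arc[OF that] by (rule W_closed)
  have rel: "t e \<otimes>\<^bsub>G\<^esub> (\<iota> (hd_of e) (emb e h) \<otimes>\<^bsub>G\<^esub> t (rv e)) = \<iota> (tl_of e) (emb (rv e) h)"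
    if e: "e \<in> E" and h: "h \<in> carrier (EG e)" for e h
  proof -
    let ?p = "(\<one>\<^bsub>VG (tl_of e)\<^esub>, [(e, emb e h), (rv e, \<one>\<^bsub>VG (tl_of e)\<^esub>)])"
    have p: "?p \<in> gpaths \<G> (tl_of e) (tl_of e)" using e h by simp
    have "gpath_reduce \<G> ?p (emb (rv e) h, [])"
      using gpath_reduce.here[OF e h, of "\<one>\<^bsub>VG (tl_of e)\<^esub>" "\<one>\<^bsub>VG (tl_of e)\<^esub>" "[]"] e h by simp
    from W_cong[OF reduce_homotopy[OF this p]]
    have "gpath_value G \<iota> t (tl_of e) ?p = \<iota> (tl_of e) (emb (rv e) h)"
      using val[OF p] by (simp add: \<iota>_def)
    moreover have "\<iota> (hd_of e) (emb e h) \<in> carrier G"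
      using hom_in_carrier[OF hom, of "hd_of e"] e h by simp
    ultimately show ?thesis using e t_closed by (simp add: \<iota>_one)
  qed
  have t_tree: "t e = \<one>\<^bsub>G\<^esub>" if e: "e \<in> E" "\<pi> (hd_of e) = \<pi> (tl_of e) @ [e]" for e
  proof -
    have V: "tl_of e \<in> V" "hd_of e \<in> V" using e(1) by auto
    have "base.awalk (tl_of e) [e] (hd_of e)" using e(1) by (auto simp: base.awalk_simps)
    from append_trivial[OF \<pi>(2)[OF V(1)] this]
    have "ap v0 (P (tl_of e)) (trivial_gpath (tl_of e) [e]) = P (hd_of e)"
      unfolding P_def by (simp add: e(2))
    then have "t e = F (ap v0 (P (hd_of e)) (Q (hd_of e)))"
      unfolding t_def W_def using append_assoc[OF P[OF V(1)] arc[OF e(1)] Q[OF V(2)]] by simp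
    also have "\<dots> = F (O' v0)"
      using F_eq[OF append_gpaths[OF P Q, OF V(2) V(2)] O(1)[OF v0]] PQ[OF V(2)] by simp
    finally show ?thesis using F_one by simp
  qed
  have t_rev: "t (rv e) = \<one>\<^bsub>G\<^esub>" if e: "e \<in> E" "t e = \<one>\<^bsub>G\<^esub>" for e
    using rel[OF e(1) edge_one_closed[OF e(1)]] e t_closed[of "rv e"] by (simp add: \<iota>_one)
  let ?T = "{(tl_of e, hd_of e) |e. e \<in> E \<and> t e = \<one>\<^bsub>G\<^esub>}"
  have T: "(v0, v) \<in> ?T\<^sup>* \<and> (v, v0) \<in> ?T\<^sup>*" if "v \<in> V" for v
    using that
  proof (induction "length (\<pi> v)" arbitrary: v rule: less_induct)
    case less
    show ?case
    proof (cases "v = v0")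
      case False
      then obtain e where e: "e \<in> E" "hd_of e = v" "\<pi> v = \<pi> (tl_of e) @ [e]"
        using \<pi>(3) less.prems by blast
      then have te: "t e = \<one>\<^bsub>G\<^esub>" using t_tree by simp
      have "(tl_of e, v) \<in> ?T" using e te by blast
      moreover have "(v, tl_of e) \<in> ?T"
        using e(1,2) t_rev[OF e(1) te] by (auto intro!: exI[of _ "rv e"])
      moreover have "(v0, tl_of e) \<in> ?T\<^sup>* \<and> (tl_of e, v0) \<in> ?T\<^sup>*"
        using less.hyps[of "tl_of e"] e by simp
      ultimately show ?thesis by (meson rtrancl.rtrancl_into_rtrancl converse_rtrancl_into_rtrancl)
    qed simp
  qed
  have "pi1_presentation \<G> G v0 \<iota> t"
  proof unfold_locales
    show "(p, q) \<in> ?H" if "p \<in> gpaths \<G> v0 v0" "q \<in> gpaths \<G> v0 v0"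
      "gpath_value G \<iota> t v0 p = gpath_value G \<iota> t v0 q" for p q
      using that F_eq by (simp add: val W_v0)
    show "\<exists>p \<in> gpaths \<G> v0 v0. gpath_value G \<iota> t v0 p = g" if "g \<in> carrier G" for g
      using F_surj[OF that] by (auto simp: val W_v0)
    show "(u, v) \<in> ?T\<^sup>*" if "u \<in> V" "v \<in> V" for u v
      using T[OF that(1)] T[OF that(2)] by (meson rtrancl_trans)
  qed (fact v0 hom t_closed rel)+
  then show ?thesis by blast
qed

section \<open>Reading words along paths\<close>

text \<open>The sets \<open>Y v\<close> contain the edge group elements, so that an edge group element is a single letter at both
ends of its arc.\<close>

locale generated_pi1 = pi1_presentation \<G> G v0 \<iota> t
  for \<G> :: "('v, 'e, 'a, 'b) gog" and G :: "'g monoid" (structure) and v0 \<iota> t +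
  fixes Y :: "'v \<Rightarrow> 'a set" and K :: nat
  assumes marked_vertex: "v \<in> V \<Longrightarrow> marked_group (VG v) (Y v)"
    and edge_letters: "\<lbrakk>e \<in> E; h \<in> carrier (EG e)\<rbrakk> \<Longrightarrow> emb e h \<in> Y (hd_of e)"
    and vertex_fftp: "v \<in> V \<Longrightarrow> word_fftp (VG v) (Y v) K"
begin

definition "X = (\<Union>v \<in> V. \<iota> v ` Y v) \<union> t ` {e \<in> E. t e \<noteq> \<one>}"

definition "edge_word e = (if t e = \<one> then [] else [t e])"

abbreviation "vlen u \<equiv> word_length (VG u) (Y u)"

text \<open>\<open>reads u p w\<close> means that \<open>w\<close> spells the labels and the arcs of \<open>p\<close>, a path from \<open>u\<close>. Neither argument
determines the other: labels have many spellings, and arcs with trivial image leave no trace in \<open>w\<close>.\<close>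

fun reads :: "'v \<Rightarrow> ('e, 'a) gpath \<Rightarrow> 'g list \<Rightarrow> bool" where
  "reads u (a, []) w \<longleftrightarrow> (\<exists>\<alpha> \<in> lists (Y u). word_value (VG u) \<alpha> = a \<and> w = map (\<iota> u) \<alpha>)"
| "reads u (a, (e, b) # s) w \<longleftrightarrow> (\<exists>\<alpha> \<in> lists (Y u). \<exists>w'. word_value (VG u) \<alpha> = a \<and>
     w = map (\<iota> u) \<alpha> @ edge_word e @ w' \<and> reads (hd_of e) (b, s) w')"

text \<open>The length of the shortest words that are read along a path.\<close>

fun cost :: "'v \<Rightarrow> ('e, 'a) gpath \<Rightarrow> nat" where
  "cost u (a, []) = vlen u a"
| "cost u (a, (e, b) # s) = vlen u a + length (edge_word e) + cost (hd_of e) (b, s)"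

lemma Y_carrier: "\<lbrakk>v \<in> V; y \<in> Y v\<rbrakk> \<Longrightarrow> y \<in> carrier (VG v)"
  by (rule marked_group.generator_in_carrier[OF marked_vertex])

lemma Y_value_closed [simp]: "\<lbrakk>v \<in> V; \<alpha> \<in> lists (Y v)\<rbrakk> \<Longrightarrow> word_value (VG v) \<alpha> \<in> carrier (VG v)"
  by (rule marked_group.value_closed[OF marked_vertex])

lemma \<iota>_closed [simp]: "\<lbrakk>v \<in> V; a \<in> carrier (VG v)\<rbrakk> \<Longrightarrow> \<iota> v a \<in> carrier G"
  using \<iota>_hom hom_in_carrier by metis

lemma \<iota>_mult: "\<lbrakk>v \<in> V; a \<in> carrier (VG v); b \<in> carrier (VG v)\<rbrakk>
    \<Longrightarrow> \<iota> v (a \<otimes>\<^bsub>VG v\<^esub> b) = \<iota> v a \<otimes> \<iota> v b"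
  using \<iota>_hom hom_mult by metis

lemma \<iota>_one [simp]: "v \<in> V \<Longrightarrow> \<iota> v \<one>\<^bsub>VG v\<^esub> = \<one>"
  using \<iota>_hom group_vertex hom_one G.is_group by metis

lemma letters_in_X: "\<lbrakk>u \<in> V; \<alpha> \<in> lists (Y u)\<rbrakk> \<Longrightarrow> map (\<iota> u) \<alpha> \<in> lists X"
  unfolding X_def in_lists_conv_set set_map by blast

lemma edge_word_in_X: "e \<in> E \<Longrightarrow> edge_word e \<in> lists X"
  by (auto simp: X_def edge_word_def)

lemma X_carrier: "X \<subseteq> carrier G"
  using Y_carrier by (auto simp: X_def)

lemma letters_value:
  "\<lbrakk>u \<in> V; \<alpha> \<in> lists (Y u)\<rbrakk> \<Longrightarrow> word_value G (map (\<iota> u) \<alpha>) = \<iota> u (word_value (VG u) \<alpha>)"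
  by (rule word_value_map_hom[OF group_vertex G.is_group \<iota>_hom])
    (auto intro: Y_carrier)

lemma edge_word_value [simp]: "e \<in> E \<Longrightarrow> word_value G (edge_word e) = t e"
  by (simp add: edge_word_def)

lemma X_value_append:
  "\<lbrakk>v \<in> lists X; w \<in> lists X\<rbrakk> \<Longrightarrow> word_value G (v @ w) = word_value G v \<otimes> word_value G w"
  using X_carrier by (intro G.word_value_append) auto

lemma reads_in_X: "\<lbrakk>reads u p w; p \<in> gpaths \<G> u v\<rbrakk> \<Longrightarrow> w \<in> lists X"
proof (induction u p arbitrary: w rule: gpath_induct)
  case (Nil u a)
  then show ?case using letters_in_X[of u] by auto
next
  case (Cons u a e c s)
  then obtain \<alpha> w' where "\<alpha> \<in> lists (Y u)" "w = map (\<iota> u) \<alpha> @ edge_word e @ w'" "reads (hd_of e) (c, s) w'"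
    by auto
  then show ?case using Cons letters_in_X[of u \<alpha>] edge_word_in_X[of e] by auto
qed

lemma reads_value: "\<lbrakk>reads u p w; p \<in> gpaths \<G> u v\<rbrakk> \<Longrightarrow> word_value G w = gpath_value G \<iota> t u p"
proof (induction u p arbitrary: w rule: gpath_induct)
  case (Nil u a)
  then show ?case using letters_value[of u] by auto
next
  case (Cons u a e c s)
  then obtain \<alpha> w' where r: "\<alpha> \<in> lists (Y u)" "word_value (VG u) \<alpha> = a"
      "w = map (\<iota> u) \<alpha> @ edge_word e @ w'" "reads (hd_of e) (c, s) w'"
    by auto
  have p: "e \<in> E" "u = tl_of e" "(c, s) \<in> gpaths \<G> (hd_of e) v" using Cons.prems by auto
  have u: "u \<in> V" using p by simp
  have w': "w' \<in> lists X" by (rule reads_in_X[OF r(4) p(3)])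
  then have "edge_word e @ w' \<in> lists X" using edge_word_in_X[OF p(1)] by simp
  then show ?case
    using r Cons.IH[OF r(4) p(3)] w' edge_word_in_X[OF p(1)] letters_in_X[OF u r(1)] letters_value[OF u r(1)] p(1)
    by (simp add: X_value_append del: append_assoc)
qed

lemma reads_of_length_cost: "p \<in> gpaths \<G> u v \<Longrightarrow> \<exists>w. reads u p w \<and> length w = cost u p"
proof (induction u p rule: gpath_induct)
  case (Nil u a)
  then have u: "u \<in> V" "a \<in> carrier (VG u)" by auto
  obtain \<alpha> where "\<alpha> \<in> lists (Y u)" "word_value (VG u) \<alpha> = a" "length \<alpha> = vlen u a"
    by (rule marked_group.geodesic_word_exists[OF marked_vertex[OF u(1)] u(2)])
  then show ?case by (intro exI[of _ "map (\<iota> u) \<alpha>"]) auto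
next
  case (Cons u a e c s)
  then have u: "u \<in> V" "a \<in> carrier (VG u)" by auto
  obtain \<alpha> where \<alpha>: "\<alpha> \<in> lists (Y u)" "word_value (VG u) \<alpha> = a" "length \<alpha> = vlen u a"
    by (rule marked_group.geodesic_word_exists[OF marked_vertex[OF u(1)] u(2)])
  obtain w where "reads (hd_of e) (c, s) w" "length w = cost (hd_of e) (c, s)" using Cons by auto
  with \<alpha> show ?case by (intro exI[of _ "map (\<iota> u) \<alpha> @ edge_word e @ w"]) auto
qed

sublocale marked: marked_group G X
proof (rule marked_group.intro[OF G.is_group], rule marked_group_axioms.intro)
  have "g \<in> word_value G ` lists X" if "g \<in> carrier G" for g
  proof -
    obtain p where p: "p \<in> gpaths \<G> v0 v0" "gpath_value G \<iota> t v0 p = g" using value_surj[OF \<open>g \<in> carrier G\<close>] by blast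
    obtain w where "reads v0 p w" using reads_of_length_cost[OF p(1)] by blast
    then have "w \<in> lists X" "g = word_value G w" using reads_in_X[OF _ p(1)] reads_value[OF _ p(1)] p(2) by auto
    then show ?thesis by blast
  qed
  then show "generating_set G X" using X_carrier by (auto simp: generating_set_def)
qed

lemma vlen_le: "\<lbrakk>u \<in> V; \<alpha> \<in> lists (Y u)\<rbrakk> \<Longrightarrow> vlen u (word_value (VG u) \<alpha>) \<le> length \<alpha>"
  by (rule marked_group.length_ge_word_length[OF marked_vertex])

lemma cost_le: "\<lbrakk>reads u p w; p \<in> gpaths \<G> u v\<rbrakk> \<Longrightarrow> cost u p \<le> length w"
proof (induction u p arbitrary: w rule: gpath_induct)
  case (Nil u a)
  then obtain \<alpha> where "\<alpha> \<in> lists (Y u)" "word_value (VG u) \<alpha> = a" "w = map (\<iota> u) \<alpha>" by auto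
  then show ?case using vlen_le[of u \<alpha>] Nil.prems(2) by auto
next
  case (Cons u a e c s)
  then obtain \<alpha> w' where r: "\<alpha> \<in> lists (Y u)" "word_value (VG u) \<alpha> = a"
      "w = map (\<iota> u) \<alpha> @ edge_word e @ w'" "reads (hd_of e) (c, s) w'"
    by auto
  then have "cost (hd_of e) (c, s) \<le> length w'" using Cons by auto
  moreover have "vlen u a \<le> length \<alpha>" using vlen_le[of u \<alpha>] r Cons.prems by auto
  ultimately show ?case using r(3) by simp
qed

lemma reads_translate:
  assumes "reads u (b, s) w" "u \<in> V" "b \<in> carrier (VG u)" "\<beta> \<in> lists (Y u)"
  shows "reads u (word_value (VG u) \<beta> \<otimes>\<^bsub>VG u\<^esub> b, s) (map (\<iota> u) \<beta> @ w)"
proof -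
  have app: "word_value (VG u) (\<beta> @ \<alpha>) = word_value (VG u) \<beta> \<otimes>\<^bsub>VG u\<^esub> word_value (VG u) \<alpha>"
    if "\<alpha> \<in> lists (Y u)" for \<alpha>
    by (rule marked_group.value_append[OF marked_vertex[OF assms(2)] assms(4) that])
  show ?thesis
  proof (cases s)
    case Nil
    then obtain \<alpha> where "\<alpha> \<in> lists (Y u)" "word_value (VG u) \<alpha> = b" "w = map (\<iota> u) \<alpha>"
      using assms(1) by auto
    then show ?thesis using Nil app assms(4) by (auto intro!: bexI[of _ "\<beta> @ \<alpha>"])
  next
    case (Cons ec s')
    obtain e c where ec: "ec = (e, c)" by fastforce
    then obtain \<alpha> w' where "\<alpha> \<in> lists (Y u)" "word_value (VG u) \<alpha> = b"
        "w = map (\<iota> u) \<alpha> @ edge_word e @ w'" "reads (hd_of e) (c, s') w'"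
      using assms(1) Cons by auto
    then show ?thesis using Cons ec app assms(4) by (auto intro!: bexI[of _ "\<beta> @ \<alpha>"])
  qed
qed

lemma reads_from_tree_neighbour:
  assumes "(u, v) \<in> {(tl_of e, hd_of e) |e. e \<in> E \<and> t e = \<one>}\<^sup>*" "\<exists>p \<in> gpaths \<G> v z. reads v p w"
  shows "\<exists>p \<in> gpaths \<G> u z. reads u p w"
  using assms
proof (induction rule: converse_rtrancl_induct)
  case (step x y)
  then obtain e where e: "e \<in> E" "t e = \<one>" "x = tl_of e" "y = hd_of e" by blast
  obtain a s where as: "(a, s) \<in> gpaths \<G> y z" "reads y (a, s) w" using step by auto
  have "(\<one>\<^bsub>VG x\<^esub>, (e, a) # s) \<in> gpaths \<G> x z" using e as by simp
  moreover have "reads x (\<one>\<^bsub>VG x\<^esub>, (e, a) # s) w"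
    using e as by (auto intro!: bexI[of _ "[]"] simp: edge_word_def)
  ultimately show ?case by blast
qed

text \<open>To read the next letter, first go to the vertex where it belongs along arcs with trivial image.\<close>

lemma word_is_read:
  assumes "w \<in> lists X" "u \<in> V"
  shows "\<exists>p \<in> gpaths \<G> u v0. reads u p w"
  using assms
proof (induction w arbitrary: u)
  case Nil
  have "reads v0 (\<one>\<^bsub>VG v0\<^esub>, []) []" by (auto intro!: bexI[of _ "[]"])
  moreover have "(\<one>\<^bsub>VG v0\<^esub>, []) \<in> gpaths \<G> v0 v0" using v0 by simp
  ultimately show ?case
    using reads_from_tree_neighbour[OF tree[OF Nil.prems(1) v0]] by blast
next
  case (Cons x w)
  from Cons.hyps(1) consider v y where "v \<in> V" "y \<in> Y v" "x = \<iota> v y"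
    | e where "e \<in> E" "t e \<noteq> \<one>" "x = t e" by (auto simp: X_def)
  then show ?case
  proof cases
    case 1
    obtain b s where bs: "(b, s) \<in> gpaths \<G> v v0" "reads v (b, s) w"
      using Cons.IH[OF 1(1)] by auto
    have b: "b \<in> carrier (VG v)" using gpaths_head[OF bs(1)] by simp
    have y: "y \<in> carrier (VG v)" "[y] \<in> lists (Y v)" using 1 Y_carrier by auto
    have "reads v (y \<otimes>\<^bsub>VG v\<^esub> b, s) (x # w)"
      using reads_translate[OF bs(2) 1(1) b y(2)] 1 y by simp
    moreover have "(y \<otimes>\<^bsub>VG v\<^esub> b, s) \<in> gpaths \<G> v v0"
      using gpaths_change_head[OF bs(1)] 1 b y by simp
    ultimately show ?thesis using reads_from_tree_neighbour[OF tree[OF Cons.prems 1(1)]] by blast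
  next
    case 2
    then have V: "tl_of e \<in> V" "hd_of e \<in> V" by auto
    obtain b s where bs: "(b, s) \<in> gpaths \<G> (hd_of e) v0" "reads (hd_of e) (b, s) w"
      using Cons.IH[OF V(2)] by auto
    have "reads (tl_of e) (\<one>\<^bsub>VG (tl_of e)\<^esub>, (e, b) # s) (x # w)"
      using 2 bs by (auto intro!: bexI[of _ "[]"] simp: edge_word_def)
    moreover have "(\<one>\<^bsub>VG (tl_of e)\<^esub>, (e, b) # s) \<in> gpaths \<G> (tl_of e) v0" using bs 2 by simp
    ultimately show ?thesis using reads_from_tree_neighbour[OF tree[OF Cons.prems V(1)]] by blast
  qed
qed

section \<open>Shortening a word\<close>

lemma edge_letters_rev: "\<lbrakk>e \<in> E; h \<in> carrier (EG e)\<rbrakk> \<Longrightarrow> emb (rv e) h \<in> Y (tl_of e)"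
  using edge_letters[of "rv e" h] by (simp add: edge_group_rev)

lemma emb_eq_one_iff: "\<lbrakk>e \<in> E; h \<in> carrier (EG e)\<rbrakk> \<Longrightarrow> emb e h = \<one>\<^bsub>VG (hd_of e)\<^esub> \<longleftrightarrow> h = \<one>\<^bsub>EG e\<^esub>"
  using inj_onD[OF emb_inj, of e h "\<one>\<^bsub>EG e\<^esub>"] by auto

lemma vlen_emb:
  assumes "e \<in> E" "h \<in> carrier (EG e)"
  shows "vlen (hd_of e) (emb e h) = (if h = \<one>\<^bsub>EG e\<^esub> then 0 else 1)"
proof -
  have V: "hd_of e \<in> V" using assms by simp
  have "vlen (hd_of e) (emb e h) \<le> 1"
    by (rule marked_group.word_length_generator[OF marked_vertex[OF V] edge_letters[OF assms]])
  moreover have "vlen (hd_of e) (emb e h) = 0 \<longleftrightarrow> h = \<one>\<^bsub>EG e\<^esub>"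
    using marked_group.word_length_eq_0_iff[OF marked_vertex[OF V]] emb_eq_one_iff[OF assms] assms by simp
  ultimately show ?thesis by auto
qed

lemma vlen_emb_rev:
  assumes "e \<in> E" "h \<in> carrier (EG e)"
  shows "vlen (tl_of e) (emb (rv e) h) = vlen (hd_of e) (emb e h)"
  using vlen_emb[of "rv e" h] vlen_emb[OF assms] assms by (simp add: edge_group_rev)

lemma t_rev:
  assumes "e \<in> E"
  shows "t (rv e) \<otimes> t e = \<one>" "t e \<otimes> t (rv e) = \<one>"
proof -
  have *: "t e \<otimes> t (rv e) = \<one>" if "e \<in> E" for e
    using edge_relation[OF that edge_one_closed[OF that]] that by simp
  show "t e \<otimes> t (rv e) = \<one>" using * assms .
  show "t (rv e) \<otimes> t e = \<one>" using *[of "rv e"] assms by simp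
qed

lemma edge_conjugation:
  assumes "e \<in> E" "h \<in> carrier (EG e)"
  shows "\<iota> (tl_of e) (emb (rv e) h) \<otimes> t e = t e \<otimes> \<iota> (hd_of e) (emb e h)"
proof -
  have c: "\<iota> (hd_of e) (emb e h) \<in> carrier G" using assms by simp
  have "\<iota> (tl_of e) (emb (rv e) h) \<otimes> t e = t e \<otimes> (\<iota> (hd_of e) (emb e h) \<otimes> (t (rv e) \<otimes> t e))"
    using assms c by (simp add: G.m_assoc flip: edge_relation)
  then show ?thesis using assms c by (simp add: t_rev)
qed

lemma shorten_vertex_word:
  assumes u: "u \<in> V" "\<alpha> \<in> lists (Y u)" "vlen u (word_value (VG u) \<alpha>) < length \<alpha>"
  obtains \<beta> where "\<beta> \<in> lists (Y u)" "word_value (VG u) \<beta> = word_value (VG u) \<alpha>" "length \<beta> < length \<alpha>"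
    "fellow G X K \<one> (map (\<iota> u) \<alpha>) (map (\<iota> u) \<beta>)"
proof -
  obtain \<beta> where \<beta>: "\<beta> \<in> lists (Y u)" "word_value (VG u) \<beta> = word_value (VG u) \<alpha>" "length \<beta> < length \<alpha>"
      "fellow (VG u) (Y u) K \<one>\<^bsub>VG u\<^esub> \<alpha> \<beta>"
    using vertex_fftp[OF u(1)] u(2,3) unfolding word_fftp_def by blast
  have "\<iota> u ` Y u \<subseteq> X" using u(1) by (auto simp: X_def)
  from fellow_map_hom[OF marked_vertex[OF u(1)] marked.marked_group_axioms \<iota>_hom[OF u(1)] this \<beta>(4) u(2) \<beta>(1)]
  show thesis using that \<beta> u(1) by simp
qed

lemma shorten_reading:
  "\<lbrakk>reads u p w; p \<in> gpaths \<G> u v; cost u p < length w\<rbrakk>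
    \<Longrightarrow> \<exists>q. reads u p q \<and> length q < length w \<and> fellow G X K \<one> w q"
proof (induction u p arbitrary: w rule: gpath_induct)
  case (Nil u a)
  then obtain \<alpha> where \<alpha>: "\<alpha> \<in> lists (Y u)" "word_value (VG u) \<alpha> = a" "w = map (\<iota> u) \<alpha>" by auto
  have u: "u \<in> V" "vlen u (word_value (VG u) \<alpha>) < length \<alpha>" using Nil \<alpha> by auto
  obtain \<beta> where "\<beta> \<in> lists (Y u)" "word_value (VG u) \<beta> = word_value (VG u) \<alpha>" "length \<beta> < length \<alpha>"
      "fellow G X K \<one> (map (\<iota> u) \<alpha>) (map (\<iota> u) \<beta>)"
    by (rule shorten_vertex_word[OF u(1) \<alpha>(1) u(2)])
  then show ?case using \<alpha> by (intro exI[of _ "map (\<iota> u) \<beta>"]) auto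
next
  case (Cons u a e c s)
  then obtain \<alpha> w' where r: "\<alpha> \<in> lists (Y u)" "word_value (VG u) \<alpha> = a"
      "w = map (\<iota> u) \<alpha> @ edge_word e @ w'" "reads (hd_of e) (c, s) w'"
    by auto
  have p: "e \<in> E" "u = tl_of e" "(c, s) \<in> gpaths \<G> (hd_of e) v" using Cons.prems by auto
  then have u: "u \<in> V" by simp
  have wX: "map (\<iota> u) \<alpha> \<in> lists X" "edge_word e \<in> lists X" "w' \<in> lists X"
    using letters_in_X[OF u r(1)] edge_word_in_X[OF p(1)] reads_in_X[OF r(4) p(3)] .
  consider "vlen u (word_value (VG u) \<alpha>) < length \<alpha>" | "cost (hd_of e) (c, s) < length w'"
    using Cons.prems(3) r by fastforce
  then show ?case
  proof cases
    case 1
    obtain \<beta> where \<beta>: "\<beta> \<in> lists (Y u)" "word_value (VG u) \<beta> = word_value (VG u) \<alpha>" "length \<beta> < length \<alpha>"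
        "fellow G X K \<one> (map (\<iota> u) \<alpha>) (map (\<iota> u) \<beta>)"
      by (rule shorten_vertex_word[OF u r(1) 1])
    have "fellow G X K \<one> ([] @ map (\<iota> u) \<alpha> @ edge_word e @ w') ([] @ map (\<iota> u) \<beta> @ edge_word e @ w')"
      using \<beta> wX letters_in_X[OF u \<beta>(1)] r(1) u
      by (intro marked.fellow_in_context) (simp_all add: letters_value)
    moreover have "reads u (a, (e, c) # s) (map (\<iota> u) \<beta> @ edge_word e @ w')"
      using \<beta> r by auto
    ultimately show ?thesis using \<beta>(3) r(3) by (intro exI[of _ "map (\<iota> u) \<beta> @ edge_word e @ w'"]) simp
  next
    case 2
    obtain q where q: "reads (hd_of e) (c, s) q" "length q < length w'" "fellow G X K \<one> w' q"
      using Cons.IH[OF r(4) p(3) 2] by blast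
    have qX: "q \<in> lists X" by (rule reads_in_X[OF q(1) p(3)])
    have "word_value G w' = word_value G q" using reads_value[OF _ p(3)] r(4) q(1) by simp
    then have "fellow G X K \<one> ((map (\<iota> u) \<alpha> @ edge_word e) @ w' @ []) ((map (\<iota> u) \<alpha> @ edge_word e) @ q @ [])"
      using q wX qX by (intro marked.fellow_in_context) simp_all
    moreover have "reads u (a, (e, c) # s) (map (\<iota> u) \<alpha> @ edge_word e @ q)" using r q by auto
    ultimately show ?thesis using q(2) r(3) by (intro exI[of _ "map (\<iota> u) \<alpha> @ edge_word e @ q"]) simp
  qed
qed

lemma backtrack_cost:
  assumes "e \<in> E" "h \<in> carrier (EG e)" "a \<in> carrier (VG (tl_of e))" "b \<in> carrier (VG (tl_of e))"
  shows "vlen (tl_of e) (a \<otimes>\<^bsub>VG (tl_of e)\<^esub> emb (rv e) h \<otimes>\<^bsub>VG (tl_of e)\<^esub> b)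
    \<le> vlen (tl_of e) a + vlen (hd_of e) (emb e h) + vlen (tl_of e) b"
proof -
  have "tl_of e \<in> V" using assms by simp
  then interpret M: marked_group "VG (tl_of e)" "Y (tl_of e)" by (rule marked_vertex)
  show ?thesis
    using M.word_length_mult[of "a \<otimes>\<^bsub>VG (tl_of e)\<^esub> emb (rv e) h" b] M.word_length_mult[of a "emb (rv e) h"]
      vlen_emb_rev[of e h] assms by simp
qed

text \<open>Cancelling a backtrack replaces \<open>emb e h\<close> by \<open>emb (rv e) h\<close>, and both have length \<open>0\<close> or \<open>1\<close> according
to whether \<open>h\<close> is trivial.\<close>

lemma reduce_cost: "\<lbrakk>gpath_reduce \<G> p q; p \<in> gpaths \<G> u v\<rbrakk> \<Longrightarrow> cost u q \<le> cost u p"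
proof (induction arbitrary: u rule: gpath_reduce.induct)
  case (here e h a b s)
  then have "(b, s) \<in> gpaths \<G> (tl_of e) v" "u = tl_of e" "a \<in> carrier (VG (tl_of e))" by auto
  then show ?case
    using backtrack_cost[of e h a b] here.hyps gpaths_head[of b s "tl_of e" v] by (cases s) auto
qed auto

text \<open>All labels are spelled geodesically because the length of \<open>w\<close> is the cost of \<open>p\<close>; in particular the label
of the backtrack is spelled by at most one letter. If \<open>t e\<close> is trivial, this letter represents the
same element of \<open>G\<close> at both ends of \<open>e\<close>, and \<open>w\<close> spells the reduced path as well. Otherwise the
letters for \<open>e\<close> and its reverse are saved.\<close>

lemma reads_reduce:
  "\<lbrakk>gpath_reduce \<G> p p'; p \<in> gpaths \<G> u v; reads u p w; length w = cost u p\<rbrakk>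
    \<Longrightarrow> reads u p' w \<or> (\<exists>q \<in> lists X. word_value G q = word_value G w \<and> length q < length w \<and> fellow G X 3 \<one> w q)"
proof (induction arbitrary: u w rule: gpath_reduce.induct)
  case (here e h a b s)
  note e = here.hyps
  have u: "u = tl_of e" "u \<in> V" and a: "a \<in> carrier (VG u)" and bs: "(b, s) \<in> gpaths \<G> u v"
    using here.prems(1) e by auto
  then have b: "b \<in> carrier (VG u)" using gpaths_head by blast
  obtain \<alpha> \<beta> w' where r: "\<alpha> \<in> lists (Y u)" "word_value (VG u) \<alpha> = a"
      "\<beta> \<in> lists (Y (hd_of e))" "word_value (VG (hd_of e)) \<beta> = emb e h"
      "reads u (b, s) w'"
      "w = map (\<iota> u) \<alpha> @ edge_word e @ map (\<iota> (hd_of e)) \<beta> @ edge_word (rv e) @ w'"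
    using here.prems(2) e u(1) by auto
  have V: "hd_of e \<in> V" using e by simp
  have "vlen u a \<le> length \<alpha>" "vlen (hd_of e) (emb e h) \<le> length \<beta>" "cost u (b, s) \<le> length w'"
    using vlen_le[OF u(2) r(1)] vlen_le[OF V r(3)] r cost_le[OF r(5) bs] by auto
  then have len\<beta>: "length \<beta> = vlen (hd_of e) (emb e h)"
    using here.prems(3) r(6) e u(1) by simp
  have eh: "emb (rv e) h \<in> carrier (VG u)" using e u by simp
  obtain \<gamma> where \<gamma>: "\<gamma> \<in> lists (Y u)" "word_value (VG u) \<gamma> = emb (rv e) h" "length \<gamma> = vlen u (emb (rv e) h)"
    by (rule marked_group.geodesic_word_exists[OF marked_vertex[OF u(2)] eh])
  have len: "length \<gamma> = length \<beta>" "length \<beta> \<le> 1"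
    using \<gamma>(3) len\<beta> u(1) e by (simp_all add: vlen_emb_rev vlen_emb)
  have wX: "map (\<iota> u) \<alpha> \<in> lists X" "map (\<iota> (hd_of e)) \<beta> \<in> lists X" "map (\<iota> u) \<gamma> \<in> lists X"
      "w' \<in> lists X" "edge_word e \<in> lists X" "edge_word (rv e) \<in> lists X"
    using letters_in_X u V r(1,3) \<gamma>(1) reads_in_X[OF r(5) bs] edge_word_in_X e(1) by auto
  show ?case
  proof (cases "t e = \<one>")
    case True
    then have te: "t (rv e) = \<one>" using t_rev(1)[OF e(1)] e(1) by simp
    \<comment> \<open>The letter for \<open>emb e h\<close> and the letter for \<open>emb (rv e) h\<close> are equal as elements of \<open>G\<close>.\<close>
    have same: "map (\<iota> (hd_of e)) \<beta> = map (\<iota> u) \<gamma>"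
    proof (cases \<beta>)
      case Nil
      then show ?thesis using len by simp
    next
      case (Cons y ys)
      then obtain z where yz: "\<beta> = [y]" "\<gamma> = [z]" using len by (cases \<gamma>; cases ys) auto
      then have "y \<in> carrier (VG (hd_of e))" "z \<in> carrier (VG u)" using r(3) \<gamma>(1) Y_carrier V u(2) by auto
      then have "y = emb e h" "z = emb (rv e) h" using yz r(4) \<gamma>(2) V u(2) by auto
      then show ?thesis
        using yz edge_relation[OF e] True te u(1) V e by simp
    qed
    have "reads u (emb (rv e) h \<otimes>\<^bsub>VG u\<^esub> b, s) (map (\<iota> u) \<gamma> @ w')"
      using reads_translate[OF r(5) u(2) b \<gamma>(1)] \<gamma>(2) by simp
    from reads_translate[OF this u(2) _ r(1)]
    have "reads u (a \<otimes>\<^bsub>VG u\<^esub> emb (rv e) h \<otimes>\<^bsub>VG u\<^esub> b, s) (map (\<iota> u) \<alpha> @ map (\<iota> u) \<gamma> @ w')"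
      using u eh a b r(2) by (simp add: vertex_m_assoc)
    moreover have "w = map (\<iota> u) \<alpha> @ map (\<iota> u) \<gamma> @ w'"
      using r(6) same True te by (simp add: edge_word_def)
    ultimately show ?thesis using u(1) by simp
  next
    case False
    then have te: "t (rv e) \<noteq> \<one>" using t_rev(1)[OF e(1)] e(1) by auto
    let ?m = "edge_word e @ map (\<iota> (hd_of e)) \<beta> @ edge_word (rv e)"
    have m: "?m \<in> lists X" using wX by simp
    have val: "word_value G ?m = word_value G (map (\<iota> u) \<gamma>)"
      using wX e edge_relation[OF e] letters_value[OF u(2) \<gamma>(1)] letters_value[OF V r(3)] r(4) \<gamma>(2) u(1)
      by (simp add: marked.value_append)
    have "fellow G X 3 \<one> ?m (map (\<iota> u) \<gamma>)"
      using len by (intro marked.fellow_same_value m wX val) (simp_all add: edge_word_def)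
    from marked.fellow_in_context[OF this val m wX(3,1,4)]
    have "fellow G X 3 \<one> w (map (\<iota> u) \<alpha> @ map (\<iota> u) \<gamma> @ w')" by (simp add: r(6))
    moreover have "word_value G (map (\<iota> u) \<alpha> @ ?m @ w') = word_value G (map (\<iota> u) \<alpha> @ map (\<iota> u) \<gamma> @ w')"
      using marked.value_append[OF m wX(4)] marked.value_append[OF wX(3,4)]
        marked.value_append[OF wX(1), of "?m @ w'"] marked.value_append[OF wX(1), of "map (\<iota> u) \<gamma> @ w'"]
        val m wX by simp
    then have "word_value G (map (\<iota> u) \<alpha> @ map (\<iota> u) \<gamma> @ w') = word_value G w" by (simp add: r(6))
    moreover have "length (map (\<iota> u) \<alpha> @ map (\<iota> u) \<gamma> @ w') < length w"
      using len False r(6) by (simp add: edge_word_def)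
    moreover have "map (\<iota> u) \<alpha> @ map (\<iota> u) \<gamma> @ w' \<in> lists X" using wX by simp
    ultimately show ?thesis by blast
  qed
next
  case (later c s c' s' a e)
  then obtain \<alpha> w' where r: "\<alpha> \<in> lists (Y u)" "word_value (VG u) \<alpha> = a"
      "w = map (\<iota> u) \<alpha> @ edge_word e @ w'" "reads (hd_of e) (c, s) w'"
    by auto
  have p: "e \<in> E" "u = tl_of e" "u \<in> V" "(c, s) \<in> gpaths \<G> (hd_of e) v" using later.prems by auto
  have "vlen u a \<le> length \<alpha>" "cost (hd_of e) (c, s) \<le> length w'"
    using vlen_le[OF p(3) r(1)] r cost_le[OF r(4) p(4)] by auto
  then have len: "length w' = cost (hd_of e) (c, s)" using later.prems(3) r(3) by simp
  have wX: "map (\<iota> u) \<alpha> @ edge_word e \<in> lists X" "w' \<in> lists X"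
    using letters_in_X[OF p(3) r(1)] edge_word_in_X[OF p(1)] reads_in_X[OF r(4) p(4)] by simp_all
  from later.IH[OF p(4) r(4) len] show ?case
  proof
    assume "reads (hd_of e) (c', s') w'"
    then show ?thesis using r by auto
  next
    assume "\<exists>q\<in>lists X. word_value G q = word_value G w' \<and> length q < length w' \<and> fellow G X 3 \<one> w' q"
    then obtain q where q: "q \<in> lists X" "word_value G q = word_value G w'" "length q < length w'"
        "fellow G X 3 \<one> w' q" by blast
    let ?c = "map (\<iota> u) \<alpha> @ edge_word e"
    have "fellow G X 3 \<one> (?c @ w' @ []) (?c @ q @ [])"
      using q wX by (intro marked.fellow_in_context) simp_all
    moreover have "word_value G (?c @ q) = word_value G (?c @ w')"
      using marked.value_append[OF wX(1)] q wX(2) by simp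
    moreover have "?c @ q \<in> lists X" using wX q by simp
    ultimately show ?thesis using q(3) r(3) by (intro disjI2 bexI[of _ "?c @ q"]) simp_all
  qed
qed

lemma gpath_value_closed: "p \<in> gpaths \<G> u v \<Longrightarrow> gpath_value G \<iota> t u p \<in> carrier G"
  by (induction u p rule: gpath_induct) auto

lemma gpath_value_translate:
  assumes "(b, s) \<in> gpaths \<G> u v" "x \<in> carrier (VG u)"
  shows "gpath_value G \<iota> t u (x \<otimes>\<^bsub>VG u\<^esub> b, s) = \<iota> u x \<otimes> gpath_value G \<iota> t u (b, s)"
proof (cases s)
  case Nil
  then have "u \<in> V" "b \<in> carrier (VG u)" using assms by auto
  then show ?thesis using Nil assms(2) by (simp add: \<iota>_mult)
next
  case (Cons ec s')
  obtain e c where "ec = (e, c)" by fastforce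
  then show ?thesis
    using assms Cons gpath_value_closed[of "(c, s')" "hd_of e" v] by (auto simp: \<iota>_mult G.m_assoc)
qed

lemma reduce_value:
  "\<lbrakk>gpath_reduce \<G> p q; p \<in> gpaths \<G> u v\<rbrakk> \<Longrightarrow> gpath_value G \<iota> t u q = gpath_value G \<iota> t u p"
proof (induction arbitrary: u rule: gpath_reduce.induct)
  case (here e h a b s)
  note e = here.hyps
  have u: "u = tl_of e" and a: "a \<in> carrier (VG (tl_of e))" and bs: "(b, s) \<in> gpaths \<G> (tl_of e) v"
    using here.prems e by auto
  let ?z = "gpath_value G \<iota> t (tl_of e) (b, s)" and ?x = "\<iota> (tl_of e) (emb (rv e) h)"
  have z: "?z \<in> carrier G" by (rule gpath_value_closed[OF bs])
  have c: "\<iota> (hd_of e) (emb e h) \<in> carrier G" "\<iota> (tl_of e) a \<in> carrier G" using e a by simp_all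
  have "gpath_value G \<iota> t u (a, (e, emb e h) # (rv e, b) # s)
      = \<iota> (tl_of e) a \<otimes> (t e \<otimes> (\<iota> (hd_of e) (emb e h) \<otimes> t (rv e)) \<otimes> ?z)"
    using e u c z by (simp add: G.m_assoc)
  also have "\<dots> = \<iota> (tl_of e) (a \<otimes>\<^bsub>VG (tl_of e)\<^esub> emb (rv e) h) \<otimes> ?z"
    using e a z by (simp add: edge_relation \<iota>_mult G.m_assoc)
  finally show ?case using gpath_value_translate[OF bs] e a u by simp
next
  case (later c s c' s' a e)
  then show ?case by auto
qed

text \<open>Both an element and its inverse are bounded because the generating sets need not be symmetric.\<close>

definition short :: "'v \<Rightarrow> 'a \<Rightarrow> bool" where
  "short u h \<longleftrightarrow> h \<in> carrier (VG u) \<and> vlen u h \<le> 1 \<and> vlen u (inv\<^bsub>VG u\<^esub> h) \<le> 1"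

lemma short_one: "u \<in> V \<Longrightarrow> short u \<one>\<^bsub>VG u\<^esub>"
  using marked_group.word_length_one[OF marked_vertex] monoid.inv_one[OF group.is_monoid[OF group_vertex]]
  by (simp add: short_def)

lemma short_emb:
  assumes "e \<in> E" "h \<in> carrier (EG e)"
  shows "short (hd_of e) (emb e h)"
  using assms vlen_emb[of e] group_hom.hom_inv[OF emb_group_hom, of e h, symmetric]
  by (simp add: short_def)

lemma short_emb_rev: "\<lbrakk>e \<in> E; h \<in> carrier (EG e)\<rbrakk> \<Longrightarrow> short (tl_of e) (emb (rv e) h)"
  using short_emb[of "rv e" h] by (simp add: edge_group_rev)

lemma push_letters:
  assumes u: "u \<in> V" and \<alpha>: "\<alpha> \<in> lists (Y u)" "length \<alpha> = vlen u (word_value (VG u) \<alpha>)"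
    and a: "a \<in> carrier (VG u)" "h \<otimes>\<^bsub>VG u\<^esub> a = word_value (VG u) \<alpha> \<otimes>\<^bsub>VG u\<^esub> k"
    and short: "short u h" "short u k"
  obtains \<beta> where "\<beta> \<in> lists (Y u)" "word_value (VG u) \<beta> = a" "length \<beta> = vlen u a"
    "fellow G X (4 * K + 1) (\<iota> u h) (map (\<iota> u) \<alpha>) (map (\<iota> u) \<beta>)"
proof -
  have h: "h \<in> carrier (VG u)" "vlen u h \<le> 1" "vlen u (inv\<^bsub>VG u\<^esub> h) \<le> 1"
    and k: "k \<in> carrier (VG u)" "vlen u k \<le> 1" "vlen u (inv\<^bsub>VG u\<^esub> k) \<le> 1"
    using short by (auto simp: short_def)
  obtain \<beta> where \<beta>: "\<beta> \<in> lists (Y u)" "word_value (VG u) \<beta> = a" "length \<beta> = vlen u a"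
      "fellow (VG u) (Y u) (4 * K + 1) h \<alpha> \<beta>"
    by (rule marked_group.geodesic_push[OF marked_vertex[OF u] vertex_fftp[OF u] \<alpha> a h k])
  have "\<iota> u ` Y u \<subseteq> X" using u by (auto simp: X_def)
  from fellow_map_hom[OF marked_vertex[OF u] marked.marked_group_axioms \<iota>_hom[OF u] this \<beta>(4) \<alpha>(1) \<beta>(1) h(1)]
  show thesis using that \<beta> by simp
qed

text \<open>Crossing \<open>e\<close> turns the offset \<open>emb (rv e) h\<close> into \<open>emb e h\<close>, and each of these is a letter.\<close>

lemma edge_word_fellow:
  assumes e: "e \<in> E" and h: "h \<in> carrier (EG e)"
  shows "fellow G X 1 (\<iota> (tl_of e) (emb (rv e) h)) (edge_word e) (edge_word e)"
  unfolding fellow_def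
proof (rule async_fellow_travelI[where \<phi> = "\<lambda>t. t" and \<psi> = "\<lambda>t. t"])
  let ?x = "\<iota> (tl_of e) (emb (rv e) h)" and ?y = "\<iota> (hd_of e) (emb e h)"
  have xy: "?x \<in> carrier G" "?y \<in> carrier G" using e h by simp_all
  have X: "?x \<in> X" "?y \<in> X" using edge_letters[OF e h] edge_letters_rev[OF e h] e by (auto simp: X_def)
  have "word_dist G X \<one> (?x \<otimes> \<one>) \<le> 1"
    using marked.word_length_generator[OF X(1)] xy by (simp add: word_dist_def)
  moreover have "word_dist G X (t e) (?x \<otimes> t e) \<le> 1"
    using marked.word_length_generator[OF X(2)] xy e h by (simp add: word_dist_def edge_conjugation)
  moreover have "take i (edge_word e) = [] \<or> take i (edge_word e) = edge_word e" for i
    by (cases i) (simp_all add: edge_word_def)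
  ultimately show *: "word_dist G X (word_value G (take i (edge_word e))) (?x \<otimes> word_value G (take i (edge_word e))) \<le> 1" for i
    using e by (metis edge_word_value word_value_Nil)
  show "word_dist G X (word_value G (take i (edge_word e))) (?x \<otimes> word_value G (take i (edge_word e))) \<le> 1" for i
    by (rule *)
qed (simp_all add: mono_def)

text \<open>A word that spells \<open>p\<close> geodesically is followed by a geodesic spelling of any path related to \<open>p\<close> by
sliding. The statement allows an initial offset \<open>h\<close> because this is what sliding leaves behind after
crossing an arc.\<close>

lemma slide_reading:
  "\<lbrakk>slide_eq p r; p \<in> gpaths \<G> u v; (a', s') \<in> gpaths \<G> u v; r = (h \<otimes>\<^bsub>VG u\<^esub> a', s'); short u h;
    reads u p w; length w = cost u p\<rbrakk>
    \<Longrightarrow> \<exists>q. reads u (a', s') q \<and> length q = cost u (a', s') \<and> fellow G X (4 * K + 1) (\<iota> u h) w q"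
proof (induction arbitrary: u a' s' h w rule: slide_eq.induct)
  case (Nil a)
  then have u: "u \<in> V" "a' \<in> carrier (VG u)" and s': "s' = []" "a = h \<otimes>\<^bsub>VG u\<^esub> a'" "a \<in> carrier (VG u)" by auto
  obtain \<alpha> where \<alpha>: "\<alpha> \<in> lists (Y u)" "word_value (VG u) \<alpha> = a" "w = map (\<iota> u) \<alpha>"
    using Nil.prems(5) by auto
  have "h \<otimes>\<^bsub>VG u\<^esub> a' = word_value (VG u) \<alpha> \<otimes>\<^bsub>VG u\<^esub> \<one>\<^bsub>VG u\<^esub>" using \<alpha> s' u by simp
  moreover have "length \<alpha> = vlen u (word_value (VG u) \<alpha>)" using \<alpha> Nil.prems(6) by simp
  ultimately obtain \<beta> where "\<beta> \<in> lists (Y u)" "word_value (VG u) \<beta> = a'" "length \<beta> = vlen u a'"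
    "fellow G X (4 * K + 1) (\<iota> u h) (map (\<iota> u) \<alpha>) (map (\<iota> u) \<beta>)"
    using push_letters[OF u(1) \<alpha>(1) _ u(2) _ Nil.prems(4) short_one[OF u(1)]] by blast
  then show ?case using s'(1) \<alpha>(3) by (intro exI[of _ "map (\<iota> u) \<beta>"]) auto
next
  case (Cons k e b s b' t' a)
  have e: "e \<in> E" "u = tl_of e" "u \<in> V" "a \<in> carrier (VG u)" and bs: "(b, s) \<in> gpaths \<G> (hd_of e) v"
    using Cons.prems(1) by auto
  have s': "s' = (e, b') # t'" and ha: "h \<otimes>\<^bsub>VG u\<^esub> a' = a \<otimes>\<^bsub>VG u\<^esub> emb (rv e) k"
    using Cons.prems(3) e(2) by auto
  have a': "a' \<in> carrier (VG u)" and bt: "(b', t') \<in> gpaths \<G> (hd_of e) v"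
    using Cons.prems(2) e(2) by (auto simp: s')
  obtain \<alpha> w' where r: "\<alpha> \<in> lists (Y u)" "word_value (VG u) \<alpha> = a"
      "w = map (\<iota> u) \<alpha> @ edge_word e @ w'" "reads (hd_of e) (b, s) w'"
    using Cons.prems(5) by auto
  have "vlen u a \<le> length \<alpha>" "cost (hd_of e) (b, s) \<le> length w'"
    using vlen_le[OF e(3) r(1)] r cost_le[OF r(4) bs] by auto
  then have len: "length w' = cost (hd_of e) (b, s)" "length \<alpha> = vlen u (word_value (VG u) \<alpha>)"
    using Cons.prems(6) r(2,3) by auto
  obtain q' where q': "reads (hd_of e) (b', t') q'" "length q' = cost (hd_of e) (b', t')"
      "fellow G X (4 * K + 1) (\<iota> (hd_of e) (emb e k)) w' q'"
    using Cons.IH[OF bs bt refl short_emb[OF e(1) Cons.hyps(1)] r(4) len(1)] by blast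
  have "h \<otimes>\<^bsub>VG u\<^esub> a' = word_value (VG u) \<alpha> \<otimes>\<^bsub>VG u\<^esub> emb (rv e) k" using ha r(2) by simp
  moreover have "short u (emb (rv e) k)" using short_emb_rev[OF e(1) Cons.hyps(1)] e(2) by simp
  ultimately obtain \<beta> where \<beta>: "\<beta> \<in> lists (Y u)" "word_value (VG u) \<beta> = a'" "length \<beta> = vlen u a'"
    "fellow G X (4 * K + 1) (\<iota> u h) (map (\<iota> u) \<alpha>) (map (\<iota> u) \<beta>)"
    using push_letters[OF e(3) r(1) len(2) a' _ Cons.prems(4)] by blast
  have wX: "map (\<iota> u) \<alpha> \<in> lists X" "map (\<iota> u) \<beta> \<in> lists X" "edge_word e \<in> lists X" "w' \<in> lists X" "q' \<in> lists X"
    using letters_in_X[OF e(3)] r(1) \<beta>(1) edge_word_in_X[OF e(1)] reads_in_X[OF r(4) bs] reads_in_X[OF q'(1) bt]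
    by simp_all
  have h: "h \<in> carrier (VG u)" using Cons.prems(4) by (simp add: short_def)
  have k: "emb (rv e) k \<in> carrier (VG u)" "emb e k \<in> carrier (VG (hd_of e))"
    using e Cons.hyps(1) by simp_all
  have "fellow G X 1 (\<iota> u (emb (rv e) k)) (edge_word e) (edge_word e)"
    using edge_word_fellow[OF e(1) Cons.hyps(1)] e(2) by simp
  then have ee: "fellow G X (4 * K + 1) (\<iota> u (emb (rv e) k)) (edge_word e) (edge_word e)"
    by (rule fellow_mono) simp
  have tail: "fellow G X (4 * K + 1) (\<iota> u (emb (rv e) k)) (edge_word e @ w') (edge_word e @ q')"
    using marked.fellow_append[OF ee q'(3)] edge_conjugation[OF e(1) Cons.hyps(1)] wX k e by simp
  have "\<iota> u h \<otimes> word_value G (map (\<iota> u) \<beta>) = word_value G (map (\<iota> u) \<alpha>) \<otimes> \<iota> u (emb (rv e) k)"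
    using ha h k a' e r(1,2) \<beta>(1,2) by (simp add: letters_value flip: \<iota>_mult)
  from marked.fellow_append[OF \<beta>(4) tail this wX(1,2)]
  have "fellow G X (4 * K + 1) (\<iota> u h) w (map (\<iota> u) \<beta> @ edge_word e @ q')"
    unfolding r(3) using wX \<iota>_closed[OF e(3) h] \<iota>_closed[OF e(3) k(1)] by simp
  then show ?case using q' \<beta> s' by (intro exI[of _ "map (\<iota> u) \<beta> @ edge_word e @ q'"]) auto
qed

text \<open>Induction on the number of arcs of the path along which \<open>w\<close> is read. The constant is
\<open>4 * K + 3\<close> as it has to cover \<open>K\<close> for shortening a label, \<open>3\<close> for cancelling a backtrack of three
letters, and \<open>4 * K + 1\<close> for sliding.\<close>

lemma nongeodesic_word_shortened:
  "\<lbrakk>p \<in> gpaths \<G> v0 v0; reads v0 p w; word_length G X (word_value G w) < length w\<rbrakk>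
    \<Longrightarrow> \<exists>q \<in> lists X. word_value G q = word_value G w \<and> length q < length w \<and> fellow G X (4 * K + 3) \<one> w q"
proof (induction "length (snd p)" arbitrary: p rule: less_induct)
  case less
  note p = less.prems(1,2)
  have w: "w \<in> lists X" by (rule reads_in_X[OF p(2,1)])
  consider "cost v0 p < length w" | p' where "length w = cost v0 p" "gpath_reduce \<G> p p'"
    | "length w = cost v0 p" "irreducible p"
    using cost_le[OF p(2,1)] unfolding irreducible_def by fastforce
  then show ?case
  proof cases
    case 1
    then obtain q where q: "reads v0 p q" "length q < length w" "fellow G X K \<one> w q"
      using shorten_reading[OF p(2,1)] by blast
    then show ?thesis
      using reads_value[OF _ p(1)] reads_in_X[OF q(1) p(1)] p(2) fellow_mono[OF q(3), of "4 * K + 3"] by auto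
  next
    case 2
    from reads_reduce[OF 2(2) p(1,2) 2(1)] show ?thesis
    proof
      assume "reads v0 p' w"
      then show ?thesis
        using less.hyps[OF reduce_length[OF 2(2)] reduce_gpaths[OF 2(2) p(1)]] less.prems(3) by blast
    next
      assume "\<exists>q\<in>lists X. word_value G q = word_value G w \<and> length q < length w \<and> fellow G X 3 \<one> w q"
      then show ?thesis using fellow_mono[of G X 3 \<one> w _ "4 * K + 3"] by auto
    qed
  next
    case 3
    obtain q0 where q0: "q0 \<in> lists X" "word_value G q0 = word_value G w"
        "length q0 = word_length G X (word_value G w)"
      by (rule marked.geodesic_word_exists[OF marked.value_closed[OF w]])
    obtain p0 where p0: "p0 \<in> gpaths \<G> v0 v0" "reads v0 p0 q0" using word_is_read[OF q0(1) v0] by blast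
    have "gpath_value G \<iota> t v0 p = gpath_value G \<iota> t v0 p0"
      using reads_value[OF p(2,1)] reads_value[OF p0(2,1)] q0(2) by simp
    then obtain p1 where p1: "(gpath_reduce \<G>)\<^sup>*\<^sup>* p0 p1" "slide_eq p p1"
      using homotopic_irreducible[OF value_faithful[OF p(1) p0(1)] 3(2)] by blast
    \<comment> \<open>The reduced loop \<open>p1\<close> is at most as expensive as the geodesic word, hence cheaper than \<open>w\<close>.\<close>
    have "p1 \<in> gpaths \<G> v0 v0 \<and> cost v0 p1 \<le> cost v0 p0"
      using p1(1)
    proof (induction rule: rtranclp_induct)
      case (step y z)
      then show ?case using reduce_cost reduce_gpaths by (meson order_trans)
    qed (use p0 in simp)
    moreover obtain a s where as: "p1 = (a, s)" by fastforce
    ultimately have as_v: "(a, s) \<in> gpaths \<G> v0 v0" and "cost v0 (a, s) \<le> cost v0 p0" by auto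
    then have cost: "cost v0 (a, s) < length w"
      using cost_le[OF p0(2,1)] q0(3) less.prems(3) by simp
    have "(a, s) = (\<one>\<^bsub>VG v0\<^esub> \<otimes>\<^bsub>VG v0\<^esub> a, s)" using gpaths_head[OF as_v] by simp
    from slide_reading[OF p1(2)[unfolded as] p(1) as_v this short_one[OF v0] p(2) 3(1)]
    obtain q where q: "reads v0 (a, s) q" "length q = cost v0 (a, s)" "fellow G X (4 * K + 1) \<one> w q"
      using v0 by auto
    have "gpath_value G \<iota> t v0 p1 = gpath_value G \<iota> t v0 p0"
      using p1(1)
    proof (induction rule: rtranclp_induct)
      case (step y z)
      then show ?case using reduce_value[OF step.hyps(2) reduces_gpaths[OF step.hyps(1) p0(1)]] by simp
    qed simp
    then have "word_value G q = word_value G w"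
      using reads_value[OF q(1) as_v] reads_value[OF p0(2,1)] q0(2) as by simp
    then show ?thesis
      using q reads_in_X[OF q(1) as_v] cost fellow_mono[OF q(3), of "4 * K + 3"] by auto
  qed
qed

theorem has_fftp_of_finite_letters:
  assumes "finite X"
  shows "has_fftp G"
proof -
  have "word_fftp G X (4 * K + 3)"
    unfolding word_fftp_def
  proof (intro ballI impI)
    fix w assume w: "w \<in> lists X" "word_length G X (word_value G w) < length w"
    obtain p where "p \<in> gpaths \<G> v0 v0" "reads v0 p w" using word_is_read[OF w(1) v0] by blast
    then show "\<exists>q \<in> lists X. word_value G q = word_value G w \<and> length q < length w \<and> fellow G X (4 * K + 3) \<one> w q"
      using w(2) by (rule nongeodesic_word_shortened)
  qed
  then have "fftp_wrt G X" using marked.fftp_wrt_iff_word_fftp by blast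
  then show ?thesis unfolding has_fftp_def using assms marked.generating by blast
qed

end

theorem corollary1p4:
  fixes \<G> :: "('v, 'e, 'a, 'b) gog" and v0 :: 'v and G :: "'g monoid"
  assumes "graph_of_groups \<G>"
    and "fin_digraph (base \<G>)"
    and "\<And>v. v \<in> verts (base \<G>) \<Longrightarrow> has_fftp (vertex_group \<G> v)"
    and "\<And>e. e \<in> arcs (base \<G>) \<Longrightarrow> finite (carrier (edge_group \<G> e))"
    and "v0 \<in> verts (base \<G>)"
    and "group G"
    and "G \<cong> fundamental_group \<G> v0"
  shows "has_fftp G"
proof -
  interpret graph_of_groups \<G> by (rule assms(1))
  interpret fin_digraph "base \<G>" by (rule assms(2))
  define F where "F v = (\<Union>e \<in> {e \<in> E. hd_of e = v}. emb e ` carrier (EG e))" for v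
  let ?Q = "\<lambda>v Y K. finite Y \<and> marked_group (VG v) Y \<and> F v \<subseteq> Y \<and> word_fftp (VG v) Y K"
  have ex: "\<forall>v \<in> V. \<exists>Y K. ?Q v Y K"
  proof
    fix v assume v: "v \<in> V"
    have "finite (F v)" "F v \<subseteq> carrier (VG v)" using assms(4) by (auto simp: F_def)
    from fftp_generators_containing[OF group_vertex[OF v] assms(3)[OF v] this]
    show "\<exists>Y K. ?Q v Y K" by blast
  qed
  obtain Y where exY: "\<forall>v \<in> V. \<exists>K. ?Q v (Y v) K" using bchoice[OF ex] by blast
  obtain L where YL: "\<forall>v \<in> V. ?Q v (Y v) (L v)" using bchoice[OF exY] by blast
  have Y: "finite (Y v)" "marked_group (VG v) (Y v)" "F v \<subseteq> Y v" "word_fftp (VG v) (Y v) (L v)"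
    if "v \<in> V" for v
    using YL that by simp_all
  define K where "K = Max (L ` V)"
  have fftp: "word_fftp (VG v) (Y v) K" if "v \<in> V" for v
    using that by (intro word_fftp_mono[OF Y(4)]) (simp_all add: K_def)
  have letters: "emb e h \<in> Y (hd_of e)" if "e \<in> E" "h \<in> carrier (EG e)" for e h
  proof -
    have "emb e h \<in> F (hd_of e)" using that by (auto simp: F_def)
    then show ?thesis using Y(3)[of "hd_of e"] that by auto
  qed
  obtain \<iota> t where "pi1_presentation \<G> G v0 \<iota> t"
    using fundamental_group_presentation[OF assms(5-7)] by blast
  then interpret generated_pi1 \<G> G v0 \<iota> t Y K
    by (rule generated_pi1.intro) (rule generated_pi1_axioms.intro[OF Y(2) letters fftp])
  have "finite X" using Y(1) by (simp add: X_def)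
  then show ?thesis by (rule has_fftp_of_finite_letters)
qed

end
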